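(* Let $G$ be an infinite compact abelian group with dual group $\varGamma$ and let $\varLambda \subset \varGamma$. If $C_{\varGamma\setminus\varLambda^{-1}}(G)$ is a rich subspace of $C(G)$, then the quotient space $L^1(G)/L^1_\varLambda(G)$ has the Daugavet property.
   Context: $\varGamma$ is the (discrete) group of continuous homomorphisms $G \to \mathbb T$, $\varLambda^{-1} = \{\gamma^{-1} : \gamma \in \varLambda\}$ where $\gamma^{-1} = \overline\gamma$; $m$ is the normalized Haar measure on $G$; $L^1(G) = L^1(G,m)$ and $C(G)$ (sup norm) consist of complex-valued functions. $\hat f(\gamma) = \int_G f\overline\gamma\,dm$. For $\varTheta\subset\varGamma$, $C_\varTheta(G)$ (resp. $L^1_\varTheta(G)$) is the set of $f$ in $C(G)$ (resp. $L^1(G)$) with $\hat f(\gamma) = 0$ for all $\gamma \in \varGamma\setminus\varTheta$. A Banach space $X$ has the Daugavet property if every bounded rank-one operator $T: X \to X$ satisfies $\|\mathrm{Id}+T\| = 1 + \|T\|$. ($C(G)$ has the Daugavet property.) If $X$ has the Daugavet property and $E$ is a Banach space, a bounded linear operator $T: X\to E$ is narrow if for all $x,y \in S_X$ (unit sphere), $x^*\in X^*$, $\varepsilon>0$ there is $z \in S_X$ with $\|T(y-z)\| + |x^*(y-z)| \le \varepsilon$ and $\|x+z\| \ge 2-\varepsilon$. A closed subspace $Y$ of $X$ is rich if the quotient map $X \to X/Y$ is narrow. *)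

theory Defs
  imports "HOL-Analysis.Analysis" "HOL-Algebra.Module" "HOL-Algebra.AbelCoset"
begin

text \<open>
  Complex Banach spaces are carrier-based here: a module over the complex numbers in the sense of
  HOL-Algebra, extended by a norm. This allows quotients by a subspace that depends on term
  variables. The ring fields \<open>mult\<close> and \<open>one\<close>, which every module record inherits, are not used by
  the locale \<open>module\<close>; they are left undefined except for the scalars.
\<close>

record 'v normed_module = "(complex, 'v) module" +
  nrm :: "'v \<Rightarrow> real"

text \<open>The field of complex numbers, serving both as the scalar ring and as the one-dimensional
  Banach space in which functionals take their values.\<close>

definition complex_scalars :: "complex normed_module" where
  "complex_scalars =
     \<lparr>carrier = UNIV, mult = (*), one = 1, zero = 0, add = (+), smult = (*), nrm = cmod\<rparr>"

locale complex_normed_space = module complex_scalars X for X :: "'v normed_module" (structure) +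
  assumes nrm_nonneg: "x \<in> carrier X \<Longrightarrow> 0 \<le> nrm X x"
    and nrm_eq_0: "x \<in> carrier X \<Longrightarrow> nrm X x = 0 \<longleftrightarrow> x = \<zero>"
    and nrm_triangle: "x \<in> carrier X \<Longrightarrow> y \<in> carrier X \<Longrightarrow> nrm X (x \<oplus> y) \<le> nrm X x + nrm X y"
    and nrm_smult: "x \<in> carrier X \<Longrightarrow> nrm X (c \<odot> x) = cmod c * nrm X x"

locale complex_banach_space = complex_normed_space +
  assumes complete:
    "(\<And>n. s n \<in> carrier X) \<Longrightarrow>
     (\<And>e. e > 0 \<Longrightarrow> \<exists>N. \<forall>m\<ge>N. \<forall>n\<ge>N. nrm X (s m \<ominus> s n) < e) \<Longrightarrow>
     \<exists>l\<in>carrier X. (\<lambda>n. nrm X (s n \<ominus> l)) \<longlonglongrightarrow> 0"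

definition unit_sphere :: "'v normed_module \<Rightarrow> 'v set" where
  "unit_sphere X = {x \<in> carrier X. nrm X x = 1}"

definition closed_subspace :: "'v set \<Rightarrow> 'v normed_module \<Rightarrow> bool" where
  "closed_subspace Y X \<longleftrightarrow> submodule Y complex_scalars X \<and>
     (\<forall>s. \<forall>l\<in>carrier X. (\<forall>n. s n \<in> Y) \<longrightarrow> (\<lambda>n. nrm X (s n \<ominus>\<^bsub>X\<^esub> l)) \<longlonglongrightarrow> 0 \<longrightarrow> l \<in> Y)"

definition bounded_operator ::
  "'v normed_module \<Rightarrow> 'w normed_module \<Rightarrow> ('v \<Rightarrow> 'w) \<Rightarrow> bool" where
  "bounded_operator X E T \<longleftrightarrow>
     (\<forall>x\<in>carrier X. T x \<in> carrier E) \<and>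
     (\<forall>x\<in>carrier X. \<forall>y\<in>carrier X. T (x \<oplus>\<^bsub>X\<^esub> y) = T x \<oplus>\<^bsub>E\<^esub> T y) \<and>
     (\<forall>c. \<forall>x\<in>carrier X. T (c \<odot>\<^bsub>X\<^esub> x) = c \<odot>\<^bsub>E\<^esub> T x) \<and>
     (\<exists>K. \<forall>x\<in>carrier X. nrm E (T x) \<le> K * nrm X x)"

definition operator_norm ::
  "'v normed_module \<Rightarrow> 'w normed_module \<Rightarrow> ('v \<Rightarrow> 'w) \<Rightarrow> real" where
  "operator_norm X E T = (SUP x\<in>{x \<in> carrier X. nrm X x \<le> 1}. nrm E (T x))"

definition dual_space :: "'v normed_module \<Rightarrow> ('v \<Rightarrow> complex) set" where
  "dual_space X = {\<phi>. bounded_operator X complex_scalars \<phi>}"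

definition rank_one :: "'v normed_module \<Rightarrow> 'w normed_module \<Rightarrow> ('v \<Rightarrow> 'w) \<Rightarrow> bool" where
  "rank_one X E T \<longleftrightarrow>
     (\<exists>u\<in>carrier E. u \<noteq> \<zero>\<^bsub>E\<^esub> \<and> T ` carrier X = range (\<lambda>c. c \<odot>\<^bsub>E\<^esub> u))"

definition daugavet_property :: "'v normed_module \<Rightarrow> bool" where
  "daugavet_property X \<longleftrightarrow> complex_banach_space X \<and>
     (\<forall>T. bounded_operator X X T \<and> rank_one X X T \<longrightarrow>
          operator_norm X X (\<lambda>x. x \<oplus>\<^bsub>X\<^esub> T x) = 1 + operator_norm X X T)"

text \<open>The elements of the quotient are the cosets of \<open>Y\<close>. In the scalar multiplication, adding \<open>Y\<close>
  only matters for \<open>c = 0\<close>. The definition also makes sense for a seminormed \<open>X\<close>.\<close>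

definition quotient_space :: "'v normed_module \<Rightarrow> 'v set \<Rightarrow> 'v set normed_module" where
  "quotient_space X Y =
     \<lparr>carrier = a_rcosets\<^bsub>X\<^esub> Y, mult = undefined, one = undefined,
      zero = Y, add = (\<lambda>A B. A <+>\<^bsub>X\<^esub> B), smult = (\<lambda>c A. \<Union>a\<in>A. Y +>\<^bsub>X\<^esub> (c \<odot>\<^bsub>X\<^esub> a)),
      nrm = (\<lambda>A. INF a\<in>A. nrm X a)\<rparr>"

text \<open>Narrow operators are considered on spaces \<open>X\<close> with the Daugavet property only; this
  standing assumption is not repeated in this definition.\<close>

definition narrow_operator ::
  "'v normed_module \<Rightarrow> 'w normed_module \<Rightarrow> ('v \<Rightarrow> 'w) \<Rightarrow> bool" where
  "narrow_operator X E T \<longleftrightarrow> bounded_operator X E T \<and>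
     (\<forall>x\<in>unit_sphere X. \<forall>y\<in>unit_sphere X. \<forall>\<phi>\<in>dual_space X. \<forall>\<epsilon>>0.
        \<exists>z\<in>unit_sphere X.
          nrm E (T (y \<ominus>\<^bsub>X\<^esub> z)) + cmod (\<phi> (y \<ominus>\<^bsub>X\<^esub> z)) \<le> \<epsilon> \<and>
          nrm X (x \<oplus>\<^bsub>X\<^esub> z) \<ge> 2 - \<epsilon>)"

definition rich_subspace :: "'v set \<Rightarrow> 'v normed_module \<Rightarrow> bool" where
  "rich_subspace Y X \<longleftrightarrow> closed_subspace Y X \<and>
     narrow_operator X (quotient_space X Y) (\<lambda>x. Y +>\<^bsub>X\<^esub> x)"

text \<open>The compact abelian group is a type of class \<open>topological_ab_group_add\<close>, hence written
  additively. Since it need not be metrizable, regularity is part of the definition of Haar measure;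
  for a finite measure on the Borel sets of a compact Hausdorff space, inner regularity
  implies outer regularity.\<close>

definition normalized_haar_measure :: "'g::topological_ab_group_add measure \<Rightarrow> bool" where
  "normalized_haar_measure m \<longleftrightarrow>
     sets m = sets borel \<and>
     emeasure m UNIV = 1 \<and>
     (\<forall>a. \<forall>A\<in>sets borel. emeasure m ((\<lambda>x. a + x) ` A) = emeasure m A) \<and>
     (\<forall>A\<in>sets borel. emeasure m A = (SUP K\<in>{K. compact K \<and> K \<subseteq> A}. emeasure m K))"

definition dual_group :: "('g::topological_ab_group_add \<Rightarrow> complex) set" where
  "dual_group = {\<gamma>. continuous_on UNIV \<gamma> \<and> (\<forall>x. cmod (\<gamma> x) = 1) \<and>
                    (\<forall>x y. \<gamma> (x + y) = \<gamma> x * \<gamma> y)}"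

definition inverse_characters ::
  "('g::topological_ab_group_add \<Rightarrow> complex) set \<Rightarrow> ('g \<Rightarrow> complex) set" where
  "inverse_characters \<Lambda> = (\<lambda>\<gamma> x. cnj (\<gamma> x)) ` \<Lambda>"

definition fourier_coeff ::
  "'g::topological_ab_group_add measure \<Rightarrow> ('g \<Rightarrow> complex) \<Rightarrow> ('g \<Rightarrow> complex) \<Rightarrow> complex" where
  "fourier_coeff m f \<gamma> = (LINT x|m. f x * cnj (\<gamma> x))"

definition continuous_functions :: "('g::topological_ab_group_add \<Rightarrow> complex) normed_module" where
  "continuous_functions =
     \<lparr>carrier = {f. continuous_on UNIV f}, mult = undefined, one = undefined,
      zero = (\<lambda>x. 0), add = (\<lambda>f g x. f x + g x), smult = (\<lambda>c f x. c * f x),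
      nrm = (\<lambda>f. SUP x. cmod (f x))\<rparr>"

definition continuous_with_spectrum ::
  "'g::topological_ab_group_add measure \<Rightarrow> ('g \<Rightarrow> complex) set \<Rightarrow> ('g \<Rightarrow> complex) set" where
  "continuous_with_spectrum m \<Theta> =
     {f \<in> carrier continuous_functions. \<forall>\<gamma>\<in>dual_group - \<Theta>. fourier_coeff m f \<gamma> = 0}"

text \<open>The seminormed space of integrable functions. \<open>L1_space\<close> is its quotient by the functions
  vanishing almost everywhere, so its elements are classes of functions; the infimum in the quotient
  norm is over a constant family.\<close>

definition integrable_functions ::
  "'g::topological_ab_group_add measure \<Rightarrow> ('g \<Rightarrow> complex) normed_module" where
  "integrable_functions m =
     \<lparr>carrier = {f. integrable m f}, mult = undefined, one = undefined,
      zero = (\<lambda>x. 0), add = (\<lambda>f g x. f x + g x), smult = (\<lambda>c f x. c * f x),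
      nrm = (\<lambda>f. LINT x|m. cmod (f x))\<rparr>"

definition L1_space ::
  "'g::topological_ab_group_add measure \<Rightarrow> ('g \<Rightarrow> complex) set normed_module" where
  "L1_space m = quotient_space (integrable_functions m)
     {f \<in> carrier (integrable_functions m). AE x in m. f x = 0}"

text \<open>Fourier coefficients do not depend on the representative \<open>f\<close> of the class \<open>F\<close>.\<close>

definition L1_with_spectrum ::
  "'g::topological_ab_group_add measure \<Rightarrow> ('g \<Rightarrow> complex) set \<Rightarrow> ('g \<Rightarrow> complex) set set" where
  "L1_with_spectrum m \<Theta> =
     {F \<in> carrier (L1_space m). \<forall>f\<in>F. \<forall>\<gamma>\<in>dual_group - \<Theta>. fourier_coeff m f \<gamma> = 0}"

end

theory Submission
  imports Defs
begin

text \<open>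
  Write \<open>\<Theta>\<close> for \<open>\<Gamma> - \<Lambda>\<inverse>\<close>. The continuous functions with spectrum in \<open>\<Theta>\<close> are those annihilated by
  all characters in \<open>\<Lambda>\<close>, and they norm \<open>L\<^sup>1 / L\<^sup>1\<^sub>\<Lambda>\<close>: that they act on the quotient is uniqueness of
  Fourier coefficients (Peter-Weyl), and that they attain the quotient norm is Hahn-Banach followed by
  convolution with an approximate identity.

  Given a rank-one operator \<open>w \<mapsto> \<phi> w u\<close> and a function \<open>f\<close> at which \<open>\<phi>\<close> is almost normed, take
  \<open>h \<in> C\<^sub>\<Theta>\<close> that almost norms \<open>u\<close>. As \<open>f\<close> is the sum of its restrictions to small sets, some
  restriction, with almost constant phase \<open>c\<close>, serves as well as \<open>f\<close>. Richness moves \<open>h\<close> so that it is close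
  to \<open>cnj c\<close> on a nonempty open set \<open>V\<close> near that piece. Restricting \<open>f\<close> once more, to a translate of \<open>V\<close>,
  and translating \<open>h\<close> accordingly, which hardly changes its value at \<open>u\<close>, gives \<open>w\<close> and \<open>h\<close> with both
  \<open>h w \<approx> \<parallel>w\<parallel>\<close> and \<open>h u \<approx> \<parallel>u\<parallel>\<close>, whence \<open>\<parallel>w + \<parallel>\<phi>\<parallel> u\<parallel> \<approx> \<parallel>w\<parallel> + \<parallel>\<phi>\<parallel>\<close>.
\<close>

section \<open>Integration on a compact abelian group\<close>

text \<open>The obstacle is that richness controls \<open>h\<close> only on some open set, where
  \<open>f\<close> may vanish altogether. What helps is that the inequality between
  \<open>\<alpha>\<close> times the norm of \<open>f\<close> and \<open>Re (\<phi> f)\<close> is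
  homogeneous and additive over restrictions: it passes to pieces of arbitrarily small norm, and the
  last piece is rescaled to norm 1 only at the end. Translates of \<open>V\<close> cover the group,
  so one of them carries a good piece. That piece and \<open>V\<close> lie in the same translate of
  a small neighbourhood of 0, hence the translation needed is itself small; this is why the first
  restriction is to a small set. Small means with respect to the uniform continuity of a continuous
  \<open>v\<close> that approximates \<open>u\<close>.

  As the group need not be metrizable, integrals are exchanged by compactness: a function continuous
  in two variables is uniformly close to one with finitely many slices. Characters are found by
  shrinking an idempotent of the convolution algebra, whose value at 0 is the dimension of its
  range, until that range is a line.\<close>

abbreviation continuous_everywhere :: "('a::topological_space \<Rightarrow> 'b::topological_space) \<Rightarrow> bool" where
  "continuous_everywhere f \<equiv> continuous_on UNIV f"

lemma continuous_everywhereI: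
  fixes f :: "'a::topological_space \<Rightarrow> 'b::metric_space"
  assumes "\<And>t0 e. e > 0 \<Longrightarrow> \<exists>W. open W \<and> t0 \<in> W \<and> (\<forall>t\<in>W. dist (f t) (f t0) < e)"
  shows "continuous_everywhere f"
  unfolding continuous_on_def
proof (intro ballI tendstoI)
  fix t0 :: 'a and e :: real assume "e > 0"
  then show "\<forall>\<^sub>F t in at t0 within UNIV. dist (f t) (f t0) < e"
    using assms[of e t0] unfolding eventually_at_topological by blast
qed

text \<open>Quantifying over every pointwise bound \<open>B\<close> keeps suprema out of the
  definition. Nothing is demanded at discontinuous functions, so the integral qualifies as it
  stands.\<close>

definition sup_bounded_functional ::
  "(('g::topological_space \<Rightarrow> complex) \<Rightarrow> complex) \<Rightarrow> real \<Rightarrow> bool" where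
  "sup_bounded_functional \<psi> C \<longleftrightarrow> 0 \<le> C \<and>
     (\<forall>f g. continuous_everywhere f \<longrightarrow> continuous_everywhere g \<longrightarrow>
        \<psi> (\<lambda>x. f x + g x) = \<psi> f + \<psi> g) \<and>
     (\<forall>c f. continuous_everywhere f \<longrightarrow> \<psi> (\<lambda>x. c * f x) = c * \<psi> f) \<and>
     (\<forall>f B. continuous_everywhere f \<longrightarrow> (\<forall>x. cmod (f x) \<le> B) \<longrightarrow> cmod (\<psi> f) \<le> C * B)"

lemma sup_bounded_functionalD:
  assumes "sup_bounded_functional \<psi> C"
  shows "0 \<le> C"
    and "continuous_everywhere f \<Longrightarrow> continuous_everywhere g \<Longrightarrow> \<psi> (\<lambda>x. f x + g x) = \<psi> f + \<psi> g"
    and "continuous_everywhere f \<Longrightarrow> \<psi> (\<lambda>x. c * f x) = c * \<psi> f"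
    and "continuous_everywhere f \<Longrightarrow> (\<And>x. cmod (f x) \<le> B) \<Longrightarrow> cmod (\<psi> f) \<le> C * B"
  using assms by (auto simp: sup_bounded_functional_def)

lemma sup_bounded_functional_diff:
  assumes "sup_bounded_functional \<psi> C" "continuous_everywhere f" "continuous_everywhere g"
  shows "\<psi> (\<lambda>x. f x - g x) = \<psi> f - \<psi> g"
proof -
  have "\<psi> (\<lambda>x. f x + (-1) * g x) = \<psi> f + \<psi> (\<lambda>x. (-1) * g x)"
    using assms by (intro sup_bounded_functionalD(2)[OF assms(1)]) (auto intro!: continuous_intros)
  then show ?thesis
    using sup_bounded_functionalD(3)[OF assms(1,3), of "-1"] by simp
qed

lemma sup_bounded_functional_sum:
  assumes "sup_bounded_functional \<psi> C" "\<And>i. i \<in> I \<Longrightarrow> continuous_everywhere (f i)" "finite I"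
  shows "\<psi> (\<lambda>x. \<Sum>i\<in>I. c i * f i x) = (\<Sum>i\<in>I. c i * \<psi> (f i))"
  using assms(3,2)
proof (induction I)
  case empty
  show ?case using sup_bounded_functionalD(3)[OF assms(1), of "\<lambda>_. 0" 0] by simp
next
  case (insert j I)
  have "\<psi> (\<lambda>x. c j * f j x + (\<Sum>i\<in>I. c i * f i x)) = \<psi> (\<lambda>x. c j * f j x) + \<psi> (\<lambda>x. \<Sum>i\<in>I. c i * f i x)"
    using insert by (intro sup_bounded_functionalD(2)[OF assms(1)]) (auto intro!: continuous_intros)
  then show ?case
    using insert sup_bounded_functionalD(3)[OF assms(1)] by simp
qed

locale haar_group =
  fixes m :: "'g::{topological_ab_group_add, t2_space} measure"
  assumes compact_UNIV: "compact (UNIV :: 'g set)"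
    and haar: "normalized_haar_measure m"
begin

lemma sets_haar [measurable_cong, simp]: "sets m = sets borel"
  using haar by (simp add: normalized_haar_measure_def)

lemma space_haar [simp]: "space m = UNIV"
  using sets_eq_imp_space_eq[OF sets_haar] by simp

lemma emeasure_UNIV [simp]: "emeasure m UNIV = 1"
  using haar by (simp add: normalized_haar_measure_def)

sublocale finite_measure m
  by (rule finite_measureI) simp

lemma measure_UNIV [simp]: "measure m UNIV = 1"
  by (simp add: measure_def)

lemma continuous_imp_measurable [measurable_dest]:
  "continuous_everywhere (f :: 'g \<Rightarrow> 'b::topological_space) \<Longrightarrow> f \<in> borel_measurable m"
  using borel_measurable_continuous_onI measurable_cong_sets[OF sets_haar refl] by blast

lemma bounded_continuous:
  fixes f :: "'g \<Rightarrow> 'b::real_normed_vector"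
  assumes "continuous_everywhere f"
  obtains B where "B > 0" "\<And>x. norm (f x) \<le> B"
  using compact_imp_bounded[OF compact_continuous_image[OF assms compact_UNIV]]
  unfolding bounded_pos by auto

lemma integrable_continuous:
  fixes f :: "'g \<Rightarrow> 'b::{banach, second_countable_topology}"
  assumes "continuous_everywhere f"
  shows "integrable m f"
proof -
  obtain B where "\<And>x. norm (f x) \<le> B" using bounded_continuous[OF assms] by metis
  then show ?thesis
    by (intro integrable_const_bound[where B=B]) (auto intro: continuous_imp_measurable assms)
qed

lemma integrable_mult_continuous:
  fixes f h :: "'g \<Rightarrow> complex"
  assumes "integrable m f" "continuous_everywhere h"
  shows "integrable m (\<lambda>x. f x * h x)"
proof -
  obtain B where "B > 0" "\<And>x. norm (h x) \<le> B" using bounded_continuous[OF assms(2)] by metis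
  then have "AE x in m. norm (f x * h x) \<le> norm (B *\<^sub>R f x)"
    using mult_left_mono[of "cmod (h x)" B "cmod (f x)" for x]
    by (intro AE_I2) (simp add: norm_mult mult.commute)
  then show ?thesis
    using assms continuous_imp_measurable[OF assms(2)]
    by (intro Bochner_Integration.integrable_bound[where f="\<lambda>x. B *\<^sub>R f x" and g="\<lambda>x. f x * h x"])
       auto
qed

lemma integral_const_1 [simp]: "(LINT x|m. (c::'b::{banach, second_countable_topology})) = c"
  by (simp add: lebesgue_integral_const)

lemma integral_cmod_bound:
  fixes f h :: "'g \<Rightarrow> complex"
  assumes "integrable m f" "h \<in> borel_measurable m" "\<And>x. cmod (h x) \<le> B"
  shows "cmod (LINT x|m. f x * h x) \<le> B * (LINT x|m. cmod (f x))"
proof -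
  have [simp]: "integrable m (\<lambda>x. cmod (f x))" using assms by simp
  have B: "cmod (f x * h x) \<le> B * cmod (f x)" for x
    using mult_left_mono[OF assms(3)[of x], of "cmod (f x)"] by (simp add: norm_mult mult.commute)
  have "cmod (LINT x|m. f x * h x) \<le> (LINT x|m. cmod (f x * h x))"
    by (rule integral_norm_bound)
  also have "\<dots> \<le> (LINT x|m. B * cmod (f x))"
  proof (rule integral_mono)
    show "integrable m (\<lambda>x. cmod (f x * h x))"
    proof (rule Bochner_Integration.integrable_bound)
      show "integrable m (\<lambda>x. B * cmod (f x))" by simp
      show "AE x in m. norm (cmod (f x * h x)) \<le> norm (B * cmod (f x))"
        using B by (intro AE_I2) (simp add: order_trans[OF _ abs_ge_self])
    qed (use assms in measurable)
  qed (use B in auto)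
  finally show ?thesis by simp
qed

lemma emeasure_translate:
  assumes "A \<in> sets borel"
  shows "emeasure m ((\<lambda>x. a + x) ` A) = emeasure m A"
  using haar assms by (simp add: normalized_haar_measure_def)

lemma distr_translate: "distr m m (\<lambda>x. a + x) = m"
proof (rule measure_eqI)
  fix A assume "A \<in> sets (distr m m (\<lambda>x. a + x))"
  then have A: "A \<in> sets borel" by simp
  have meas: "(\<lambda>x. a + x) \<in> measurable m m"
    using continuous_imp_measurable[of "\<lambda>x. a + x"]
    by (simp add: continuous_intros measurable_cong_sets[OF refl sets_haar])
  have "(\<lambda>x. a + x) -` A = (\<lambda>x. -a + x) ` A"
    by (auto intro!: image_eqI[where x="a + _"])
  then show "emeasure (distr m m (\<lambda>x. a + x)) A = emeasure m A"
    using A emeasure_translate[of A "-a"] by (simp add: emeasure_distr[OF meas])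
qed simp

lemma integral_translate:
  fixes f :: "'g \<Rightarrow> complex"
  assumes "continuous_everywhere f"
  shows "(LINT x|m. f (a + x)) = (LINT x|m. f x)"
proof -
  have meas: "(\<lambda>x. a + x) \<in> measurable m m"
    using continuous_imp_measurable[of "\<lambda>x. a + x"]
    by (simp add: continuous_intros measurable_cong_sets[OF refl sets_haar])
  have "(LINT x|m. f x) = (LINT x|distr m m (\<lambda>x. a + x). f x)"
    by (simp add: distr_translate)
  also have "\<dots> = (LINT x|m. f (a + x))"
    using meas continuous_imp_measurable[OF assms] by (rule integral_distr)
  finally show ?thesis by simp
qed

lemma integral_translate_diff:
  fixes f :: "'g \<Rightarrow> complex"
  assumes "continuous_everywhere f"
  shows "(LINT x|m. f (x - a)) = (LINT x|m. f x)"
  using integral_translate[OF assms, of "-a"] by simp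

section \<open>Uniformity in one variable, and the exchange of functionals with integrals\<close>

lemma slice_continuous:
  assumes "continuous_everywhere (\<lambda>(t, s). F t s)"
  shows "continuous_everywhere (\<lambda>s. F t s)"
  using continuous_on_compose2[OF assms, of UNIV "\<lambda>s. (t, s)"] by (simp add: continuous_intros)

text \<open>Compactness of the second factor turns joint continuity into continuity of
  \<open>t \<mapsto> F t\<close> for the sup norm.\<close>

lemma slice_nbhd:
  fixes F :: "'g \<Rightarrow> 'g \<Rightarrow> 'c::metric_space"
  assumes "continuous_everywhere (\<lambda>(t, s). F t s)" "e > 0"
  obtains W where "open W" "t0 \<in> W" "\<And>t s. t \<in> W \<Longrightarrow> dist (F t s) (F t0 s) \<le> e"
proof -
  have "continuous_on (UNIV \<times> UNIV) (\<lambda>(t, s). F t s)" using assms by simp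
  from continuous_on_prod_compactE[OF this compact_UNIV UNIV_I assms(2), of t0]
  obtain W where "t0 \<in> W" "open W"
    "\<forall>t\<in>W \<inter> UNIV. \<forall>s\<in>UNIV. dist (case (t, s) of (t, s) \<Rightarrow> F t s) (case (t0, s) of (t, s) \<Rightarrow> F t s) \<le> e" .
  then show thesis using that by simp
qed

text \<open>Finitely many of the neighbourhoods from \<open>slice_nbhd\<close> cover the group. The
  least index of one that contains \<open>t\<close> is a measurable function of \<open>t\<close>, so
  integrals of the approximating family become finite sums.\<close>

lemma finite_slice_approximation:
  fixes F :: "'g \<Rightarrow> 'g \<Rightarrow> 'c::metric_space"
  assumes F: "continuous_everywhere (\<lambda>(t, s). F t s)" and e: "e > 0"
  obtains p :: "nat \<Rightarrow> 'g" and idx :: "'g \<Rightarrow> nat" and n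
  where "idx \<in> measurable m (count_space UNIV)" "\<And>t. idx t < n"
    "\<And>t s. dist (F t s) (F (p (idx t)) s) \<le> e"
proof -
  have "\<exists>W. open W \<and> t0 \<in> W \<and> (\<forall>t\<in>W. \<forall>s. dist (F t s) (F t0 s) \<le> e)" for t0
    using slice_nbhd[OF F e, of t0] by metis
  then obtain W where W: "\<And>t0. open (W t0)" "\<And>t0. t0 \<in> W t0"
    "\<And>t0 t s. t \<in> W t0 \<Longrightarrow> dist (F t s) (F t0 s) \<le> e" by metis
  obtain T where T: "finite T" "UNIV \<subseteq> (\<Union>t\<in>T. W t)"
    using compactE_image[OF compact_UNIV, of UNIV W] W by (metis UNIV_I UNIV_eq_I UN_I subset_UNIV)
  obtain n and p :: "nat \<Rightarrow> 'g" where p: "T = p ` {i. i < n}"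
    using finite_imp_nat_seg_image_inj_on[OF T(1)] by metis
  define idx where "idx t = (LEAST i. t \<in> W (p i))" for t
  have ex: "\<exists>i<n. t \<in> W (p i)" for t
    using T(2) p by auto
  show ?thesis
  proof
    have "Measurable.pred m (\<lambda>t. t \<in> W (p i))" for i
      using W(1)[of "p i"] by (simp add: pred_def)
    then show "idx \<in> measurable m (count_space UNIV)"
      unfolding idx_def by (intro measurable_Least)
    show "idx t < n" for t
      using ex[of t] unfolding idx_def by (meson Least_le le_less_trans)
    show "dist (F t s) (F (p (idx t)) s) \<le> e" for t s
      using LeastI_ex[of "\<lambda>i. t \<in> W (p i)"] ex[of t] W(3) unfolding idx_def by blast
  qed
qed

lemma continuous_functional_slice:
  assumes \<psi>: "sup_bounded_functional \<psi> C"
    and F: "continuous_everywhere (\<lambda>(t, s). F t s)"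
  shows "continuous_everywhere (\<lambda>t::'g. \<psi> (\<lambda>s::'g. F t s))"
proof -
  have C: "0 \<le> C" using \<psi> by (rule sup_bounded_functionalD)
  have "\<exists>W. open W \<and> t0 \<in> W \<and> (\<forall>t\<in>W. dist (\<psi> (F t)) (\<psi> (F t0)) < e)" if "e > 0" for e t0
  proof -
    \<comment> \<open>The denominator is \<open>C + 1\<close> because the bound \<open>C\<close> may
      be 0.\<close>
    have "e / (C + 1) > 0" using that C by simp
    from slice_nbhd[OF F this, of t0]
    obtain W where W: "open W" "t0 \<in> W" "\<And>t s. t \<in> W \<Longrightarrow> dist (F t s) (F t0 s) \<le> e / (C + 1)"
      by blast
    have "dist (\<psi> (F t)) (\<psi> (F t0)) < e" if "t \<in> W" for t
    proof -
      have "cmod (\<psi> (\<lambda>s. F t s - F t0 s)) \<le> C * (e / (C + 1))"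
        using W(3)[OF that] slice_continuous[OF F]
        by (intro sup_bounded_functionalD(4)[OF \<psi>]) (auto simp: dist_norm intro!: continuous_intros)
      also have "\<dots> < e" using C \<open>e > 0\<close> by (simp add: field_simps)
      finally show ?thesis
        using sup_bounded_functional_diff[OF \<psi> slice_continuous[OF F] slice_continuous[OF F], of t t0]
        by (simp add: dist_norm)
    qed
    then show ?thesis using W by blast
  qed
  then show ?thesis by (rule continuous_everywhereI)
qed

lemma continuous_integral_slice:
  fixes F :: "'g \<Rightarrow> 'g \<Rightarrow> complex"
  assumes F: "continuous_everywhere (\<lambda>(t, s). F t s)" and u: "integrable m u"
  shows "continuous_everywhere (\<lambda>s. LINT t|m. u t * F t s)"
proof -
  define N where "N = (LINT t|m. cmod (u t))"
  have N: "0 \<le> N" by (simp add: N_def)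
  have F': "continuous_everywhere (\<lambda>(s, t). F t s)"
    using continuous_on_compose2[OF F, of UNIV "\<lambda>(s, t). (t, s)"]
    by (simp add: case_prod_unfold continuous_intros)
  have "\<exists>W. open W \<and> s0 \<in> W \<and> (\<forall>s\<in>W. dist (LINT t|m. u t * F t s) (LINT t|m. u t * F t s0) < e)"
    if "e > 0" for e s0
  proof -
    have "e / (N + 1) > 0" using that N by simp
    from slice_nbhd[OF F' this, of s0]
    obtain W where W: "open W" "s0 \<in> W" "\<And>s t. s \<in> W \<Longrightarrow> dist (F t s) (F t s0) \<le> e / (N + 1)"
      by blast
    have "dist (LINT t|m. u t * F t s) (LINT t|m. u t * F t s0) < e" if "s \<in> W" for s
    proof -
      have c: "continuous_everywhere (\<lambda>t. F t s)" for s
        using slice_continuous[OF F'] .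
      have "dist (LINT t|m. u t * F t s) (LINT t|m. u t * F t s0) = cmod (LINT t|m. u t * (F t s - F t s0))"
        using integrable_mult_continuous[OF u c] by (simp add: dist_norm right_diff_distrib)
      also have "\<dots> \<le> e / (N + 1) * N"
        unfolding N_def
        using W(3)[OF that] c[of s] c[of s0] continuous_imp_measurable
        by (intro integral_cmod_bound u) (auto simp: dist_norm N_def intro!: borel_measurable_diff)
      also have "\<dots> < e" using N \<open>e > 0\<close> by (simp add: field_simps)
      finally show ?thesis .
    qed
    then show ?thesis using W by blast
  qed
  then show ?thesis by (rule continuous_everywhereI)
qed

text \<open>Both sides are within \<open>C * e * \<parallel>u\<parallel>\<close> of the same finite sum when \<open>F\<close> is replaced by a
  function that depends on the first variable through finitely many values only.\<close>

lemma functional_integral_exchange: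
  fixes F :: "'g \<Rightarrow> 'g \<Rightarrow> complex"
  assumes \<psi>: "sup_bounded_functional \<psi> C"
    and F: "continuous_everywhere (\<lambda>(t, s). F t s)" and u: "integrable m u"
  shows "(LINT t|m. u t * \<psi> (F t)) = \<psi> (\<lambda>s. LINT t|m. u t * F t s)"
proof -
  define N where "N = (LINT t|m. cmod (u t))"
  have N: "0 \<le> N" by (simp add: N_def)
  have C: "0 \<le> C" using \<psi> by (rule sup_bounded_functionalD)
  have F1: "continuous_everywhere (F t)" for t using slice_continuous[OF F] .
  have F': "continuous_everywhere (\<lambda>(s, t). F t s)"
    using continuous_on_compose2[OF F, of UNIV "\<lambda>(s, t). (t, s)"]
    by (simp add: case_prod_unfold continuous_intros)
  have F2: "continuous_everywhere (\<lambda>t. F t s)" for s using slice_continuous[OF F'] .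
  have \<psi>F: "continuous_everywhere (\<lambda>t. \<psi> (F t))" using continuous_functional_slice[OF \<psi> F] .
  have bound: "cmod ((LINT t|m. u t * \<psi> (F t)) - \<psi> (\<lambda>s. LINT t|m. u t * F t s)) \<le> 2 * C * N * e" if "e > 0" for e
  proof -
    obtain p :: "nat \<Rightarrow> 'g" and idx n where idx[measurable]: "idx \<in> measurable m (count_space UNIV)"
      and n: "\<And>t. idx t < n" and p: "\<And>t s. dist (F t s) (F (p (idx t)) s) \<le> e"
      using finite_slice_approximation[OF F \<open>e > 0\<close>] by metis
    \<comment> \<open>\<open>w i\<close> is the integral of \<open>u\<close> over the
      \<open>i\<close>-th cell, so integrating against \<open>u\<close> amounts to a finite linear
      combination with these weights, and \<open>\<psi>\<close> commutes with that by
      linearity.\<close>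
    define w where "w i = (LINT t|m. u t * indicator {t. idx t = i} t)" for i
    have A[measurable]: "{t. idx t = i} \<in> sets m" for i
      using measurable_sets[OF idx, of "{i}"] by (simp add: vimage_def)
    have ui: "integrable m (\<lambda>t. u t * indicator {t. idx t = i} t)" for i
    proof -
      have "(\<lambda>t. indicator {t. idx t = i} t *\<^sub>R u t) = (\<lambda>t. u t * indicator {t. idx t = i} t)"
        by (auto simp: indicator_def fun_eq_iff)
      then show ?thesis using integrable_mult_indicator[OF A u, of i] by simp
    qed
    have expand: "u t * G (idx t) = (\<Sum>i<n. (u t * indicator {t. idx t = i} t) * G i)" for G :: "nat \<Rightarrow> complex" and t
    proof -
      have "(\<Sum>i<n. (u t * indicator {t. idx t = i} t) * G i) = (\<Sum>i<n. if i = idx t then u t * G i else 0)"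
        by (intro sum.cong) (auto simp: indicator_def)
      then show ?thesis using n[of t] by simp
    qed
    have sum_int: "(LINT t|m. u t * G (idx t)) = (\<Sum>i<n. w i * G i)"
      and sum_integrable: "integrable m (\<lambda>t. u t * G (idx t))" for G :: "nat \<Rightarrow> complex"
      unfolding expand w_def using ui by (simp_all)
    define S where "S s = (\<Sum>i<n. w i * F (p i) s)" for s
    have S: "continuous_everywhere S"
      unfolding S_def using F1 by (intro continuous_intros)
    have \<psi>S: "\<psi> S = (LINT t|m. u t * \<psi> (F (p (idx t))))"
      unfolding S_def sum_int[of "\<lambda>i. \<psi> (F (p i))"]
      by (rule sup_bounded_functional_sum[OF \<psi>]) (use F1 in auto)
    have "cmod ((LINT t|m. u t * \<psi> (F t)) - \<psi> S) = cmod (LINT t|m. u t * (\<psi> (F t) - \<psi> (F (p (idx t)))))"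
      unfolding \<psi>S right_diff_distrib
      using integrable_mult_continuous[OF u \<psi>F] sum_integrable[of "\<lambda>i. \<psi> (F (p i))"] by simp
    also have "\<dots> \<le> C * e * N"
      unfolding N_def
    proof (rule integral_cmod_bound[OF u])
      have "(\<lambda>t. \<psi> (F (p (idx t)))) \<in> borel_measurable m"
        by (rule measurable_compose[OF idx]) simp
      then show "(\<lambda>t. \<psi> (F t) - \<psi> (F (p (idx t)))) \<in> borel_measurable m"
        using continuous_imp_measurable[OF \<psi>F] by simp
      show "cmod (\<psi> (F t) - \<psi> (F (p (idx t)))) \<le> C * e" for t
        unfolding sup_bounded_functional_diff[OF \<psi> F1 F1, symmetric]
        using p F1 by (intro sup_bounded_functionalD(4)[OF \<psi>]) (auto simp: dist_norm intro!: continuous_intros)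
    qed
    finally have 1: "cmod ((LINT t|m. u t * \<psi> (F t)) - \<psi> S) \<le> C * e * N" .
    have "cmod ((LINT t|m. u t * F t s) - S s) \<le> e * N" for s
    proof -
      have "cmod ((LINT t|m. u t * F t s) - S s) = cmod (LINT t|m. u t * (F t s - F (p (idx t)) s))"
        unfolding S_def sum_int[of "\<lambda>i. F (p i) s", symmetric] right_diff_distrib
        using integrable_mult_continuous[OF u F2] sum_integrable[of "\<lambda>i. F (p i) s"] by simp
      also have "\<dots> \<le> e * N"
        unfolding N_def
      proof (rule integral_cmod_bound[OF u])
        have "(\<lambda>t. F (p (idx t)) s) \<in> borel_measurable m"
          by (rule measurable_compose[OF idx]) simp
        then show "(\<lambda>t. F t s - F (p (idx t)) s) \<in> borel_measurable m"
          using continuous_imp_measurable[OF F2] by simp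
      qed (use p in \<open>auto simp: dist_norm\<close>)
      finally show ?thesis .
    qed
    then have "cmod (\<psi> (\<lambda>s. (LINT t|m. u t * F t s) - S s)) \<le> C * (e * N)"
      using continuous_integral_slice[OF F u] S
      by (intro sup_bounded_functionalD(4)[OF \<psi>]) (auto intro!: continuous_intros)
    then have 2: "cmod (\<psi> (\<lambda>s. LINT t|m. u t * F t s) - \<psi> S) \<le> C * (e * N)"
      using sup_bounded_functional_diff[OF \<psi> continuous_integral_slice[OF F u] S] by simp
    show ?thesis
      using 1 2 norm_triangle_ineq4[of "(LINT t|m. u t * \<psi> (F t)) - \<psi> S" "\<psi> (\<lambda>s. LINT t|m. u t * F t s) - \<psi> S"]
      by (simp add: algebra_simps)
  qed
  have "cmod ((LINT t|m. u t * \<psi> (F t)) - \<psi> (\<lambda>s. LINT t|m. u t * F t s)) \<le> 0"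
  proof (rule field_le_epsilon)
    fix e :: real assume "e > 0"
    define K where "K = 2 * C * N"
    have K: "0 \<le> K" using C N by (simp add: K_def)
    then have "K * (e / (K + 1)) \<le> e" "e / (K + 1) > 0"
      using \<open>e > 0\<close> by (simp_all add: field_simps)
    with bound[of "e / (K + 1)"]
    show "cmod ((LINT t|m. u t * \<psi> (F t)) - \<psi> (\<lambda>s. LINT t|m. u t * F t s)) \<le> 0 + e"
      unfolding K_def by linarith
  qed
  then show ?thesis by simp
qed

lemma sup_bounded_functional_integral: "sup_bounded_functional (integral\<^sup>L m) 1"
  unfolding sup_bounded_functional_def
  using integral_cmod_bound[of "\<lambda>_. 1"] continuous_imp_measurable
  by (auto simp: Bochner_Integration.integral_add integrable_continuous)

text \<open>Fubini is the case in which the functional is the integral itself; joint continuity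
  takes the place of measurability on the product.\<close>

lemma fubini_continuous:
  fixes F :: "'g \<Rightarrow> 'g \<Rightarrow> complex"
  assumes "continuous_everywhere (\<lambda>(t, s). F t s)" "integrable m u"
  shows "(LINT t|m. u t * (LINT s|m. F t s)) = (LINT s|m. LINT t|m. u t * F t s)"
  using functional_integral_exchange[OF sup_bounded_functional_integral assms] .

lemma fubini_continuous':
  fixes F :: "'g \<Rightarrow> 'g \<Rightarrow> complex"
  assumes "continuous_everywhere (\<lambda>(t, s). F t s)"
  shows "(LINT t|m. LINT s|m. F t s) = (LINT s|m. LINT t|m. F t s)"
  using fubini_continuous[OF assms, of "\<lambda>_. 1"] by simp

lemma continuous_compose_diff:
  assumes "continuous_everywhere (f :: 'g \<Rightarrow> 'b::topological_space)"
  shows "continuous_everywhere (\<lambda>(t, s). f (s - t))" "continuous_everywhere (\<lambda>(t, s). f (t - s))"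
    "continuous_everywhere (\<lambda>x. f (a - x))" "continuous_everywhere (\<lambda>x. f (x - a))"
    "continuous_everywhere (\<lambda>x. f (- x))" "continuous_everywhere (\<lambda>x. f (a + x))"
  by (auto simp: case_prod_unfold intro!: continuous_intros continuous_on_compose2[OF assms])

text \<open>Invariance under inversion follows from invariance under translation: integrating
  \<open>f (s - t)\<close> first over \<open>t\<close> gives one side, first over \<open>s\<close>
  the other.\<close>

lemma integral_minus:
  fixes f :: "'g \<Rightarrow> complex"
  assumes f: "continuous_everywhere f"
  shows "(LINT x|m. f (- x)) = (LINT x|m. f x)"
proof -
  have "(LINT x|m. f (- x)) = (LINT s|m. (LINT t|m. f (s - t)))"
  proof -
    have "(LINT t|m. f (s - t)) = (LINT t|m. f (- t))" for s
      using integral_translate_diff[OF continuous_compose_diff(5)[OF f], of s] by simp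
    then show ?thesis by simp
  qed
  also have "\<dots> = (LINT t|m. (LINT s|m. f (s - t)))"
    using fubini_continuous'[OF continuous_compose_diff(1)[OF f]] by simp
  also have "\<dots> = (LINT s|m. f s)"
    using integral_translate_diff[OF f] by simp
  finally show ?thesis .
qed

lemma integral_reflect:
  fixes f :: "'g \<Rightarrow> complex"
  assumes f: "continuous_everywhere f"
  shows "(LINT x|m. f (a - x)) = (LINT x|m. f x)"
  using integral_translate_diff[OF continuous_compose_diff(5)[OF f], of a] integral_minus[OF f]
  by simp

end

section \<open>Convolution of continuous functions\<close>

context haar_group begin

definition conv :: "('g \<Rightarrow> complex) \<Rightarrow> ('g \<Rightarrow> complex) \<Rightarrow> 'g \<Rightarrow> complex" where
  "conv f g x = (LINT t|m. f t * g (x - t))"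

text \<open>The involution of the convolution algebra. Convolution by \<open>adj f\<close> is the
  Hilbert space adjoint of convolution by \<open>f\<close>, so \<open>adj k = k\<close> says that
  \<open>k\<close> acts as a self-adjoint operator on L2.\<close>

definition adj :: "('g \<Rightarrow> complex) \<Rightarrow> 'g \<Rightarrow> complex" where
  "adj f x = cnj (f (- x))"

definition sqnorm :: "('g \<Rightarrow> complex) \<Rightarrow> real" where
  "sqnorm f = (LINT x|m. (cmod (f x))\<^sup>2)"

lemma adj_adj [simp]: "adj (adj f) = f" by (simp add: adj_def fun_eq_iff)

lemma continuous_adj [continuous_intros]: "continuous_everywhere f \<Longrightarrow> continuous_everywhere (adj f)"
  unfolding adj_def by (intro continuous_intros continuous_compose_diff)

lemma continuous_conv [continuous_intros]:
  assumes "continuous_everywhere f" "continuous_everywhere g"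
  shows "continuous_everywhere (conv f g)"
  unfolding conv_def
  using continuous_integral_slice[OF continuous_compose_diff(1)[OF assms(2)] integrable_continuous[OF assms(1)]] .

lemma conv_integrand:
  assumes "continuous_everywhere (f :: 'g \<Rightarrow> complex)" "continuous_everywhere g"
  shows "continuous_everywhere (\<lambda>t. f t * g (x - t))"
  by (rule continuous_on_mult[OF assms(1) continuous_compose_diff(3)[OF assms(2)]])

lemma conv_commute:
  assumes "continuous_everywhere f" "continuous_everywhere g"
  shows "conv f g = conv g f"
proof
  fix x
  show "conv f g x = conv g f x"
    using integral_reflect[OF conv_integrand[OF assms, of x], of x] by (simp add: conv_def mult.commute)
qed

lemma conv_assoc:
  assumes f: "continuous_everywhere f" and g: "continuous_everywhere g" and h: "continuous_everywhere h"
  shows "conv (conv f g) h = conv f (conv g h)"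
proof
  fix x
  have c: "continuous_everywhere (\<lambda>(t, s). g (s - t) * h (x - s))"
    unfolding case_prod_unfold
    by (intro continuous_intros continuous_on_compose2[OF g] continuous_on_compose2[OF h]) auto
  have "conv (conv f g) h x = (LINT s|m. LINT t|m. f t * (g (s - t) * h (x - s)))"
    unfolding conv_def
    by (simp only: mult.assoc[symmetric] Bochner_Integration.integral_mult_left_zero)
  also have "\<dots> = (LINT t|m. f t * (LINT s|m. g (s - t) * h (x - s)))"
    using fubini_continuous[OF c integrable_continuous[OF f]] by simp
  also have "\<dots> = conv f (conv g h) x"
  proof -
    have "(LINT s|m. g (s - t) * h (x - s)) = conv g h (x - t)" for t
    proof -
      have "(LINT s|m. g (s - t) * h (x - t - (s - t))) = (LINT s|m. g s * h (x - t - s))"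
        by (rule integral_translate_diff[OF conv_integrand[OF g h]])
      then show ?thesis by (simp add: conv_def)
    qed
    then show ?thesis by (simp add: conv_def)
  qed
  finally show "conv (conv f g) h x = conv f (conv g h) x" .
qed

lemma conv_add_right:
  assumes "continuous_everywhere f" "continuous_everywhere g" "continuous_everywhere h"
  shows "conv f (\<lambda>x. g x + h x) = (\<lambda>x. conv f g x + conv f h x)"
  unfolding conv_def using assms
  by (simp add: distrib_left Bochner_Integration.integral_add integrable_continuous conv_integrand)

lemma conv_diff_right:
  assumes "continuous_everywhere f" "continuous_everywhere g" "continuous_everywhere h"
  shows "conv f (\<lambda>x. g x - h x) = (\<lambda>x. conv f g x - conv f h x)"
  unfolding conv_def using assms
  by (simp add: right_diff_distrib Bochner_Integration.integral_diff integrable_continuous conv_integrand)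

lemma conv_scale_right: "conv f (\<lambda>x. c * g x) = (\<lambda>x. c * conv f g x)"
  unfolding conv_def by (simp add: mult.left_commute)

lemma conv_scale_left: "conv (\<lambda>x. c * f x) g = (\<lambda>x. c * conv f g x)"
  unfolding conv_def by (simp add: mult.assoc)

lemma conv_diff_left:
  assumes "continuous_everywhere f" "continuous_everywhere g" "continuous_everywhere h"
  shows "conv (\<lambda>x. g x - h x) f = (\<lambda>x. conv g f x - conv h f x)"
  unfolding conv_def using assms
  by (simp add: left_diff_distrib Bochner_Integration.integral_diff integrable_continuous conv_integrand)

lemma conv_add_left:
  assumes "continuous_everywhere f" "continuous_everywhere g" "continuous_everywhere h"
  shows "conv (\<lambda>x. g x + h x) f = (\<lambda>x. conv g f x + conv h f x)"
  unfolding conv_def using assms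
  by (simp add: distrib_right Bochner_Integration.integral_add integrable_continuous conv_integrand)

lemma adj_conv:
  assumes f: "continuous_everywhere f" and g: "continuous_everywhere g"
  shows "adj (conv f g) = conv (adj f) (adj g)"
proof
  fix x
  have "conv (adj f) (adj g) x = (LINT t|m. cnj (f (- t) * g (- x - (- t))))"
    by (simp add: conv_def adj_def)
  also have "\<dots> = (LINT t|m. cnj (f t * g (- x - t)))"
    by (rule integral_minus[of "\<lambda>t. cnj (f t * g (- x - t))"])
      (intro continuous_intros conv_integrand[OF f g])
  also have "\<dots> = adj (conv f g) x"
    unfolding adj_def conv_def by (rule Bochner_Integration.integral_cnj)
  finally show "adj (conv f g) x = conv (adj f) (adj g) x" by simp
qed

section \<open>L2 estimates for convolutions\<close>

lemma sqnorm_nonneg: "0 \<le> sqnorm f"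
  by (simp add: sqnorm_def)

text \<open>Evaluating a product with an adjoint at 0 is the L2 inner product. The Hilbert space
  structure thus enters through convolution and evaluation alone, without completing to L2.\<close>

lemma conv_adj_0: "conv f (adj f) 0 = complex_of_real (sqnorm f)"
proof -
  have "conv f (adj f) 0 = (LINT t|m. complex_of_real ((cmod (f t))\<^sup>2))"
    unfolding conv_def adj_def by (simp only: complex_norm_square) simp
  then show ?thesis unfolding sqnorm_def by (simp only: integral_complex_of_real)
qed

lemma continuous_sq: "continuous_everywhere f \<Longrightarrow> continuous_everywhere (\<lambda>x. (cmod (f x))\<^sup>2)"
  by (intro continuous_intros)

text \<open>Finitely many translates of an open set cover the group.\<close>

lemma measure_open_pos:
  assumes "open U" "x \<in> U"
  shows "measure m U > 0"
proof (rule ccontr)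
  assume "\<not> ?thesis"
  then have 0: "emeasure m U = 0" by (simp add: emeasure_eq_measure zero_less_measure_iff)
  have translates: "open ((\<lambda>y. a + y) ` U)" for a
  proof -
    have "(\<lambda>y. a + y) ` U = (\<lambda>y. -a + y) -` U" by (auto intro!: image_eqI[where x="-a + _"])
    then show ?thesis using open_vimage[OF assms(1), of "\<lambda>y. -a + y"] by (simp add: continuous_intros)
  qed
  have "UNIV \<subseteq> (\<Union>a\<in>UNIV. (\<lambda>y. a + y) ` U)"
    using assms(2) by (auto intro!: image_eqI[where x=x] exI[where x="_ - x"])
  then obtain T where T: "finite T" "UNIV \<subseteq> (\<Union>a\<in>T. (\<lambda>y. a + y) ` U)"
    using compactE_image[OF compact_UNIV, of UNIV "\<lambda>a. (\<lambda>y. a + y) ` U"] translates by metis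
  have "emeasure m (\<Union>a\<in>T. (\<lambda>y. a + y) ` U) \<le> (\<Sum>a\<in>T. emeasure m ((\<lambda>y. a + y) ` U))"
    using translates by (intro emeasure_subadditive_finite T) auto
  also have "\<dots> = 0" using 0 assms(1) by (simp add: emeasure_translate)
  finally have "emeasure m (\<Union>a\<in>T. (\<lambda>y. a + y) ` U) = 0" by simp
  moreover have "(\<Union>a\<in>T. (\<lambda>y. a + y) ` U) = UNIV" using T(2) by blast
  ultimately show False by simp
qed

lemma sqnorm_pos:
  assumes f: "continuous_everywhere f" and "f x \<noteq> 0"
  shows "0 < sqnorm f"
proof -
  define U where "U = {y. cmod (f y) > cmod (f x) / 2}"
  have U: "open U" "x \<in> U"
    unfolding U_def using assms by (auto intro!: open_Collect_less continuous_intros)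
  have "0 < (cmod (f x) / 2)\<^sup>2 * measure m U" using measure_open_pos[OF U] assms(2) by simp
  also have "\<dots> = (LINT y|m. (cmod (f x) / 2)\<^sup>2 * indicator U y)" by simp
  also have "\<dots> \<le> sqnorm f"
    unfolding sqnorm_def
  proof (rule integral_mono)
    show "integrable m (\<lambda>y. (cmod (f x) / 2)\<^sup>2 * indicator U y)"
      using U(1) by (intro integrable_mult_right integrable_real_indicator) (auto simp: emeasure_eq_measure)
    show "(cmod (f x) / 2)\<^sup>2 * indicator U y \<le> (cmod (f y))\<^sup>2" for y
      by (auto simp: indicator_def U_def intro!: power_mono)
  qed (intro integrable_continuous continuous_sq f)
  finally show ?thesis .
qed

lemma sqnorm_translate_reflect:
  assumes f: "continuous_everywhere f"
  shows "(LINT t|m. (cmod (f (x - t)))\<^sup>2) = sqnorm f"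
proof -
  have "continuous_everywhere (\<lambda>x. complex_of_real ((cmod (f x))\<^sup>2))"
    using f by (intro continuous_intros)
  from integral_reflect[OF this, of x] show ?thesis
    unfolding sqnorm_def by (simp only: integral_complex_of_real of_real_eq_iff)
qed

text \<open>Cauchy-Schwarz, from a quadratic in \<open>s\<close> that is nonnegative everywhere. The
  bound is uniform in \<open>x\<close>; convolution therefore turns L2 convergence into uniform
  convergence.\<close>

lemma conv_bound:
  assumes f: "continuous_everywhere f" and g: "continuous_everywhere g"
  shows "(cmod (conv f g x))\<^sup>2 \<le> sqnorm f * sqnorm g"
proof -
  define A where "A = (LINT t|m. cmod (f t) * cmod (g (x - t)))"
  have g': "continuous_everywhere (\<lambda>t. g (x - t))" using continuous_compose_diff(3)[OF g] .
  have ii: "integrable m (\<lambda>t. cmod (f t) * cmod (g (x - t)))" "integrable m (\<lambda>t. (cmod (f t))\<^sup>2)"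
    "integrable m (\<lambda>t. (cmod (g (x - t)))\<^sup>2)"
    using f g' by (auto intro!: integrable_continuous continuous_intros)
  have A: "cmod (conv f g x) \<le> A"
    unfolding A_def conv_def by (rule order_trans[OF integral_norm_bound]) (simp add: norm_mult)
  have "2 * A * s \<le> sqnorm f * s\<^sup>2 + sqnorm g" for s
  proof -
    have "2 * A * s = (LINT t|m. 2 * s * (cmod (f t) * cmod (g (x - t))))" by (simp add: A_def)
    also have "\<dots> \<le> (LINT t|m. s\<^sup>2 * (cmod (f t))\<^sup>2 + (cmod (g (x - t)))\<^sup>2)"
    proof (rule integral_mono)
      show "2 * s * (cmod (f t) * cmod (g (x - t))) \<le> s\<^sup>2 * (cmod (f t))\<^sup>2 + (cmod (g (x - t)))\<^sup>2" for t
        using zero_le_power2[of "s * cmod (f t) - cmod (g (x - t))"]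
        by (simp add: power2_eq_square algebra_simps)
    qed (use ii in auto)
    also have "\<dots> = sqnorm f * s\<^sup>2 + sqnorm g"
      using ii sqnorm_translate_reflect[OF g, of x] by (simp add: sqnorm_def)
    finally show ?thesis .
  qed
  note quad = this
  have "A\<^sup>2 \<le> sqnorm f * sqnorm g"
  proof (cases "sqnorm f = 0")
    case True
    have "A \<le> 0"
    proof (rule ccontr)
      assume "\<not> A \<le> 0"
      \<comment> \<open>This \<open>s\<close> makes \<open>2 * A * s\<close> equal to
        \<open>sqnorm g + 1\<close>, too large when the quadratic term is absent.\<close>
      then show False using quad[of "(sqnorm g + 1) / (2 * A)"] True by (simp add: field_simps)
    qed
    moreover have "A \<ge> 0" by (simp add: A_def)
    ultimately show ?thesis using True by simp
  next
    case False
    then have "sqnorm f > 0" using sqnorm_nonneg[of f] by simp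
    \<comment> \<open>The minimum of the quadratic is at \<open>A / sqnorm f\<close>.\<close>
    then show ?thesis using quad[of "A / sqnorm f"] by (simp add: field_simps power2_eq_square)
  qed
  then show ?thesis using A by (meson norm_ge_zero order_trans power_mono)
qed

lemma sqnorm_le_sup:
  assumes "continuous_everywhere f" "\<And>x. cmod (f x) \<le> B"
  shows "sqnorm f \<le> B\<^sup>2"
proof -
  have "sqnorm f \<le> (LINT x|m. B\<^sup>2)"
    unfolding sqnorm_def using assms
    by (intro integral_mono integrable_continuous continuous_sq) (auto intro!: power_mono)
  then show ?thesis by simp
qed

lemma sqnorm_conv_le:
  assumes f: "continuous_everywhere f" and g: "continuous_everywhere g"
  shows "sqnorm (conv f g) \<le> sqnorm f * sqnorm g"
proof -
  have "cmod (conv f g x) \<le> sqrt (sqnorm f * sqnorm g)" for x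
    using conv_bound[OF f g, of x] by (simp add: real_le_rsqrt)
  then have "sqnorm (conv f g) \<le> (sqrt (sqnorm f * sqnorm g))\<^sup>2"
    by (intro sqnorm_le_sup continuous_conv f g)
  then show ?thesis by (simp add: sqnorm_nonneg)
qed

text \<open>A nonzero self-adjoint idempotent takes at the origin the dimension of its range.\<close>

lemma idempotent_at_0:
  assumes q: "continuous_everywhere q" "adj q = q" "conv q q = q" and nz: "q x \<noteq> 0"
  shows "q 0 = complex_of_real (sqnorm q)" "sqnorm q \<ge> 1"
proof -
  show 0: "q 0 = complex_of_real (sqnorm q)" using conv_adj_0[of q] q by simp
  have "cmod (q y) \<le> sqnorm q" for y
    using conv_bound[OF q(1,1), of y] q(3) sqnorm_nonneg[of q]
    by (simp add: power2_eq_square[symmetric] power2_le_iff_abs_le)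
  \<comment> \<open>The total mass is 1, so the sup norm dominates the L2 norm. A positive number
    that is at most its own square is at least 1.\<close>
  then have "sqnorm q \<le> (sqnorm q)\<^sup>2" by (intro sqnorm_le_sup q)
  then show "sqnorm q \<ge> 1" using sqnorm_pos[OF q(1) nz] by (simp add: power2_eq_square)
qed

end

section \<open>Characters and uniqueness of Fourier coefficients\<close>

text \<open>Log-convexity makes the ratios of consecutive terms increase to a limit
  \<open>l\<close>, so \<open>e n / l ^ Suc n\<close> decreases, and submultiplicativity keeps it
  above 1. For the squared norms of the powers of a self-adjoint operator, \<open>l\<close> is the
  top eigenvalue of its square.\<close>

lemma log_convex_submultiplicative_limit:
  fixes e :: "nat \<Rightarrow> real"
  assumes pos: "\<And>n. e n > 0"
    and conv: "\<And>n. (e (Suc n))\<^sup>2 \<le> e n * e (Suc (Suc n))"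
    and sub: "\<And>n m. e (Suc (n + m)) \<le> e n * e m"
  obtains l where "l > 0" "\<And>n. 1 \<le> e n / l ^ Suc n" "convergent (\<lambda>n. e n / l ^ Suc n)"
proof -
  define r where "r n = e (Suc n) / e n" for n
  have r_pos: "r n > 0" for n using pos by (simp add: r_def)
  have "r n \<le> r (Suc n)" for n
    using conv[of n] pos[of n] pos[of "Suc n"] by (simp add: r_def field_simps power2_eq_square)
  then have inc: "incseq r" by (rule incseq_SucI)
  have r_le: "r n \<le> e 0" for n
    using sub[of n 0] pos[of n] by (simp add: r_def field_simps)
  obtain l where l: "r \<longlonglongrightarrow> l" "\<And>n. r n \<le> l"
    using incseq_convergent[OF inc] r_le by metis
  have l_pos: "l > 0" using r_pos[of 0] l(2)[of 0] by simp
  have lim: "(\<lambda>m. e (m + n) / e m) \<longlonglongrightarrow> l ^ n" for n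
  proof (induction n)
    case 0
    then show ?case using pos by (simp add: less_imp_neq[symmetric])
  next
    case (Suc n)
    have "(\<lambda>m. r (m + n) * (e (m + n) / e m)) \<longlonglongrightarrow> l * l ^ n"
      using Suc LIMSEQ_ignore_initial_segment[OF l(1), of n] by (intro tendsto_mult)
    moreover have "(\<lambda>m. r (m + n) * (e (m + n) / e m)) = (\<lambda>m. e (m + Suc n) / e m)"
      using pos by (simp add: r_def fun_eq_iff less_imp_neq[symmetric])
    ultimately show ?case by simp
  qed
  \<comment> \<open>Submultiplicativity bounds \<open>e (m + Suc n) / e m\<close> by
    \<open>e n\<close> for every \<open>m\<close>, and \<open>l ^ Suc n\<close> is the limit in
    \<open>m\<close>.\<close>
  have ge: "l ^ Suc n \<le> e n" for n
  proof (rule LIMSEQ_le_const2[OF lim[of "Suc n"]])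
    have "e (m + Suc n) / e m \<le> e n" for m
      using sub[of n m] pos[of m] by (simp add: field_simps add.commute)
    then show "\<exists>N. \<forall>m\<ge>N. e (m + Suc n) / e m \<le> e n" by blast
  qed
  have dec: "decseq (\<lambda>n. e n / l ^ Suc n)"
  proof (rule decseq_SucI)
    fix n
    have "e (Suc n) \<le> l * e n" using l(2)[of n] pos[of n] by (simp add: r_def field_simps)
    then show "e (Suc n) / l ^ Suc (Suc n) \<le> e n / l ^ Suc n"
      using l_pos by (simp add: field_simps)
  qed
  show ?thesis
  proof
    show "l > 0" by fact
    show 1: "1 \<le> e n / l ^ Suc n" for n
      using ge[of n] l_pos by (simp add: field_simps)
    show "convergent (\<lambda>n. e n / l ^ Suc n)"
      using decseq_convergent[OF dec, of 1] 1 by (metis convergentI)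
  qed
qed

context haar_group begin

text \<open>Power iteration: the normalised convolution powers of a self-adjoint function converge
  uniformly to the projection onto the top eigenspace of the square of its convolution operator.\<close>

lemma spectral_idempotent:
  assumes k: "continuous_everywhere k" "adj k = k" and nz: "k x0 \<noteq> 0"
  obtains l q where "l > 0" "continuous_everywhere q" "adj q = q" "conv q q = q" "q 0 \<noteq> 0"
    "conv (conv k k) q = (\<lambda>x. complex_of_real l * q x)"
proof -
  \<comment> \<open>\<open>p n\<close> is the convolution power with \<open>n + 1\<close> factors
    \<open>k\<close>; hence the \<open>Suc\<close> in \<open>pp\<close> and in the exponents of
    \<open>l\<close>.\<close>
  define p where "p n = (conv k ^^ n) k" for n
  have p0: "p 0 = k" and pS: "p (Suc n) = conv k (p n)" for n by (simp_all add: p_def)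
  have pc: "continuous_everywhere (p n)" for n
    by (induction n) (auto simp: p0 pS k intro!: continuous_conv)
  have pp: "conv (p n) (p j) = p (Suc (n + j))" for n j
    by (induction n) (auto simp: p0 pS conv_assoc k pc)
  have pa: "adj (p n) = p n" for n
  proof (induction n)
    case (Suc n)
    have "adj (p (Suc n)) = conv k (p n)" using Suc k pc by (simp add: pS adj_conv)
    then show ?case by (simp add: pS)
  qed (simp add: p0 k)
  define e where "e n = sqnorm (p n)" for n
  have e0: "p (Suc (n + n)) 0 = complex_of_real (e n)" for n
    using conv_adj_0[of "p n"] by (simp add: pa pp e_def)
  have p_zero: "p (n + j) = (\<lambda>_. 0)" if "p n = (\<lambda>_. 0)" for n j
    using that by (induction j) (auto simp: pS conv_def)
  have e_pos_if: "e n > 0" if "p n \<noteq> (\<lambda>_. 0)" for n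
    using that sqnorm_pos[OF pc] unfolding e_def by (auto simp: fun_eq_iff)
  have pnz: "p n \<noteq> (\<lambda>_. 0)" for n
  proof (induction n)
    case 0
    then show ?case using nz by (auto simp: p0 fun_eq_iff)
  next
    case (Suc n)
    show ?case
    proof
      assume "p (Suc n) = (\<lambda>_. 0)"
      \<comment> \<open>If one power vanished, so would the later \<open>p (Suc (n + n))\<close>,
        whose value at 0 is \<open>e n\<close>.\<close>
      from p_zero[OF this, of n] e0[of n] e_pos_if[OF Suc] show False by simp
    qed
  qed
  then have e_pos: "e n > 0" for n by (rule e_pos_if)
  have e_conv: "(e (Suc n))\<^sup>2 \<le> e n * e (Suc (Suc n))" for n
  proof -
    \<comment> \<open>The middle norm is the inner product of its two neighbours, so log-convexity
      is Cauchy-Schwarz.\<close>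
    have "conv (p n) (p (Suc (Suc n))) 0 = complex_of_real (e (Suc n))"
      using e0[of "Suc n"] by (simp add: pp)
    then show ?thesis using conv_bound[OF pc pc, of n "Suc (Suc n)" 0] by (simp add: e_def)
  qed
  have e_sub: "e (Suc (n + j)) \<le> e n * e j" for n j
    using sqnorm_conv_le[OF pc pc, of n j] by (simp add: pp e_def)
  obtain l where l: "l > 0" and b1: "\<And>n. 1 \<le> e n / l ^ Suc n"
    and bconv: "convergent (\<lambda>n. e n / l ^ Suc n)"
    using log_convex_submultiplicative_limit[of e] e_pos e_conv e_sub by metis
  define b where "b n = e n / l ^ Suc n" for n
  obtain b' where b': "b \<longlonglongrightarrow> b'" using bconv by (auto simp: b_def[abs_def] convergent_def)
  define c where "c n = complex_of_real (1 / l ^ Suc n)" for n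
  \<comment> \<open>Only even powers of \<open>k\<close> occur: \<open>Q n\<close> is the power with
    \<open>n + 1\<close> factors of \<open>conv k k\<close> divided by \<open>l\<close>. Eigenvalues
    of \<open>k\<close> of opposite sign therefore cannot make the sequence oscillate.\<close>
  define Q where "Q n x = c n * p (Suc (n + n)) x" for n x
  have cc: "c n * c j = c (Suc (n + j))" for n j
    by (simp add: c_def power_add)
  have Qc: "continuous_everywhere (Q n)" for n
    unfolding Q_def[abs_def] by (intro continuous_intros pc)
  have QQ: "conv (Q n) (Q j) = Q (Suc (n + j))" for n j
  proof -
    have "conv (Q n) (Q j) = (\<lambda>x. c n * (c j * p (Suc (Suc (n + n) + Suc (j + j))) x))"
      unfolding Q_def[abs_def] conv_scale_left conv_scale_right pp ..
    moreover have "n + n + (j + j) = n + j + (n + j)" by simp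
    ultimately show ?thesis
      unfolding Q_def[abs_def] mult.assoc[symmetric] cc by simp
  qed
  have Qa: "adj (Q n) = Q n" for n
  proof
    fix x
    have "adj (Q n) x = c n * adj (p (Suc (n + n))) x" by (simp add: adj_def Q_def c_def)
    then show "adj (Q n) x = Q n x" by (simp add: pa Q_def)
  qed
  have Q0: "Q n 0 = complex_of_real (b n)" for n
    unfolding Q_def e0 by (simp add: c_def b_def)
  \<comment> \<open>Products of the \<open>Q n\<close> are again members of the sequence, so their
    L2 distances depend on the convergent sequence \<open>b\<close> alone, which makes
    \<open>Q\<close> Cauchy in L2.\<close>
  have Qdiff: "sqnorm (\<lambda>x. Q n x - Q j x) = b (Suc (n + n)) - 2 * b (Suc (n + j)) + b (Suc (j + j))" for n j
  proof -
    define D where "D = (\<lambda>x. Q n x - Q j x)"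
    have "adj D = D"
      using Qa[of n] Qa[of j] by (simp add: D_def adj_def fun_eq_iff)
    then have "complex_of_real (sqnorm D) = conv D D 0" using conv_adj_0[of D] by simp
    also have "\<dots> = (Q (Suc (n + n)) 0 - Q (Suc (n + j)) 0) - (Q (Suc (j + n)) 0 - Q (Suc (j + j)) 0)"
      unfolding D_def
      by (subst conv_diff_left, (intro continuous_intros Qc)+)
         (simp add: conv_diff_right Qc QQ)
    also have "\<dots> = complex_of_real (b (Suc (n + n)) - 2 * b (Suc (n + j)) + b (Suc (j + j)))"
      unfolding Q0 by (simp add: add.commute)
    finally show ?thesis unfolding D_def of_real_eq_iff .
  qed
  define S where "S = sqnorm (Q 0)"
  have S: "S \<ge> 0" by (simp add: S_def sqnorm_nonneg)
  \<comment> \<open>One more convolution with \<open>Q 0\<close> shifts the index by one and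
    upgrades the L2 estimate to a uniform one.\<close>
  have Qstep: "(cmod (Q (Suc n) x - Q (Suc j) x))\<^sup>2 \<le> S * sqnorm (\<lambda>x. Q n x - Q j x)" for n j x
  proof -
    have "conv (Q 0) (\<lambda>x. Q n x - Q j x) x = Q (Suc n) x - Q (Suc j) x"
      by (simp add: conv_diff_right Qc QQ)
    moreover have "continuous_everywhere (\<lambda>x. Q n x - Q j x)" by (intro continuous_intros Qc)
    ultimately show ?thesis using conv_bound[OF Qc, of "\<lambda>x. Q n x - Q j x" 0 x] by (simp add: S_def)
  qed
  have "uniformly_Cauchy_on UNIV (\<lambda>n. Q (Suc n))"
  proof (rule uniformly_Cauchy_onI)
    fix \<epsilon> :: real assume "\<epsilon> > 0"
    \<comment> \<open>The coefficients 1, -2, 1 in \<open>Qdiff\<close> cost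
      \<open>4 * \<delta>\<close>, and \<open>Qstep\<close> contributes the factor
      \<open>S\<close>.\<close>
    define \<delta> where "\<delta> = \<epsilon>\<^sup>2 / (4 * (S + 1))"
    have "\<delta> > 0" using S \<open>\<epsilon> > 0\<close> by (simp add: \<delta>_def)
    then obtain N where N: "\<And>n. n \<ge> N \<Longrightarrow> \<bar>b n - b'\<bar> < \<delta>"
      using b' by (auto simp: LIMSEQ_iff)
    have "dist (Q (Suc n) x) (Q (Suc j) x) < \<epsilon>" if "n \<ge> N" "j \<ge> N" for n j x
    proof -
      have "sqnorm (\<lambda>x. Q n x - Q j x) < 4 * \<delta>"
        unfolding Qdiff using N[of "Suc (n + n)"] N[of "Suc (n + j)"] N[of "Suc (j + j)"] that by linarith
      then have "S * sqnorm (\<lambda>x. Q n x - Q j x) \<le> S * (4 * \<delta>)"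
        using S by (intro mult_left_mono) auto
      also have "\<dots> < \<epsilon>\<^sup>2" using S \<open>\<epsilon> > 0\<close> by (simp add: \<delta>_def field_simps)
      finally have "(cmod (Q (Suc n) x - Q (Suc j) x))\<^sup>2 < \<epsilon>\<^sup>2" using Qstep[of n x j] by simp
      then show ?thesis using \<open>\<epsilon> > 0\<close> by (simp add: dist_norm power_less_imp_less_base)
    qed
    then show "\<exists>N. \<forall>x\<in>UNIV. \<forall>n\<ge>N. \<forall>j\<ge>N. dist (Q (Suc n) x) (Q (Suc j) x) < \<epsilon>" by blast
  qed
  then have "uniformly_convergent_on UNIV (\<lambda>n. Q (Suc n))"
    by (rule Cauchy_uniformly_convergent)
  then obtain q where ql: "uniform_limit UNIV (\<lambda>n. Q (Suc n)) q sequentially"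
    by (auto simp: uniformly_convergent_on_def)
  have qc: "continuous_everywhere q"
    by (rule uniform_limit_theorem[OF _ ql]) (auto intro!: always_eventually Qc)
  have qpt: "(\<lambda>n. Q n x) \<longlonglongrightarrow> q x" for x
    using tendsto_uniform_limitI[OF ql, of x] LIMSEQ_imp_Suc[of "\<lambda>n. Q n x"] by simp
  have Qlim: "(\<lambda>n. conv (Q (Suc n)) f x) \<longlonglongrightarrow> conv q f x" if f: "continuous_everywhere f" for f x
  proof (rule LIMSEQ_I)
    fix \<epsilon> :: real assume "\<epsilon> > 0"
    define B where "B = sqrt (sqnorm f)"
    have B: "B \<ge> 0" by (simp add: B_def sqnorm_nonneg)
    have "\<epsilon> / (B + 1) > 0" using B \<open>\<epsilon> > 0\<close> by simp
    then obtain N where N: "\<And>n x. n \<ge> N \<Longrightarrow> dist (Q (Suc n) x) (q x) < \<epsilon> / (B + 1)"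
      using ql unfolding uniform_limit_iff eventually_sequentially by blast
    have "norm (conv (Q (Suc n)) f x - conv q f x) < \<epsilon>" if "n \<ge> N" for n
    proof -
      have dc: "continuous_everywhere (\<lambda>x. Q (Suc n) x - q x)" by (intro continuous_intros Qc qc)
      have "sqnorm (\<lambda>x. Q (Suc n) x - q x) \<le> (\<epsilon> / (B + 1))\<^sup>2"
        using N[OF that] by (intro sqnorm_le_sup dc) (simp add: dist_norm less_imp_le)
      then have "sqnorm (\<lambda>x. Q (Suc n) x - q x) * sqnorm f \<le> (\<epsilon> / (B + 1))\<^sup>2 * B\<^sup>2"
        using sqnorm_nonneg by (intro mult_mono) (auto simp: B_def)
      then have "(cmod (conv (\<lambda>x. Q (Suc n) x - q x) f x))\<^sup>2 \<le> (\<epsilon> / (B + 1) * B)\<^sup>2"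
        using conv_bound[OF dc f, of x] unfolding power_mult_distrib by linarith
      then have "cmod (conv (\<lambda>x. Q (Suc n) x - q x) f x) \<le> \<epsilon> / (B + 1) * B"
      proof (rule power2_le_imp_le)
        show "0 \<le> \<epsilon> / (B + 1) * B" using B \<open>\<epsilon> > 0\<close> by simp
      qed
      also have "\<dots> < \<epsilon>" using B \<open>\<epsilon> > 0\<close> by (simp add: field_simps)
      finally show ?thesis by (simp add: conv_diff_left Qc qc f)
    qed
    then show "\<exists>N. \<forall>n\<ge>N. norm (conv (Q (Suc n)) f x - conv q f x) < \<epsilon>" by blast
  qed
  have qQ: "conv q (Q j) = q" for j
  proof
    fix x
    have "(\<lambda>n. Q (n + (j + 2)) x) \<longlonglongrightarrow> q x" using qpt by (rule LIMSEQ_ignore_initial_segment)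
    then have "(\<lambda>n. conv (Q (Suc n)) (Q j) x) \<longlonglongrightarrow> q x" by (simp add: QQ add.assoc[symmetric])
    then show "conv q (Q j) x = q x" using Qlim[OF Qc] LIMSEQ_unique by blast
  qed
  then have Qq: "conv (Q j) q = q" for j using conv_commute[OF Qc qc] by simp
  show ?thesis
  proof
    show "l > 0" by fact
    show "continuous_everywhere q" by fact
    show "adj q = q"
    proof
      fix x
      have "(\<lambda>n. adj (Q n) x) \<longlonglongrightarrow> adj q x"
        unfolding adj_def by (intro tendsto_cnj qpt)
      then show "adj q x = q x" unfolding Qa using qpt LIMSEQ_unique by blast
    qed
    show "conv q q = q"
    proof
      fix x
      show "conv q q x = q x" using Qlim[OF qc, of x] by (simp add: Qq LIMSEQ_const_iff)
    qed
    show "q 0 \<noteq> 0"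
    proof
      assume "q 0 = 0"
      then have "(\<lambda>n. complex_of_real (b n)) \<longlonglongrightarrow> complex_of_real 0" using qpt[of 0] by (simp add: Q0)
      then have "b \<longlonglongrightarrow> 0" by (simp only: tendsto_of_real_iff)
      then have "1 \<le> (0::real)" by (rule LIMSEQ_le_const) (use b1 in \<open>auto simp: b_def\<close>)
      then show False by simp
    qed
    have "conv k k = (\<lambda>x. complex_of_real l * Q 0 x)"
      using l by (simp add: Q_def c_def pS p0)
    then show "conv (conv k k) q = (\<lambda>x. complex_of_real l * q x)"
      by (simp add: conv_scale_left Qq)
  qed
qed

text \<open>Descent on the dimension \<open>sqnorm q\<close> of the range, with \<open>n\<close> as
  an integer bound for the induction. Either a smaller nonzero idempotent splits off, or the range
  is a line; being invariant under translations, the line then consists of multiples of a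
  character.\<close>

lemma idempotent_contains_character:
  assumes "continuous_everywhere q" "adj q = q" "conv q q = q" "q x \<noteq> 0" "sqnorm q < real n"
  shows "\<exists>\<gamma>\<in>dual_group. conv q \<gamma> = \<gamma>"
  using assms
proof (induction n arbitrary: q x)
  case 0
  then show ?case using sqnorm_nonneg[of q] by simp
next
  case (Suc n)
  note qc = Suc.prems(1) and qa = Suc.prems(2) and qq = Suc.prems(3)
  have q0: "q 0 = complex_of_real (sqnorm q)" "sqnorm q \<ge> 1"
    using idempotent_at_0[OF Suc.prems(1-4)] by auto
  show ?case
  \<comment> \<open>The condition is on \<open>conv k k\<close> and not on \<open>k\<close> because
    \<open>spectral_idempotent\<close> diagonalises the square: if its idempotent were all of
    \<open>q\<close>, then \<open>conv k k\<close> would be a multiple of \<open>q\<close>.\<close>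
  proof (cases "\<exists>k. continuous_everywhere k \<and> adj k = k \<and> conv q k = k \<and> (\<nexists>c. conv k k = (\<lambda>x. c * q x))")
    case True
    then obtain k where k: "continuous_everywhere k" "adj k = k" "conv q k = k"
      and nc: "\<And>c. conv k k \<noteq> (\<lambda>x. c * q x)" by blast
    have "\<exists>x0. k x0 \<noteq> 0"
    proof (rule ccontr)
      assume "\<not> ?thesis"
      then have "conv k k = (\<lambda>x. 0 * q x)" by (simp add: conv_def[abs_def])
      with nc show False by blast
    qed
    then obtain x0 where "k x0 \<noteq> 0" by blast
    from spectral_idempotent[OF k(1,2) this] obtain l p where l: "l > 0" and p: "continuous_everywhere p" "adj p = p" "conv p p = p" "p 0 \<noteq> 0"
      and kp: "conv (conv k k) p = (\<lambda>x. complex_of_real l * p x)"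
      by metis
    have kk: "continuous_everywhere (conv k k)" using k by (intro continuous_conv)
    have qkk: "conv q (conv k k) = conv k k" using conv_assoc[OF qc k(1) k(1)] k(3) by simp
    have "conv q (\<lambda>x. complex_of_real l * p x) = (\<lambda>x. complex_of_real l * p x)"
      using conv_assoc[OF qc kk p(1)] qkk kp by simp
    then have qp: "conv q p = p"
      using l by (simp add: conv_scale_right fun_eq_iff)
    have pq: "conv p q = p" using conv_commute[OF p(1) qc] qp by simp
    define r where "r = (\<lambda>x. q x - p x)"
    have rc: "continuous_everywhere r" unfolding r_def by (intro continuous_intros qc p)
    have ra: "adj r = r" using qa p(2) by (simp add: r_def adj_def fun_eq_iff)
    have rr: "conv r r = r"
      unfolding r_def
      by (subst conv_diff_left, (intro continuous_intros qc p)+)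
         (simp add: conv_diff_right qc p qq qp pq)
    have "\<exists>y. r y \<noteq> 0"
    proof (rule ccontr)
      assume "\<not> ?thesis"
      then have "p = q" by (simp add: r_def fun_eq_iff)
      then have "conv k k = (\<lambda>x. complex_of_real l * q x)"
        using kp qkk conv_commute[OF qc kk] by simp
      with nc show False by blast
    qed
    then obtain y where "r y \<noteq> 0" by blast
    from idempotent_at_0[OF rc ra rr this]
    have r0: "r 0 = complex_of_real (sqnorm r)" "sqnorm r \<ge> 1" by auto
    have p0: "p 0 = complex_of_real (sqnorm p)" using idempotent_at_0[OF p] by simp
    \<comment> \<open>Values at 0 are additive, hence so are the dimensions; the complement
      \<open>r\<close> of \<open>p\<close> in \<open>q\<close> accounts for at least 1.\<close>
    have "complex_of_real (sqnorm r) = complex_of_real (sqnorm q - sqnorm p)"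
      using r0(1) q0(1) p0 by (simp add: r_def)
    then have "sqnorm r = sqnorm q - sqnorm p" by (simp only: of_real_eq_iff)
    then have "sqnorm p < real n" using r0(2) Suc.prems(5) by simp
    from Suc.IH[OF p this] obtain \<gamma> where \<gamma>: "\<gamma> \<in> dual_group" "conv p \<gamma> = \<gamma>" by blast
    have "conv q \<gamma> = \<gamma>"
      using conv_assoc[OF qc p(1), of \<gamma>] \<gamma> qp by (simp add: dual_group_def)
    then show ?thesis using \<gamma> by blast
  next
    case False
    then have sq: "\<exists>c. conv k k = (\<lambda>x. c * q x)"
      if "continuous_everywhere k" "adj k = k" "conv q k = k" for k
      using that by blast
    \<comment> \<open>Polarisation: the square of \<open>k + q\<close> contains \<open>k\<close>
      twice as cross term, all other terms being multiples of \<open>q\<close>.\<close>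
    have sa: "\<exists>c. k = (\<lambda>x. c * q x)"
      if k: "continuous_everywhere k" "adj k = k" "conv q k = k" for k
    proof -
      have kq: "conv k q = k" using conv_commute[OF k(1) qc] k(3) by simp
      obtain c where c: "conv k k = (\<lambda>x. c * q x)" using sq[OF k] by blast
      have "continuous_everywhere (\<lambda>x. k x + q x)" "adj (\<lambda>x. k x + q x) = (\<lambda>x. k x + q x)"
        "conv q (\<lambda>x. k x + q x) = (\<lambda>x. k x + q x)"
        using k qc qa qq by (auto simp: conv_add_right adj_def fun_eq_iff intro!: continuous_intros)
      from sq[OF this] obtain d
        where d: "conv (\<lambda>x. k x + q x) (\<lambda>x. k x + q x) = (\<lambda>x. d * q x)" by blast
      have "conv (\<lambda>x. k x + q x) (\<lambda>x. k x + q x) = (\<lambda>x. c * q x + k x + (k x + q x))"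
        by (subst conv_add_left, (intro continuous_intros k qc)+)
           (simp add: conv_add_right qc k kq qq c)
      then have "k x = ((d - c - 1) / 2) * q x" for x
        using fun_cong[OF d, of x] by (simp add: field_simps)
      then show ?thesis by blast
    qed
    have one_dim: "\<exists>c. w = (\<lambda>x. c * q x)" if w: "continuous_everywhere w" "conv q w = w" for w
    proof -
      have aw: "continuous_everywhere (adj w)" "conv q (adj w) = adj w"
        using adj_conv[OF qc w(1)] qa w by (auto intro: continuous_adj)
      define a where "a = (\<lambda>x. w x + adj w x)"
      define b where "b = (\<lambda>x. \<i> * (w x - adj w x))"
      have "\<exists>c. a = (\<lambda>x. c * q x)"
      proof (rule sa)
        show "conv q a = a" using w aw qc by (simp add: a_def conv_add_right)
      qed (use w aw in \<open>auto simp: a_def adj_def fun_eq_iff intro!: continuous_intros\<close>)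
      moreover have "\<exists>c. b = (\<lambda>x. c * q x)"
      proof (rule sa)
        show "conv q b = b" using w aw qc by (simp add: b_def conv_scale_right conv_diff_right)
      qed (use w aw in \<open>auto simp: b_def adj_def fun_eq_iff algebra_simps intro!: continuous_intros\<close>)
      ultimately obtain c d where "a = (\<lambda>x. c * q x)" "b = (\<lambda>x. d * q x)" by blast
      then have "w x + adj w x = c * q x" "\<i> * (w x - adj w x) = d * q x" for x
        by (auto simp: a_def b_def fun_eq_iff)
      moreover have "w x = ((w x + adj w x) - \<i> * (\<i> * (w x - adj w x))) / 2" for x
        by (simp add: mult.assoc[symmetric])
      ultimately have "w x = (c * q x - \<i> * (d * q x)) / 2" for x by metis
      then have "w x = ((c - \<i> * d) / 2) * q x" for x by (simp add: algebra_simps)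
      then show ?thesis by blast
    qed
    have qnz: "q 0 \<noteq> 0" using q0 by simp
    \<comment> \<open>A translate of \<open>q\<close> stays in the range, so it is a multiple of
      \<open>q\<close>; evaluation at 0 identifies the factor.\<close>
    have mult: "q (x + y) = q x * q y / q 0" for x y
    proof -
      have "conv q (\<lambda>x. q (x + y)) = (\<lambda>x. q (x + y))"
      proof
        fix x
        have "conv q (\<lambda>x. q (x + y)) x = conv q q (x + y)"
          by (simp add: conv_def algebra_simps)
        then show "conv q (\<lambda>x. q (x + y)) x = q (x + y)" by (simp add: qq)
      qed
      moreover have "continuous_everywhere (\<lambda>x. q (x + y))"
        using continuous_compose_diff(6)[OF qc, of y] by (simp add: add.commute)
      ultimately obtain c where c: "(\<lambda>x. q (x + y)) = (\<lambda>x. c * q x)" using one_dim by blast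
      from fun_cong[OF c, of 0] fun_cong[OF c, of x] show ?thesis using qnz by simp
    qed
    define \<gamma> where "\<gamma> = (\<lambda>x. (1 / q 0) * q x)"
    have \<gamma>m: "\<gamma> (x + y) = \<gamma> x * \<gamma> y" for x y by (simp add: \<gamma>_def mult)
    have "cmod (\<gamma> x) = 1" for x
    proof -
      have "cnj (q (- x)) = q x" using fun_cong[OF qa, of x] by (simp add: adj_def)
      moreover have "cnj (q 0) = q 0" using q0 by simp
      ultimately have "cnj (\<gamma> (- x)) = \<gamma> x" by (simp add: \<gamma>_def)
      then have "\<gamma> x * cnj (\<gamma> x) = \<gamma> x * \<gamma> (- x)" by (metis complex_cnj_cnj)
      also have "\<dots> = \<gamma> 0" by (simp add: \<gamma>m[symmetric])
      also have "\<dots> = 1" using qnz by (simp add: \<gamma>_def)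
      finally have "(cmod (\<gamma> x))\<^sup>2 = 1"
        by (simp add: complex_norm_square[symmetric] flip: of_real_power)
      then show ?thesis using norm_ge_zero[of "\<gamma> x"] unfolding power2_eq_1_iff by linarith
    qed
    moreover have "continuous_everywhere \<gamma>" unfolding \<gamma>_def by (rule continuous_on_mult_left[OF qc])
    ultimately have \<gamma>d: "\<gamma> \<in> dual_group" using \<gamma>m by (simp add: dual_group_def)
    have "conv q \<gamma> = \<gamma>" unfolding \<gamma>_def conv_scale_right qq ..
    then show ?thesis using \<gamma>d by (rule bexI)
  qed
qed

section \<open>Elementary properties of characters, uniqueness of coefficients,
  orthogonality\<close>

lemma dual_groupD:
  assumes "\<gamma> \<in> dual_group"
  shows "continuous_everywhere \<gamma>" "cmod (\<gamma> x) = 1" "\<gamma> (x + y) = \<gamma> x * \<gamma> y"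
    "\<gamma> (- x) = cnj (\<gamma> x)" "\<gamma> (x - y) = \<gamma> x * cnj (\<gamma> y)" "\<gamma> 0 = 1" "\<gamma> x \<noteq> 0"
proof -
  show *: "continuous_everywhere \<gamma>" "cmod (\<gamma> x) = 1" "\<gamma> (x + y) = \<gamma> x * \<gamma> y" for x y
    using assms by (auto simp: dual_group_def)
  show nz: "\<gamma> x \<noteq> 0" for x using *(2)[of x] by auto
  have "\<gamma> 0 * \<gamma> 0 = \<gamma> 0" using *(3)[of 0 0] by simp
  then show 1: "\<gamma> 0 = 1" using nz[of 0] by simp
  show m: "\<gamma> (- x) = cnj (\<gamma> x)" for x
  proof -
    have "\<gamma> x * \<gamma> (- x) = \<gamma> x * cnj (\<gamma> x)"
      using *(3)[of x "- x"] 1 *(2)[of x] complex_norm_square[of "\<gamma> x"] by simp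
    then show ?thesis using nz[of x] by simp
  qed
  show "\<gamma> (x - y) = \<gamma> x * cnj (\<gamma> y)" using *(3)[of x "- y"] m by simp
qed

text \<open>For \<open>w\<close> not identically 0, \<open>k\<close> is a nonzero self-adjoint
  kernel, and the top eigenspace of its square contains a character. Convolution by
  \<open>conv k k\<close> multiplies that character by \<open>l > 0\<close>, whereas the vanishing
  coefficient of \<open>w\<close> makes the same convolution vanish.\<close>

theorem fourier_uniqueness:
  assumes w: "continuous_everywhere w" and 0: "\<And>\<gamma>. \<gamma> \<in> dual_group \<Longrightarrow> fourier_coeff m w \<gamma> = 0"
  shows "w x = 0"
proof (rule ccontr)
  assume "w x \<noteq> 0"
  define k where "k = conv w (adj w)"
  have aw: "continuous_everywhere (adj w)" using w by (rule continuous_adj)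
  have kc: "continuous_everywhere k" unfolding k_def by (intro continuous_conv w aw)
  have k': "k = conv (adj w) w" unfolding k_def by (rule conv_commute[OF w aw])
  have ka: "adj k = k" using k' adj_conv[OF w aw] by (simp add: k_def)
  have "k 0 \<noteq> 0" using sqnorm_pos[OF w \<open>w x \<noteq> 0\<close>] by (simp add: k_def conv_adj_0)
  from spectral_idempotent[OF kc ka this] obtain l q
    where l: "l > 0" and q: "continuous_everywhere q" "adj q = q" "conv q q = q" "q 0 \<noteq> 0"
      and kq: "conv (conv k k) q = (\<lambda>x. complex_of_real l * q x)" by metis
  obtain n where "sqnorm q < real n" using reals_Archimedean2 by blast
  from idempotent_contains_character[OF q this] obtain \<gamma>
    where \<gamma>: "\<gamma> \<in> dual_group" "conv q \<gamma> = \<gamma>" by blast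
  note \<gamma>c = dual_groupD(1)[OF \<gamma>(1)]
  have "conv (conv k k) \<gamma> = conv (conv (conv k k) q) \<gamma>"
    using conv_assoc[OF continuous_conv[OF kc kc] q(1) \<gamma>c] \<gamma>(2) by simp
  also have "\<dots> = (\<lambda>x. complex_of_real l * \<gamma> x)" by (simp add: kq conv_scale_left \<gamma>)
  finally have 1: "conv (conv k k) \<gamma> 0 = complex_of_real l" using dual_groupD(6)[OF \<gamma>(1)] by simp
  have "conv w \<gamma> = (\<lambda>_. 0)"
  proof
    fix y
    have "conv w \<gamma> y = \<gamma> y * fourier_coeff m w \<gamma>"
      by (simp add: conv_def fourier_coeff_def dual_groupD(5)[OF \<gamma>(1)] mult.left_commute)
    then show "conv w \<gamma> y = 0" using 0[OF \<gamma>(1)] by simp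
  qed
  then have "conv k \<gamma> = (\<lambda>_. 0)"
    unfolding k' using conv_assoc[OF aw w \<gamma>c] by (simp add: conv_def[abs_def])
  then have "conv (conv k k) \<gamma> 0 = 0"
    using conv_assoc[OF kc kc \<gamma>c] by (simp add: conv_def)
  with 1 l show False by simp
qed

text \<open>Translating by a point where the characters differ multiplies the coefficient by a
  factor other than 1.\<close>

lemma fourier_coeff_orthogonal:
  assumes "\<gamma> \<in> dual_group" "\<gamma>' \<in> dual_group" "\<gamma> \<noteq> \<gamma>'"
  shows "fourier_coeff m \<gamma> \<gamma>' = 0"
proof -
  obtain a where a: "\<gamma> a \<noteq> \<gamma>' a" using assms(3) by auto
  note D = dual_groupD[OF assms(1)] dual_groupD[OF assms(2)]
  have c: "continuous_everywhere (\<lambda>x. \<gamma> x * cnj (\<gamma>' x))" by (intro continuous_intros D)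
  have "fourier_coeff m \<gamma> \<gamma>' = (LINT x|m. \<gamma> (a + x) * cnj (\<gamma>' (a + x)))"
    unfolding fourier_coeff_def using integral_translate[OF c, of a] by simp
  also have "\<dots> = (LINT x|m. (\<gamma> a * cnj (\<gamma>' a)) * (\<gamma> x * cnj (\<gamma>' x)))"
    by (simp add: D(3) D(10) mult_ac)
  also have "\<dots> = (\<gamma> a * cnj (\<gamma>' a)) * fourier_coeff m \<gamma> \<gamma>'"
    by (simp add: fourier_coeff_def)
  finally have "fourier_coeff m \<gamma> \<gamma>' = 0 \<or> \<gamma> a * cnj (\<gamma>' a) = 1" by simp
  moreover have "\<gamma> a * cnj (\<gamma>' a) \<noteq> 1"
  proof
    assume "\<gamma> a * cnj (\<gamma>' a) = 1"
    then have "\<gamma> a * (cnj (\<gamma>' a) * \<gamma>' a) = \<gamma>' a" by (simp add: mult.assoc[symmetric])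
    moreover have "cnj (\<gamma>' a) * \<gamma>' a = 1"
      using complex_norm_square[of "\<gamma>' a"] D(9)[of a] by (simp add: mult.commute)
    ultimately show False using a by simp
  qed
  ultimately show ?thesis by blast
qed

end

section \<open>The Hahn-Banach theorem for sublinear functionals\<close>

text \<open>The scaling axiom is an inequality, which is what infima preserve most easily; the
  inverse scalar turns it into an equality in \<open>sublinearD\<close>.\<close>

definition sublinear :: "('a::real_vector \<Rightarrow> real) \<Rightarrow> bool" where
  "sublinear q \<longleftrightarrow> (\<forall>x y. q (x + y) \<le> q x + q y) \<and> (\<forall>c>0. \<forall>x. q (c *\<^sub>R x) \<le> c * q x)"

lemma sublinearD:
  assumes "sublinear q"
  shows "q (x + y) \<le> q x + q y" "c > 0 \<Longrightarrow> q (c *\<^sub>R x) = c * q x" "q 0 = 0" "- q (- x) \<le> q x"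
proof -
  show add: "q (x + y) \<le> q x + q y" for x y using assms by (simp add: sublinear_def)
  have le: "q (c *\<^sub>R x) \<le> c * q x" if "c > 0" for c x using assms that by (simp add: sublinear_def)
  show hom: "q (c *\<^sub>R x) = c * q x" if "c > 0" for c x
    using le[OF that, of x] le[of "1 / c" "c *\<^sub>R x"] that by (simp add: field_simps)
  show 0: "q 0 = 0" using hom[of 2 0] by simp
  show "- q (- x) \<le> q x" using add[of x "- x"] 0 by simp
qed

text \<open>The infima at \<open>x\<close> and at \<open>y\<close> may be approached along different
  members of \<open>C\<close>; directedness supplies one member below both.\<close>

lemma sublinear_INF_chain:
  assumes C: "C \<noteq> {}" "\<And>q. q \<in> C \<Longrightarrow> sublinear q"
    and dir: "\<And>q r. q \<in> C \<Longrightarrow> r \<in> C \<Longrightarrow> \<exists>s\<in>C. s \<le> q \<and> s \<le> r"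
    and bdd: "\<And>x. bdd_below ((\<lambda>q. q x) ` C)"
  shows "sublinear (\<lambda>x. INF q\<in>C. q x)"
  unfolding sublinear_def
proof (intro conjI allI impI)
  have le: "(INF q\<in>C. q x) \<le> q x" if "q \<in> C" for q x
    using bdd that by (rule cINF_lower)
  fix x y
  have *: "(INF q\<in>C. q (x + y)) \<le> q x + r y" if qr: "q \<in> C" "r \<in> C" for q r
  proof -
    obtain s where s: "s \<in> C" "s \<le> q" "s \<le> r" using dir[OF qr] by blast
    have "(INF q\<in>C. q (x + y)) \<le> s x + s y"
      using le[OF s(1), of "x + y"] sublinearD(1)[OF C(2)[OF s(1)], of x y] by simp
    also have "\<dots> \<le> q x + r y" using s by (intro add_mono) (auto simp: le_fun_def)
    finally show ?thesis .
  qed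
  have "(INF q\<in>C. q (x + y)) - r y \<le> (INF q\<in>C. q x)" if "r \<in> C" for r
    using C(1) *[OF _ that] by (intro cINF_greatest) (auto simp: algebra_simps)
  then have "(INF q\<in>C. q (x + y)) - (INF q\<in>C. q x) \<le> (INF q\<in>C. q y)"
    using C(1) by (intro cINF_greatest) (auto simp: algebra_simps)
  then show "(INF q\<in>C. q (x + y)) \<le> (INF q\<in>C. q x) + (INF q\<in>C. q y)" by simp
next
  have le: "(INF q\<in>C. q x) \<le> q x" if "q \<in> C" for q x
    using bdd that by (rule cINF_lower)
  fix c :: real and x assume c: "c > 0"
  have "(INF q\<in>C. q (c *\<^sub>R x)) / c \<le> (INF q\<in>C. q x)"
  proof (rule cINF_greatest[OF C(1)])
    fix q assume q: "q \<in> C"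
    show "(INF q\<in>C. q (c *\<^sub>R x)) / c \<le> q x"
      using le[OF q, of "c *\<^sub>R x"] sublinearD(2)[OF C(2)[OF q] c, of x] c by (simp add: field_simps)
  qed
  then show "(INF q\<in>C. q (c *\<^sub>R x)) \<le> c * (INF q\<in>C. q x)"
    using c by (simp add: field_simps)
qed

text \<open>The choice \<open>t = 1\<close> at \<open>- y\<close> gives
  \<open>q' (- y) \<le> - q y\<close>, so passing from \<open>q\<close> to \<open>q'\<close>
  enforces linearity along \<open>y\<close>. The value \<open>- q (- x)\<close> bounds the infimum
  from below.\<close>

lemma sublinear_shift:
  fixes q :: "'a::real_vector \<Rightarrow> real" and y :: 'a
  assumes q: "sublinear q"
  defines "q' \<equiv> \<lambda>x. INF t\<in>{0..}. q (x + t *\<^sub>R y) - t * q y"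
  shows "sublinear q'" "t \<ge> 0 \<Longrightarrow> q' x \<le> q (x + t *\<^sub>R y) - t * q y" "q' x \<le> q x"
proof -
  have lower: "- q (- x) \<le> q (x + t *\<^sub>R y) - t * q y" if "t \<ge> 0" for x t
  proof (cases "t = 0")
    case True
    then show ?thesis using sublinearD(4)[OF q, of x] by simp
  next
    case False
    then have "q (t *\<^sub>R y) = t * q y" using that by (intro sublinearD(2)[OF q]) simp
    then show ?thesis using sublinearD(1)[OF q, of "x + t *\<^sub>R y" "- x"] by simp
  qed
  have bdd: "bdd_below ((\<lambda>t. q (x + t *\<^sub>R y) - t * q y) ` {0..})" for x
    using lower by (intro bdd_belowI2[where m="- q (- x)"]) auto
  show le: "q' x \<le> q (x + t *\<^sub>R y) - t * q y" if "t \<ge> 0" for t x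
    unfolding q'_def using bdd that by (intro cINF_lower) auto
  show "q' x \<le> q x" for x using le[of 0 x] by simp
  show "sublinear q'"
    unfolding sublinear_def
  proof (intro conjI allI impI)
    fix a b
    have *: "q' (a + b) - (q (b + s *\<^sub>R y) - s * q y) \<le> q (a + t *\<^sub>R y) - t * q y"
      if "t \<ge> 0" "s \<ge> 0" for s t
      using le[of "t + s" "a + b"] that sublinearD(1)[OF q, of "a + t *\<^sub>R y" "b + s *\<^sub>R y"]
      by (simp add: algebra_simps)
    have "q' (a + b) - (q (b + s *\<^sub>R y) - s * q y) \<le> q' a" if "s \<ge> 0" for s
      using *[OF _ that] unfolding q'_def by (intro cINF_greatest) auto
    then have "q' (a + b) - q' a \<le> q (b + s *\<^sub>R y) - s * q y" if "s \<ge> 0" for s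
      using that by (simp add: algebra_simps)
    then have "q' (a + b) - q' a \<le> q' b"
      unfolding q'_def by (intro cINF_greatest) auto
    then show "q' (a + b) \<le> q' a + q' b" by simp
  next
    fix c :: real and a assume c: "c > 0"
    have "q' (c *\<^sub>R a) / c \<le> q (a + t *\<^sub>R y) - t * q y" if "t \<ge> 0" for t
    proof -
      have "q' (c *\<^sub>R a) \<le> q (c *\<^sub>R (a + t *\<^sub>R y)) - c * t * q y"
        using le[of "c * t" "c *\<^sub>R a"] c that by (simp add: algebra_simps)
      then show ?thesis
        using sublinearD(2)[OF q c, of "a + t *\<^sub>R y"] c by (simp add: field_simps)
    qed
    then have "q' (c *\<^sub>R a) / c \<le> q' a"
      unfolding q'_def by (intro cINF_greatest) auto
    then show "q' (c *\<^sub>R a) \<le> c * q' a" using c by (simp add: field_simps)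
  qed
qed

lemma minimal_sublinear_exists:
  assumes p: "sublinear p"
  shows "\<exists>q. sublinear q \<and> q \<le> p \<and> (\<forall>r. sublinear r \<longrightarrow> r \<le> q \<longrightarrow> r = q)"
proof -
  define A where "A = {q. sublinear q \<and> q \<le> p}"
  have po: "partial_order_on A (relation_of (\<lambda>q r. r \<le> q) A)"
    by (rule partial_order_on_relation_ofI) auto
  have "\<exists>u\<in>A. \<forall>a\<in>C. u \<le> a" if C: "C \<in> Chains (relation_of (\<lambda>q r. r \<le> q) A)" for C
  proof (cases "C = {}")
    case True
    then show ?thesis using p by (auto simp: A_def)
  next
    case False
    have lin: "q \<le> r \<or> r \<le> q" if "q \<in> C" "r \<in> C" for q r
      using C that unfolding Chains_def relation_of_def by auto
    have CA: "C \<subseteq> A" using C unfolding Chains_def relation_of_def by auto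
    have bdd: "bdd_below ((\<lambda>q. q x) ` C)" for x
    proof (rule bdd_belowI2)
      fix q assume "q \<in> C"
      then have "sublinear q" "q (- x) \<le> p (- x)" using CA by (auto simp: A_def le_fun_def)
      then show "- p (- x) \<le> q x" using sublinearD(4)[of q x] by simp
    qed
    define u where "u = (\<lambda>x. INF q\<in>C. q x)"
    have le: "u \<le> q" if "q \<in> C" for q
      unfolding u_def le_fun_def using bdd that by (auto intro: cINF_lower)
    have "sublinear u"
      unfolding u_def
    proof (rule sublinear_INF_chain[OF False _ _ bdd])
      show "\<exists>s\<in>C. s \<le> q \<and> s \<le> r" if "q \<in> C" "r \<in> C" for q r
        using lin[OF that] that by auto
    qed (use CA in \<open>auto simp: A_def\<close>)
    moreover have "u \<le> p"
    proof -
      obtain q where "q \<in> C" using False by blast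
      then show ?thesis using le[of q] CA by (auto simp: A_def)
    qed
    ultimately show ?thesis using le by (auto simp: A_def)
  qed
  from predicate_Zorn[OF po this] obtain q where "q \<in> A" "\<And>r. r \<in> A \<Longrightarrow> r \<le> q \<Longrightarrow> r = q" by blast
  then show ?thesis by (intro exI[of _ q]) (auto simp: A_def)
qed

text \<open>A minimal sublinear functional is additive, since it agrees with its own shifts.\<close>

theorem hahn_banach_sublinear:
  fixes p :: "'a::real_vector \<Rightarrow> real"
  assumes p: "sublinear p"
  obtains f where "linear f" "\<And>x. f x \<le> p x" "f x0 = p x0"
proof -
  \<comment> \<open>One shift along \<open>x0\<close> before minimising forces
    \<open>f (- x0) \<le> - p x0\<close>, and with it the equality at \<open>x0\<close>.\<close>
  define p' where "p' = (\<lambda>x. INF t\<in>{0..}. p (x + t *\<^sub>R x0) - t * p x0)"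
  note s = sublinear_shift[OF p, where y=x0, folded p'_def]
  from minimal_sublinear_exists[OF s(1)] obtain f
    where f: "sublinear f" "f \<le> p'" and min: "\<And>r. sublinear r \<Longrightarrow> r \<le> f \<Longrightarrow> r = f" by blast
  have fp': "f x \<le> p' x" for x using f(2) by (simp add: le_fun_def)
  have fp: "f x \<le> p x" for x using fp'[of x] s(3)[where x=x] by (simp add: p'_def)
  have add: "f (x + y) = f x + f y" for x y
  proof -
    note sh = sublinear_shift[OF f(1), where y=y]
    have "(\<lambda>x. INF t\<in>{0..}. f (x + t *\<^sub>R y) - t * f y) = f"
      using sh(1,3) by (intro min) (auto simp: le_fun_def)
    then have "(INF t\<in>{0..}. f (x + t *\<^sub>R y) - t * f y) = f x" by (rule fun_cong)
    then have "f x \<le> f (x + y) - f y" using sh(2)[where t=1 and x=x] by simp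
    then show ?thesis using sublinearD(1)[OF f(1), of x y] by simp
  qed
  have minus: "f (- x) = - f x" for x
    using add[of x "- x"] sublinearD(3)[OF f(1)] by simp
  have scale: "f (c *\<^sub>R x) = c * f x" for c x
  proof (cases c "0::real" rule: linorder_cases)
    case less
    then show ?thesis using sublinearD(2)[OF f(1), of "- c" x] minus[of "c *\<^sub>R x"] by simp
  next
    case equal
    then show ?thesis using sublinearD(3)[OF f(1)] by simp
  next
    case greater
    then show ?thesis by (rule sublinearD(2)[OF f(1)])
  qed
  have "f (- x0) \<le> - p x0"
  proof -
    have "f (- x0) \<le> p (- x0 + 1 *\<^sub>R x0) - 1 * p x0"
      using fp'[of "- x0"] s(2)[where t=1 and x="- x0"] by (simp add: p'_def)
    then show ?thesis using sublinearD(3)[OF p] by simp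
  qed
  then have "f x0 = p x0" using fp[of x0] minus[of x0] by simp
  moreover have "linear f" using add scale by (intro linearI) auto
  ultimately show ?thesis using that fp by blast
qed

section \<open>Duality between continuous functions and classes of integrable functions\<close>

context haar_group begin

definition spectral_L1 :: "('g \<Rightarrow> complex) set \<Rightarrow> ('g \<Rightarrow> complex) set" where
  "spectral_L1 \<Lambda> = {f. integrable m f \<and> (\<forall>\<gamma>\<in>dual_group - \<Lambda>. fourier_coeff m f \<gamma> = 0)}"

definition annihilator :: "('g \<Rightarrow> complex) set \<Rightarrow> ('g \<Rightarrow> complex) set" where
  "annihilator \<Lambda> = {h. continuous_everywhere h \<and> (\<forall>\<gamma>\<in>\<Lambda>. (LINT x|m. h x * \<gamma> x) = 0)}"

text \<open>Integrating against \<open>\<gamma>\<close> without conjugation is taking the Fourier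
  coefficient at the inverse of \<open>\<gamma>\<close>. This bilinear pairing is where the inverse
  of \<open>\<Lambda>\<close> in the hypothesis comes from.\<close>

lemma annihilator_eq_spectrum:
  assumes "\<Lambda> \<subseteq> dual_group"
  shows "continuous_with_spectrum m (dual_group - inverse_characters \<Lambda>) = annihilator \<Lambda>"
proof -
  have "inverse_characters \<Lambda> \<subseteq> dual_group"
    using assms by (auto simp: inverse_characters_def dual_group_def intro!: continuous_intros)
  then have "dual_group - (dual_group - inverse_characters \<Lambda>) = inverse_characters \<Lambda>" by blast
  then show ?thesis
    by (simp add: continuous_with_spectrum_def annihilator_def continuous_functions_def
        inverse_characters_def fourier_coeff_def)
qed

text \<open>The continuous function \<open>w\<close> below has vanishing Fourier coefficients, and the integral is \<open>w 0\<close>.\<close>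

lemma integral_annihilator:
  assumes \<Lambda>: "\<Lambda> \<subseteq> dual_group" and f: "f \<in> spectral_L1 \<Lambda>" and h: "h \<in> annihilator \<Lambda>"
  shows "(LINT x|m. f x * h x) = 0"
proof -
  have fi: "integrable m f" and f0: "\<And>\<gamma>. \<gamma> \<in> dual_group - \<Lambda> \<Longrightarrow> fourier_coeff m f \<gamma> = 0"
    using f by (auto simp: spectral_L1_def)
  have hc: "continuous_everywhere h" and h0: "\<And>\<gamma>. \<gamma> \<in> \<Lambda> \<Longrightarrow> (LINT x|m. h x * \<gamma> x) = 0"
    using h by (auto simp: annihilator_def)
  have hF: "continuous_everywhere (\<lambda>(t, x). h (t - x))"
    by (rule continuous_compose_diff(2)[OF hc])
  define w where "w x = (LINT t|m. f t * h (t - x))" for x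
  have wc: "continuous_everywhere w"
    unfolding w_def[abs_def] by (rule continuous_integral_slice[OF hF fi])
  have "fourier_coeff m w \<gamma> = 0" if \<gamma>: "\<gamma> \<in> dual_group" for \<gamma>
  proof -
    note D = dual_groupD[OF \<gamma>]
    have F: "continuous_everywhere (\<lambda>(t, x). h (t - x) * cnj (\<gamma> x))"
      unfolding case_prod_unfold
      by (intro continuous_intros continuous_on_compose2[OF hc] continuous_on_compose2[OF D(1)]) auto
    have inner: "(LINT x|m. h (t - x) * cnj (\<gamma> x)) = cnj (\<gamma> t) * (LINT x|m. h x * \<gamma> x)" for t
    proof -
      have c: "continuous_everywhere (\<lambda>x. h x * cnj (\<gamma> (t - x)))"
        by (intro continuous_on_mult continuous_on_cnj hc continuous_compose_diff(3)[OF D(1)])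
      have "(LINT x|m. h (t - x) * cnj (\<gamma> x)) = (LINT x|m. h x * cnj (\<gamma> (t - x)))"
        using integral_reflect[OF c, of t] by simp
      also have "\<dots> = (LINT x|m. cnj (\<gamma> t) * (h x * \<gamma> x))"
        by (simp add: D(5) mult_ac)
      finally show ?thesis by simp
    qed
    have "fourier_coeff m w \<gamma> = (LINT x|m. LINT t|m. f t * (h (t - x) * cnj (\<gamma> x)))"
      unfolding fourier_coeff_def w_def
      by (simp only: mult.assoc[symmetric] Bochner_Integration.integral_mult_left_zero)
    also have "\<dots> = (LINT t|m. f t * (LINT x|m. h (t - x) * cnj (\<gamma> x)))"
      using fubini_continuous[OF F fi] by simp
    also have "\<dots> = (LINT t|m. f t * (cnj (\<gamma> t) * (LINT x|m. h x * \<gamma> x)))"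
      unfolding inner ..
    also have "\<dots> = fourier_coeff m f \<gamma> * (LINT x|m. h x * \<gamma> x)"
      unfolding fourier_coeff_def
      by (simp only: mult.assoc[symmetric] Bochner_Integration.integral_mult_left_zero)
    \<comment> \<open>The coefficient is a product whose first factor vanishes off
      \<open>\<Lambda>\<close> and whose second vanishes on \<open>\<Lambda>\<close>.\<close>
    also have "\<dots> = 0" using f0[of \<gamma>] h0[of \<gamma>] \<gamma> by (cases "\<gamma> \<in> \<Lambda>") auto
    finally show ?thesis .
  qed
  from fourier_uniqueness[OF wc this, of 0] show ?thesis by (simp add: w_def)
qed

section \<open>Urysohn functions and approximate identities\<close>

lemma urysohn:
  fixes S T :: "'g set"
  assumes "closed S" "closed T" "S \<inter> T = {}"
  obtains f :: "'g \<Rightarrow> real" where "continuous_everywhere f" "\<And>x. 0 \<le> f x" "\<And>x. f x \<le> 1"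
    "\<And>x. x \<in> S \<Longrightarrow> f x = 0" "\<And>x. x \<in> T \<Longrightarrow> f x = 1"
proof -
  have "Hausdorff_space (euclidean :: 'g topology)"
    unfolding Hausdorff_space_def disjnt_def by simp (metis hausdorff)
  then have "normal_space (euclidean :: 'g topology)"
    using compact_UNIV by (intro compact_Hausdorff_or_regular_imp_normal_space)
      (simp_all add: compact_space_def)
  from Urysohn_lemma[OF this, of S T 0 1] assms
  obtain f where f: "continuous_map euclidean (top_of_set {0..1::real}) f" "f ` S \<subseteq> {0}" "f ` T \<subseteq> {1}"
    by (auto simp: disjnt_def)
  have "continuous_everywhere f" "0 \<le> f x \<and> f x \<le> 1" for x
    using f(1) by (auto simp: continuous_map_in_subtopology image_subset_iff)
  then show ?thesis using f(2,3) by (intro that[of f]) auto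
qed

lemma uniformly_continuous_translate:
  assumes "continuous_everywhere (v :: 'g \<Rightarrow> complex)" "e > 0"
  obtains W where "open W" "0 \<in> W" "\<And>a x. a \<in> W \<Longrightarrow> cmod (v (x + a) - v x) \<le> e"
proof -
  have "continuous_everywhere (\<lambda>(a, x). v (x + a))"
    unfolding case_prod_unfold by (intro continuous_on_compose2[OF assms(1)] continuous_intros) auto
  from slice_nbhd[OF this assms(2), of 0] obtain W where "open W" "0 \<in> W"
    "\<And>a x. a \<in> W \<Longrightarrow> dist (v (x + a)) (v (x + 0)) \<le> e" by blast
  then show ?thesis by (intro that[of W]) (auto simp: dist_norm)
qed

text \<open>A Urysohn function times its reflection is symmetric. Squaring makes the normalising
  constant a \<open>sqnorm\<close>, which is known to be positive.\<close>

lemma symmetric_kernel: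
  assumes "open W" "0 \<in> W"
  obtains k :: "'g \<Rightarrow> real" where "continuous_everywhere k" "\<And>x. 0 \<le> k x" "\<And>x. k (- x) = k x"
    "\<And>x. x \<notin> W \<Longrightarrow> k x = 0" "(LINT x|m. k x) = 1"
proof -
  obtain f :: "'g \<Rightarrow> real" where f: "continuous_everywhere f" "\<And>x. 0 \<le> f x" "\<And>x. f x \<le> 1"
    "\<And>x. x \<in> - W \<Longrightarrow> f x = 0" "\<And>x. x \<in> {0} \<Longrightarrow> f x = 1"
    using urysohn[of "- W" "{0}"] assms by (auto simp: closed_Compl)
  define g where "g x = complex_of_real (f x * f (- x))" for x
  have gc: "continuous_everywhere g"
    unfolding g_def[abs_def]
    by (intro continuous_on_of_real continuous_on_mult f continuous_compose_diff(5))
  define c where "c = sqnorm g"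
  have "g 0 \<noteq> 0" using f(5)[of 0] by (simp add: g_def)
  then have c: "c > 0" unfolding c_def by (rule sqnorm_pos[OF gc])
  show ?thesis
  proof (rule that[of "\<lambda>x. (cmod (g x))\<^sup>2 / c"])
    show "continuous_everywhere (\<lambda>x. (cmod (g x))\<^sup>2 / c)"
      using c by (intro continuous_on_divide continuous_sq gc continuous_on_const) auto
    show "(LINT x|m. (cmod (g x))\<^sup>2 / c) = 1"
      using c by (simp add: c_def sqnorm_def)
    show "(cmod (g x))\<^sup>2 / c = 0" if "x \<notin> W" for x using f(4)[of x] that by (simp add: g_def)
  qed (use c in \<open>auto simp: g_def mult.commute\<close>)
qed

section \<open>The norm of the quotient by functions with spectrum in \<open>\<Lambda>\<close>,
  computed on representatives\<close>

definition dist_L1 :: "('g \<Rightarrow> complex) set \<Rightarrow> ('g \<Rightarrow> complex) \<Rightarrow> real" where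
  "dist_L1 \<Lambda> f = (INF g\<in>spectral_L1 \<Lambda>. LINT x|m. cmod (f x + g x))"

lemma zero_spectral: "(\<lambda>_. 0) \<in> spectral_L1 \<Lambda>"
  by (simp add: spectral_L1_def fourier_coeff_def)

lemma character_mult_integrable:
  assumes "integrable m f" "\<gamma> \<in> dual_group"
  shows "integrable m (\<lambda>x. f x * cnj (\<gamma> x))"
  using assms dual_groupD(1) by (intro integrable_mult_continuous continuous_on_cnj)

lemma add_spectral: "f \<in> spectral_L1 \<Lambda> \<Longrightarrow> g \<in> spectral_L1 \<Lambda> \<Longrightarrow> (\<lambda>x. f x + g x) \<in> spectral_L1 \<Lambda>"
  by (auto simp: spectral_L1_def fourier_coeff_def distrib_right character_mult_integrable)

lemma scale_spectral: "f \<in> spectral_L1 \<Lambda> \<Longrightarrow> (\<lambda>x. c * f x) \<in> spectral_L1 \<Lambda>"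
  by (auto simp: spectral_L1_def fourier_coeff_def mult.assoc)

lemma dist_L1_le: "g \<in> spectral_L1 \<Lambda> \<Longrightarrow> dist_L1 \<Lambda> f \<le> (LINT x|m. cmod (f x + g x))"
  unfolding dist_L1_def by (intro cINF_lower bdd_belowI2[where m=0]) auto

lemma dist_L1_nonneg: "0 \<le> dist_L1 \<Lambda> f"
  unfolding dist_L1_def using zero_spectral by (intro cINF_greatest) auto

lemma dist_L1_le_norm: "dist_L1 \<Lambda> f \<le> (LINT x|m. cmod (f x))"
  using dist_L1_le[OF zero_spectral, of \<Lambda> f] by simp

lemma dist_L1_approx:
  assumes "e > 0"
  obtains g where "g \<in> spectral_L1 \<Lambda>" "(LINT x|m. cmod (f x + g x)) < dist_L1 \<Lambda> f + e"
proof -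
  have "Inf ((\<lambda>g. LINT x|m. cmod (f x + g x)) ` spectral_L1 \<Lambda>) < dist_L1 \<Lambda> f + e"
    using assms by (simp add: dist_L1_def)
  then show ?thesis
    using that cInf_lessD[of "(\<lambda>g. LINT x|m. cmod (f x + g x)) ` spectral_L1 \<Lambda>"] zero_spectral by blast
qed

lemma spectral_integrable: "g \<in> spectral_L1 \<Lambda> \<Longrightarrow> integrable m g"
  by (simp add: spectral_L1_def)

lemma L1_triangle:
  assumes "integrable m f" "integrable m (g :: 'g \<Rightarrow> complex)"
  shows "(LINT x|m. cmod (f x + g x)) \<le> (LINT x|m. cmod (f x)) + (LINT x|m. cmod (g x))"
proof -
  have "(LINT x|m. cmod (f x + g x)) \<le> (LINT x|m. cmod (f x) + cmod (g x))"
    using assms by (intro integral_mono) (auto intro: norm_triangle_ineq)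
  then show ?thesis using assms by simp
qed

lemma dist_L1_triangle:
  assumes "integrable m f" "integrable m g"
  shows "dist_L1 \<Lambda> (\<lambda>x. f x + g x) \<le> dist_L1 \<Lambda> f + dist_L1 \<Lambda> g"
proof (rule field_le_epsilon)
  fix e :: real assume "e > 0"
  then have e: "e / 2 > 0" by simp
  obtain a where a: "a \<in> spectral_L1 \<Lambda>" "(LINT x|m. cmod (f x + a x)) < dist_L1 \<Lambda> f + e / 2"
    using dist_L1_approx[OF e] by metis
  obtain b where b: "b \<in> spectral_L1 \<Lambda>" "(LINT x|m. cmod (g x + b x)) < dist_L1 \<Lambda> g + e / 2"
    using dist_L1_approx[OF e] by metis
  have "dist_L1 \<Lambda> (\<lambda>x. f x + g x) \<le> (LINT x|m. cmod (f x + g x + (a x + b x)))"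
    by (rule dist_L1_le[OF add_spectral[OF a(1) b(1)]])
  also have "\<dots> = (LINT x|m. cmod ((f x + a x) + (g x + b x)))" by (simp add: algebra_simps)
  also have "\<dots> \<le> (LINT x|m. cmod (f x + a x)) + (LINT x|m. cmod (g x + b x))"
    using assms a b by (intro L1_triangle) (auto dest: spectral_integrable)
  finally show "dist_L1 \<Lambda> (\<lambda>x. f x + g x) \<le> dist_L1 \<Lambda> f + dist_L1 \<Lambda> g + e" using a b by simp
qed

lemma dist_L1_scale_le: "dist_L1 \<Lambda> (\<lambda>x. c * f x) \<le> cmod c * dist_L1 \<Lambda> f"
proof (rule field_le_epsilon)
  fix e :: real assume "e > 0"
  then have e: "e / (cmod c + 1) > 0" by (simp add: add_nonneg_pos)
  obtain a where a: "a \<in> spectral_L1 \<Lambda>" "(LINT x|m. cmod (f x + a x)) < dist_L1 \<Lambda> f + e / (cmod c + 1)"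
    using dist_L1_approx[OF e] by metis
  have "dist_L1 \<Lambda> (\<lambda>x. c * f x) \<le> (LINT x|m. cmod (c * f x + c * a x))"
    by (rule dist_L1_le[OF scale_spectral[OF a(1)]])
  also have "\<dots> = cmod c * (LINT x|m. cmod (f x + a x))"
    by (simp add: distrib_left[symmetric] norm_mult)
  also have "\<dots> \<le> cmod c * (dist_L1 \<Lambda> f + e / (cmod c + 1))"
    using a by (intro mult_left_mono) auto
  also have "\<dots> \<le> cmod c * dist_L1 \<Lambda> f + e"
  proof -
    define K where "K = cmod c"
    have "0 \<le> K" by (simp add: K_def)
    then have "K * (e / (K + 1)) \<le> e" using \<open>e > 0\<close> by (simp add: field_simps)
    then show ?thesis by (simp add: distrib_left K_def)
  qed
  finally show "dist_L1 \<Lambda> (\<lambda>x. c * f x) \<le> cmod c * dist_L1 \<Lambda> f + e" .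
qed

lemma dist_L1_unimodular:
  assumes "cmod c = 1"
  shows "dist_L1 \<Lambda> (\<lambda>x. c * f x) = dist_L1 \<Lambda> f"
proof (rule antisym)
  show "dist_L1 \<Lambda> (\<lambda>x. c * f x) \<le> dist_L1 \<Lambda> f"
    using dist_L1_scale_le[of \<Lambda> c f] assms by simp
  have "cnj c * c = 1" using complex_norm_square[of c] assms by (simp add: mult.commute)
  then show "dist_L1 \<Lambda> f \<le> dist_L1 \<Lambda> (\<lambda>x. c * f x)"
    using dist_L1_scale_le[of \<Lambda> "cnj c" "\<lambda>x. c * f x"] assms by (simp add: mult.assoc[symmetric])
qed

lemma dist_L1_spectral:
  assumes "f \<in> spectral_L1 \<Lambda>"
  shows "dist_L1 \<Lambda> f = 0"
  using dist_L1_le[OF scale_spectral[OF assms, of "-1"], of f] dist_L1_nonneg[of \<Lambda> f] by simp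

text \<open>The easy half of the duality: since \<open>h\<close> kills
  \<open>spectral_L1 \<Lambda>\<close>, the function \<open>f\<close> may be altered by any element
  of it before the trivial estimate is applied.\<close>

lemma integral_annihilator_bound:
  assumes \<Lambda>: "\<Lambda> \<subseteq> dual_group" and f: "integrable m f" and h: "h \<in> annihilator \<Lambda>"
    and B: "\<And>x. cmod (h x) \<le> B"
  shows "cmod (LINT x|m. f x * h x) \<le> B * dist_L1 \<Lambda> f"
proof -
  have hc: "continuous_everywhere h" using h by (simp add: annihilator_def)
  have B0: "B \<ge> 0" using B[of 0] norm_ge_zero order_trans by blast
  have *: "cmod (LINT x|m. f x * h x) \<le> B * (LINT x|m. cmod (f x + g x))" if g: "g \<in> spectral_L1 \<Lambda>" for g
  proof -
    have gi: "integrable m g" using g by (rule spectral_integrable)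
    have "(LINT x|m. f x * h x) = (LINT x|m. (f x + g x) * h x)"
      using integral_annihilator[OF \<Lambda> g h] integrable_mult_continuous[OF f hc]
        integrable_mult_continuous[OF gi hc] by (simp add: distrib_right)
    also have "cmod \<dots> \<le> B * (LINT x|m. cmod (f x + g x))"
      using f gi hc B continuous_imp_measurable by (intro integral_cmod_bound) auto
    finally show ?thesis .
  qed
  show ?thesis
  proof (cases "B = 0")
    case True
    then show ?thesis using *[OF zero_spectral] by simp
  next
    case False
    then have "B > 0" using B0 by simp
    have "cmod (LINT x|m. f x * h x) / B \<le> dist_L1 \<Lambda> f"
      unfolding dist_L1_def using zero_spectral * \<open>B > 0\<close>
      by (intro cINF_greatest) (auto simp: field_simps)
    then show ?thesis using \<open>B > 0\<close> by (simp add: field_simps)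
  qed
qed

lemma character_spectral:
  assumes "\<Lambda> \<subseteq> dual_group" "\<gamma> \<in> \<Lambda>"
  shows "\<gamma> \<in> spectral_L1 \<Lambda>"
  using assms fourier_coeff_orthogonal[of \<gamma>] dual_groupD(1)[of \<gamma>]
  by (auto simp: spectral_L1_def intro!: integrable_continuous)

section \<open>Density of the continuous functions in L1\<close>

lemma inner_regular:
  assumes A: "A \<in> sets borel" and d: "d > 0"
  obtains K where "compact K" "K \<subseteq> A" "measure m A < measure m K + d"
proof -
  have "\<exists>K. compact K \<and> K \<subseteq> A \<and> measure m A < measure m K + d"
  proof (rule ccontr)
    assume no: "\<not> ?thesis"
    then have le: "measure m K \<le> measure m A - d" if "compact K" "K \<subseteq> A" for K
      using that by (auto simp: not_less)
    have "measure m A - d \<ge> 0" using le[of "{}"] by simp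
    have "emeasure m A = (SUP K\<in>{K. compact K \<and> K \<subseteq> A}. emeasure m K)"
      using haar A by (simp add: normalized_haar_measure_def)
    also have "\<dots> \<le> ennreal (measure m A - d)"
      using le by (intro SUP_least) (simp add: emeasure_eq_measure ennreal_leI)
    finally have "measure m A \<le> measure m A - d"
      using \<open>measure m A - d \<ge> 0\<close> by (simp add: emeasure_eq_measure)
    then show False using d by simp
  qed
  then show ?thesis using that by blast
qed

text \<open>Inner regularity is applied to \<open>A\<close> and to its complement, the latter
  standing for outer regularity of \<open>A\<close>. A Urysohn function separating the two compact
  sets differs from the indicator only on the leftovers.\<close>

lemma indicator_approx_continuous:
  assumes A: "A \<in> sets borel" and d: "d > 0"
  obtains f :: "'g \<Rightarrow> real" where "continuous_everywhere f" "(LINT x|m. \<bar>indicator A x - f x\<bar>) < d"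
proof -
  have d2: "d / 2 > 0" using d by simp
  obtain K where K: "compact K" "K \<subseteq> A" "measure m A < measure m K + d / 2"
    using inner_regular[OF A d2] by metis
  obtain L where L: "compact L" "L \<subseteq> - A" "measure m (- A) < measure m L + d / 2"
    using inner_regular[OF borel_comp[OF A] d2] by metis
  have cl: "closed K" "closed L" using K L by (auto intro: compact_imp_closed)
  obtain f :: "'g \<Rightarrow> real" where f: "continuous_everywhere f" "\<And>x. 0 \<le> f x" "\<And>x. f x \<le> 1"
    "\<And>x. x \<in> L \<Longrightarrow> f x = 0" "\<And>x. x \<in> K \<Longrightarrow> f x = 1"
    using urysohn[OF cl(2,1)] K L by blast
  have s: "K \<in> sets m" "L \<in> sets m" "A \<in> sets m" "- A \<in> sets m"
    using cl A borel_comp[OF A] by auto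
  have s': "A - K \<in> sets m" "- A - L \<in> sets m"
    using s by (blast intro: sets.Diff)+
  have bound: "\<bar>indicator A x - f x\<bar> \<le> indicator (A - K) x + indicator (- A - L) x" for x
    using f(2)[of x] f(3)[of x] f(4)[of x] f(5)[of x] by (auto simp: indicator_def)
  have "(LINT x|m. \<bar>indicator A x - f x\<bar>) \<le> (LINT x|m. indicator (A - K) x + indicator (- A - L) x)"
  proof (rule integral_mono[OF _ _ bound])
    show "integrable m (\<lambda>x. \<bar>indicator A x - f x\<bar>)"
      using s f(1) by (intro integrable_abs Bochner_Integration.integrable_diff integrable_real_indicator
          integrable_continuous) (auto simp: emeasure_eq_measure)
    show "integrable m (\<lambda>x. indicator (A - K) x + indicator (- A - L) x :: real)"
      using s' by (intro Bochner_Integration.integrable_add integrable_real_indicator) (auto simp: emeasure_eq_measure)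
  qed
  also have "\<dots> = measure m (A - K) + measure m (- A - L)"
    using s' by (subst Bochner_Integration.integral_add) (auto simp: emeasure_eq_measure intro!: integrable_real_indicator)
  also have "\<dots> = (measure m A - measure m K) + (measure m (- A) - measure m L)"
    using s K L by (simp add: finite_measure_Diff)
  also have "\<dots> < d" using K L by simp
  finally show ?thesis using that f(1) by blast
qed

lemma continuous_dense_L1:
  fixes u :: "'g \<Rightarrow> complex"
  assumes "integrable m u" "e > 0"
  shows "\<exists>v. continuous_everywhere v \<and> (LINT x|m. cmod (u x - v x)) < e"
  using assms
proof (induction u arbitrary: e rule: integrable_induct)
  case (base A c)
  have A: "A \<in> sets borel" using base by simp
  have "e / (cmod c + 1) > 0" using base by (simp add: add_nonneg_pos)
  from indicator_approx_continuous[OF A this]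
  obtain f :: "'g \<Rightarrow> real" where f: "continuous_everywhere f"
    "(LINT x|m. \<bar>indicator A x - f x\<bar>) < e / (cmod c + 1)" by blast
  define I where "I = (LINT x|m. \<bar>indicator A x - f x\<bar>)"
  have "cmod (indicator A x *\<^sub>R c - f x *\<^sub>R c) = cmod c * \<bar>indicator A x - f x\<bar>" for x
    by (simp add: scaleR_diff_left[symmetric] mult.commute)
  then have "(LINT x|m. cmod (indicator A x *\<^sub>R c - f x *\<^sub>R c)) = cmod c * I"
    by (simp add: I_def)
  also have "\<dots> \<le> (cmod c + 1) * I" by (simp add: I_def mult_right_mono)
  also have "\<dots> < e"
  proof -
    have "cmod c + 1 > 0" by (simp add: add_nonneg_pos)
    then show ?thesis using f(2) unfolding I_def by (simp add: pos_less_divide_eq mult.commute)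
  qed
  finally show ?case
    using f(1) by (intro exI[of _ "\<lambda>x. f x *\<^sub>R c"]) (auto intro!: continuous_intros)
next
  case (add f g)
  from add.IH(1)[of "e / 2"] add.prems obtain v where v: "continuous_everywhere v" "(LINT x|m. cmod (f x - v x)) < e / 2" by auto
  from add.IH(2)[of "e / 2"] add.prems obtain w where w: "continuous_everywhere w" "(LINT x|m. cmod (g x - w x)) < e / 2" by auto
  have "(LINT x|m. cmod (f x + g x - (v x + w x))) = (LINT x|m. cmod ((f x - v x) + (g x - w x)))"
    by (simp add: algebra_simps)
  also have "\<dots> \<le> (LINT x|m. cmod (f x - v x)) + (LINT x|m. cmod (g x - w x))"
    using add v w by (intro L1_triangle) (auto intro: integrable_continuous)
  finally show ?case
    using v w by (intro exI[of _ "\<lambda>x. v x + w x"]) (auto intro!: continuous_intros)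
next
  case (lim f s)
  have meas: "(\<lambda>x. cmod (f x - s i x)) \<in> borel_measurable m" for i
    using lim.hyps(1)[of i] \<open>integrable m f\<close> by measurable
  have "(\<lambda>i. LINT x|m. cmod (f x - s i x)) \<longlonglongrightarrow> (LINT x|m. (0::real))"
  proof (rule integral_dominated_convergence[where w="\<lambda>x. 3 * cmod (f x)"])
    show "AE x in m. (\<lambda>i. cmod (f x - s i x)) \<longlonglongrightarrow> 0"
    proof (rule AE_I2)
      fix x assume "x \<in> space m"
      then have "(\<lambda>i. s i x) \<longlonglongrightarrow> f x" by (rule lim.hyps)
      then have "(\<lambda>i. cmod (f x - s i x)) \<longlonglongrightarrow> cmod (f x - f x)"
        by (intro tendsto_norm tendsto_diff tendsto_const)
      then show "(\<lambda>i. cmod (f x - s i x)) \<longlonglongrightarrow> 0" by simp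
    qed
    show "AE x in m. norm (cmod (f x - s i x)) \<le> 3 * cmod (f x)" for i
    proof (rule AE_I2)
      fix x assume "x \<in> space m"
      then have "cmod (s i x) \<le> 2 * cmod (f x)" using lim.hyps(3) by blast
      then show "norm (cmod (f x - s i x)) \<le> 3 * cmod (f x)"
        using norm_triangle_ineq4[of "f x" "s i x"] by simp
    qed
  qed (use meas \<open>integrable m f\<close> in auto)
  then have "\<forall>\<^sub>F i in sequentially. (LINT x|m. cmod (f x - s i x)) < e / 2"
    using lim.prems by (intro order_tendstoD) auto
  then obtain i where i: "(LINT x|m. cmod (f x - s i x)) < e / 2"
    by (auto simp: eventually_sequentially)
  from lim.IH[of "e / 2" i] lim.prems obtain v where v: "continuous_everywhere v" "(LINT x|m. cmod (s i x - v x)) < e / 2" by auto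
  have "(LINT x|m. cmod (f x - v x)) = (LINT x|m. cmod ((f x - s i x) + (s i x - v x)))" by simp
  also have "\<dots> \<le> (LINT x|m. cmod (f x - s i x)) + (LINT x|m. cmod (s i x - v x))"
    using lim.hyps(1) \<open>integrable m f\<close> v by (intro L1_triangle) (auto intro: integrable_continuous)
  finally show ?case using v i by (intro exI[of _ v]) auto
qed

section \<open>Norming the distance by functions in the annihilator\<close>

lemma mem_bcontfun: "continuous_everywhere (f :: 'g \<Rightarrow> complex) \<Longrightarrow> f \<in> bcontfun"
  unfolding bcontfun_def
  using compact_imp_bounded[OF compact_continuous_image[OF _ compact_UNIV]] by auto

lemma apply_Bcontfun: "continuous_everywhere (f :: 'g \<Rightarrow> complex) \<Longrightarrow> apply_bcontfun (Bcontfun f) = f"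
  by (rule Bcontfun_inverse[OF mem_bcontfun])

lemma sublinear_dist_L1: "sublinear (\<lambda>b :: 'g \<Rightarrow>\<^sub>C complex. dist_L1 \<Lambda> (apply_bcontfun b))"
  unfolding sublinear_def
proof (intro conjI allI impI)
  fix x y :: "'g \<Rightarrow>\<^sub>C complex"
  have "integrable m (apply_bcontfun b)" for b :: "'g \<Rightarrow>\<^sub>C complex"
    by (intro integrable_continuous) (auto intro: continuous_on_apply_bcontfun)
  then show "dist_L1 \<Lambda> (apply_bcontfun (x + y)) \<le> dist_L1 \<Lambda> (apply_bcontfun x) + dist_L1 \<Lambda> (apply_bcontfun y)"
    using dist_L1_triangle by (simp add: plus_bcontfun.rep_eq)
next
  fix c :: real and x :: "'g \<Rightarrow>\<^sub>C complex" assume "c > 0"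
  then show "dist_L1 \<Lambda> (apply_bcontfun (c *\<^sub>R x)) \<le> c * dist_L1 \<Lambda> (apply_bcontfun x)"
    using dist_L1_scale_le[of \<Lambda> "complex_of_real c" "apply_bcontfun x"]
    by (simp add: scaleR_bcontfun.rep_eq scaleR_conv_of_real)
qed

text \<open>The real functional from Hahn-Banach is made complex by
  \<open>\<phi> f - \<i> * \<phi> (\<i> * f)\<close>, and rotating \<open>\<psi> w\<close> onto the
  positive axis turns the bound on real parts into one on moduli. Domination by
  \<open>dist_L1\<close> makes \<open>\<psi>\<close> vanish on continuous functions with spectrum in
  \<open>\<Lambda>\<close>.\<close>

lemma dual_functional:
  assumes v: "continuous_everywhere v"
  obtains \<psi> where "sup_bounded_functional \<psi> 1" "Re (\<psi> v) = dist_L1 \<Lambda> v"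
    "\<And>w. continuous_everywhere w \<Longrightarrow> cmod (\<psi> w) \<le> dist_L1 \<Lambda> w"
proof -
  define B :: "('g \<Rightarrow> complex) \<Rightarrow> 'g \<Rightarrow>\<^sub>C complex" where "B = Bcontfun"
  have apB: "apply_bcontfun (B f) = f" if "continuous_everywhere f" for f
    unfolding B_def using that by (rule apply_Bcontfun)
  obtain \<phi> where lin: "linear \<phi>" and le: "\<And>b. \<phi> b \<le> dist_L1 \<Lambda> (apply_bcontfun b)"
    and v0: "\<phi> (B v) = dist_L1 \<Lambda> (apply_bcontfun (B v))"
    using hahn_banach_sublinear[OF sublinear_dist_L1, of \<Lambda> "B v"] by blast
  have B_comb: "B (\<lambda>x. complex_of_real a * f x + complex_of_real b * g x) = a *\<^sub>R B f + b *\<^sub>R B g"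
    if "continuous_everywhere f" "continuous_everywhere g" for f g a b
    using that by (intro bcontfun_eqI)
      (simp add: plus_bcontfun.rep_eq scaleR_bcontfun.rep_eq apB continuous_intros scaleR_conv_of_real)
  define \<psi> where "\<psi> f = complex_of_real (\<phi> (B f)) - \<i> * complex_of_real (\<phi> (B (\<lambda>x. \<i> * f x)))" for f
  have comb: "\<phi> (B (\<lambda>x. complex_of_real a * f x + complex_of_real b * g x)) = a * \<phi> (B f) + b * \<phi> (B g)"
    if "continuous_everywhere f" "continuous_everywhere g" for f g a b
    unfolding B_comb[OF that] by (simp add: linear_add[OF lin] linear_scale[OF lin])
  have add: "\<psi> (\<lambda>x. f x + g x) = \<psi> f + \<psi> g" if fg: "continuous_everywhere f" "continuous_everywhere g" for f g
  proof -
    have "continuous_everywhere (\<lambda>x. \<i> * f x)" "continuous_everywhere (\<lambda>x. \<i> * g x)"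
      using fg by (auto intro!: continuous_intros)
    from comb[OF this, of 1 1] comb[OF fg, of 1 1] show ?thesis
      by (simp add: \<psi>_def algebra_simps)
  qed
  have scale: "\<psi> (\<lambda>x. c * f x) = c * \<psi> f" if f: "continuous_everywhere f" for c f
  proof -
    have fi: "continuous_everywhere (\<lambda>x. \<i> * f x)" using f by (intro continuous_intros)
    have "c * f x = complex_of_real (Re c) * f x + complex_of_real (Im c) * (\<i> * f x)"
      "\<i> * (c * f x) = complex_of_real (- Im c) * f x + complex_of_real (Re c) * (\<i> * f x)" for x
      by (simp_all add: complex_eq_iff)
    then have "\<psi> (\<lambda>x. c * f x) = complex_of_real (Re c * \<phi> (B f) + Im c * \<phi> (B (\<lambda>x. \<i> * f x)))
      - \<i> * complex_of_real (- Im c * \<phi> (B f) + Re c * \<phi> (B (\<lambda>x. \<i> * f x)))"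
      unfolding \<psi>_def by (simp only: comb[OF f fi])
    then show ?thesis by (simp add: \<psi>_def complex_eq_iff algebra_simps)
  qed
  have Re\<psi>: "Re (\<psi> f) = \<phi> (B f)" for f by (simp add: \<psi>_def)
  have bound: "cmod (\<psi> w) \<le> dist_L1 \<Lambda> w" if w: "continuous_everywhere w" for w
  proof (cases "\<psi> w = 0")
    case False
    define u where "u = cnj (\<psi> w) / complex_of_real (cmod (\<psi> w))"
    have u: "cmod u = 1" using False by (simp add: u_def norm_divide)
    have uw: "continuous_everywhere (\<lambda>x. u * w x)" using w by (intro continuous_intros)
    have "u * \<psi> w = complex_of_real (cmod (\<psi> w))"
      using False complex_norm_square[of "\<psi> w"]
      by (simp add: u_def field_simps power2_eq_square)
    then have "cmod (\<psi> w) = Re (\<psi> (\<lambda>x. u * w x))" using scale[OF w, of u] by simp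
    also have "\<dots> \<le> dist_L1 \<Lambda> (\<lambda>x. u * w x)" using le[of "B (\<lambda>x. u * w x)"] apB[OF uw] by (simp add: Re\<psi>)
    also have "\<dots> = dist_L1 \<Lambda> w" by (rule dist_L1_unimodular[OF u])
    finally show ?thesis .
  qed (simp add: dist_L1_nonneg)
  have "cmod (\<psi> w) \<le> 1 * b" if w: "continuous_everywhere w" and b: "\<And>x. cmod (w x) \<le> b" for w b
  proof -
    have "(LINT x|m. cmod (w x)) \<le> (LINT x|m. b)"
      using b w by (intro integral_mono integrable_continuous continuous_intros)
    then show ?thesis using bound[OF w] dist_L1_le_norm[of \<Lambda> w] by simp
  qed
  then have "sup_bounded_functional \<psi> 1"
    unfolding sup_bounded_functional_def using add scale by auto
  moreover have "Re (\<psi> v) = dist_L1 \<Lambda> v" using v0 by (simp add: Re\<psi> apB[OF v])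
  ultimately show ?thesis using that bound by blast
qed

text \<open>A functional on \<open>L\<^sup>1\<close> applied to the translates of an approximate identity is a continuous
  function, which replaces the representation of the functional by a bounded function.\<close>

lemma dist_L1_attained_by_annihilator:
  assumes \<Lambda>: "\<Lambda> \<subseteq> dual_group" and v: "continuous_everywhere v" and e: "e > 0"
  obtains h where "h \<in> annihilator \<Lambda>" "\<And>x. cmod (h x) \<le> 1"
    "Re (LINT x|m. v x * h x) \<ge> dist_L1 \<Lambda> v - e"
proof -
  obtain \<psi> where \<psi>: "sup_bounded_functional \<psi> 1" "Re (\<psi> v) = dist_L1 \<Lambda> v"
    "\<And>w. continuous_everywhere w \<Longrightarrow> cmod (\<psi> w) \<le> dist_L1 \<Lambda> w"
    using dual_functional[OF v] by metis
  obtain W where W: "open W" "0 \<in> W" "\<And>a x. a \<in> W \<Longrightarrow> cmod (v (x + a) - v x) \<le> e"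
    using uniformly_continuous_translate[OF v e] by metis
  obtain k :: "'g \<Rightarrow> real" where k: "continuous_everywhere k" "\<And>x. 0 \<le> k x" "\<And>x. k (- x) = k x"
    "\<And>x. x \<notin> W \<Longrightarrow> k x = 0" "(LINT x|m. k x) = 1"
    using symmetric_kernel[OF W(1,2)] by metis
  define K where "K x = complex_of_real (k x)" for x
  have Kc: "continuous_everywhere K" unfolding K_def[abs_def] by (intro continuous_intros k)
  have K1: "(LINT x|m. K x) = 1" unfolding K_def using k(5) by simp
  have Kabs: "cmod (K x) = k x" for x using k(2) by (simp add: K_def)
  have F: "continuous_everywhere (\<lambda>(t, s). K (t - s))" by (rule continuous_compose_diff(2)[OF Kc])
  \<comment> \<open>\<open>\<psi>\<close> is applied to the bump \<open>K\<close> centred at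
    \<open>t\<close>. Were \<open>\<psi>\<close> integration against a bounded function,
    \<open>h\<close> would be the convolution of that function with \<open>K\<close>.\<close>
  define h where "h t = \<psi> (\<lambda>s. K (t - s))" for t
  have hc: "continuous_everywhere h"
    unfolding h_def by (rule continuous_functional_slice[OF \<psi>(1) F])
  have exch: "(LINT t|m. u t * h t) = \<psi> (\<lambda>s. LINT t|m. u t * K (t - s))" if "integrable m u" for u
    unfolding h_def using functional_integral_exchange[OF \<psi>(1) F that] .
  have "cmod (h t) \<le> 1" for t
  proof -
    have c: "continuous_everywhere (\<lambda>s. K (t - s))" by (rule continuous_compose_diff(3)[OF Kc])
    have "cmod (h t) \<le> (LINT s|m. cmod (K (t - s)))"
      unfolding h_def using \<psi>(3)[OF c] dist_L1_le_norm[of \<Lambda> "\<lambda>s. K (t - s)"] by linarith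
    also have "(LINT s|m. cmod (K (t - s))) = 1"
    proof -
      have "complex_of_real (LINT s|m. cmod (K (t - s))) = (LINT s|m. K (t - s))"
        unfolding Kabs by (simp add: K_def)
      also have "\<dots> = complex_of_real 1" using integral_reflect[OF Kc, of t] K1 by simp
      finally show ?thesis unfolding of_real_eq_iff .
    qed
    finally show ?thesis .
  qed
  moreover have "h \<in> annihilator \<Lambda>"
    unfolding annihilator_def
  proof (intro CollectI conjI ballI hc)
    fix \<gamma> assume \<gamma>: "\<gamma> \<in> \<Lambda>"
    then have \<gamma>d: "\<gamma> \<in> dual_group" using \<Lambda> by blast
    note D = dual_groupD[OF \<gamma>d]
    define c where "c = (LINT t|m. \<gamma> t * K t)"
    \<comment> \<open>Characters are eigenfunctions of smoothing by \<open>K\<close>, so the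
      integral of \<open>\<gamma>\<close> against \<open>h\<close> is a multiple of
      \<open>\<psi> \<gamma>\<close>, which is 0.\<close>
    have "(LINT t|m. \<gamma> t * K (t - s)) = c * \<gamma> s" for s
    proof -
      have cc: "continuous_everywhere (\<lambda>t. \<gamma> (t + s) * K t)"
        using continuous_compose_diff(6)[OF D(1), of s] by (simp add: add.commute continuous_on_mult Kc)
      have "(LINT t|m. \<gamma> t * K (t - s)) = (LINT t|m. \<gamma> (t + s) * K t)"
        using integral_translate_diff[OF cc, of s] by simp
      also have "\<dots> = (LINT t|m. \<gamma> s * (\<gamma> t * K t))" by (simp add: D(3) mult_ac)
      finally show ?thesis by (simp add: c_def)
    qed
    then have "(LINT t|m. \<gamma> t * h t) = c * \<psi> \<gamma>"
      using exch[OF integrable_continuous[OF D(1)]] sup_bounded_functionalD(3)[OF \<psi>(1) D(1)] by simp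
    moreover have "\<psi> \<gamma> = 0"
      using \<psi>(3)[OF D(1)] dist_L1_spectral[OF character_spectral[OF \<Lambda> \<gamma>]] by simp
    ultimately show "(LINT x|m. h x * \<gamma> x) = 0" by (simp add: mult.commute)
  qed
  moreover have "Re (LINT x|m. v x * h x) \<ge> dist_L1 \<Lambda> v - e"
  proof -
    have cv: "continuous_everywhere (\<lambda>s. LINT t|m. v t * K (t - s))"
      by (rule continuous_integral_slice[OF F integrable_continuous[OF v]])
    \<comment> \<open>\<open>K\<close> has mass 1 and vanishes off \<open>W\<close>, so smoothing
      replaces \<open>v s\<close> by an average of values within \<open>e\<close> of it.\<close>
    have near: "cmod (v s - (LINT t|m. v t * K (t - s))) \<le> e" for s
    proof -
      have c: "continuous_everywhere (\<lambda>t. K (t - s))" by (rule continuous_compose_diff(4)[OF Kc])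
      have ci: "integrable m (\<lambda>t. K (t - s))" by (rule integrable_continuous[OF c])
      have c1: "(LINT t|m. K (t - s)) = 1" using integral_translate_diff[OF Kc, of s] K1 by simp
      have vc: "integrable m (\<lambda>t. v t * K (t - s))"
        using v c by (intro integrable_continuous continuous_on_mult)
      have "v s - (LINT t|m. v t * K (t - s)) = (LINT t|m. v s * K (t - s) - v t * K (t - s))"
        using vc ci c1 by (subst Bochner_Integration.integral_diff) auto
      also have "cmod \<dots> \<le> (LINT t|m. cmod (v s * K (t - s) - v t * K (t - s)))"
        by (rule integral_norm_bound)
      also have "\<dots> \<le> (LINT t|m. e * k (t - s))"
      proof (rule integral_mono)
        show "integrable m (\<lambda>t. cmod (v s * K (t - s) - v t * K (t - s)))"
          using vc ci by (intro integrable_norm Bochner_Integration.integrable_diff) auto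
        show "integrable m (\<lambda>t. e * k (t - s))"
          by (intro integrable_continuous continuous_on_mult_left continuous_compose_diff(4) k)
        show "cmod (v s * K (t - s) - v t * K (t - s)) \<le> e * k (t - s)" for t
        proof (cases "t - s \<in> W")
          case True
          have "cmod (v t - v s) \<le> e" using W(3)[OF True, of s] by simp
          then show ?thesis
            using k(2)[of "t - s"]
            by (simp add: left_diff_distrib[symmetric] norm_mult Kabs norm_minus_commute mult_right_mono)
        next
          case False
          then show ?thesis using k(4)[OF False] by (simp add: K_def)
        qed
      qed
      also have "\<dots> = e"
      proof -
        have "complex_of_real (LINT t|m. k (t - s)) = (LINT t|m. K (t - s))" by (simp add: K_def)
        then have "(LINT t|m. k (t - s)) = 1" using c1 by simp
        then show ?thesis by simp
      qed
      finally show ?thesis .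
    qed
    have "cmod (\<psi> (\<lambda>s. v s - (LINT t|m. v t * K (t - s)))) \<le> 1 * e"
      using near v cv by (intro sup_bounded_functionalD(4)[OF \<psi>(1)] continuous_on_diff) auto
    then have "cmod (\<psi> v - (LINT x|m. v x * h x)) \<le> e"
      using sup_bounded_functional_diff[OF \<psi>(1) v cv] exch[OF integrable_continuous[OF v]] by simp
    then show ?thesis
      using abs_Re_le_cmod[of "\<psi> v - (LINT x|m. v x * h x)"] \<psi>(2) by simp
  qed
  ultimately show ?thesis using that by blast
qed

end

section \<open>Rich annihilators\<close>

context haar_group begin

definition restrict_to :: "('g \<Rightarrow> complex) \<Rightarrow> 'g set \<Rightarrow> 'g \<Rightarrow> complex" where
  "restrict_to f A x = indicator A x * f x"

lemma integrable_restrict: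
  assumes "integrable m f" "A \<in> sets borel"
  shows "integrable m (restrict_to f A)"
proof -
  have "(\<lambda>x. indicator A x *\<^sub>R f x) = restrict_to f A"
    by (auto simp: restrict_to_def indicator_def fun_eq_iff)
  then show ?thesis using integrable_mult_indicator[of A m f] assms by simp
qed

text \<open>Both the norm and \<open>\<Phi>\<close> are additive over a partition, so the inequality survives on some part.\<close>

lemma select_piece:
  fixes \<Phi> :: "('g \<Rightarrow> complex) \<Rightarrow> real"
  assumes add: "\<And>f g. integrable m f \<Longrightarrow> integrable m g \<Longrightarrow> \<Phi> (\<lambda>x. f x + g x) = \<Phi> f + \<Phi> g"
    and bound: "\<And>f. integrable m f \<Longrightarrow> \<Phi> f \<le> K * (LINT x|m. cmod (f x))"
    and F: "finite F" "\<And>C. C \<in> F \<Longrightarrow> C \<in> sets borel"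
    and f: "integrable m f" "{x. f x \<noteq> 0} \<subseteq> \<Union>F"
      "0 < (LINT x|m. cmod (f x))" "\<alpha> * (LINT x|m. cmod (f x)) \<le> \<Phi> f"
  shows "\<exists>C\<in>F. \<exists>B\<in>sets borel. B \<subseteq> C \<and> 0 < (LINT x|m. cmod (restrict_to f B x)) \<and>
    \<alpha> * (LINT x|m. cmod (restrict_to f B x)) \<le> \<Phi> (restrict_to f B)"
  using F f
proof (induction F arbitrary: f)
  case empty
  then have "f x = 0" for x by auto
  with empty show ?case by simp
next
  case (insert C F)
  define g where "g = restrict_to f C"
  define h where "h = restrict_to f (- C)"
  have C: "C \<in> sets borel" "- C \<in> sets borel" using insert.prems(1)[of C] by auto
  have gi: "integrable m g" and hi: "integrable m h"
    unfolding g_def h_def using C insert.prems(2) by (auto intro: integrable_restrict)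
  have fgh: "f = (\<lambda>x. g x + h x)" by (auto simp: g_def h_def restrict_to_def indicator_def fun_eq_iff)
  have "cmod (f x) = cmod (g x) + cmod (h x)" for x
    by (auto simp: g_def h_def restrict_to_def indicator_def)
  then have norm: "(LINT x|m. cmod (f x)) = (LINT x|m. cmod (g x)) + (LINT x|m. cmod (h x))"
    using gi hi by simp
  have \<Phi>: "\<Phi> f = \<Phi> g + \<Phi> h" using add[OF gi hi] fgh by simp
  have nn: "0 \<le> (LINT x|m. cmod (g x))" "0 \<le> (LINT x|m. cmod (h x))" by simp_all
  show ?case
  proof (cases "0 < (LINT x|m. cmod (g x)) \<and> \<alpha> * (LINT x|m. cmod (g x)) \<le> \<Phi> g")
    case True
    then show ?thesis using C by (intro bexI[of _ C]) (auto simp: g_def)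
  next
    case False
    \<comment> \<open>If \<open>g\<close> has norm 0, then \<open>bound\<close> gives
      \<open>\<Phi> g \<le> 0\<close> and the inequality is left to \<open>h\<close>; otherwise
      \<open>g\<close> violates it, and \<open>h\<close> must make up for that.\<close>
    have ineq: "\<alpha> * (LINT x|m. cmod (h x)) \<le> \<Phi> h"
    proof (cases "0 < (LINT x|m. cmod (g x))")
      case True
      then show ?thesis using False insert.prems(5) by (simp add: norm \<Phi> distrib_left)
    next
      case False
      then have "(LINT x|m. cmod (g x)) = 0" using nn by simp
      then show ?thesis using insert.prems(5) bound[OF gi] by (simp add: norm \<Phi>)
    qed
    have pos: "0 < (LINT x|m. cmod (h x))"
    proof (rule ccontr)
      assume "\<not> ?thesis"
      then have h0: "(LINT x|m. cmod (h x)) = 0" using nn by simp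
      then have g0: "0 < (LINT x|m. cmod (g x))" using insert.prems(4) norm by simp
      then have "\<Phi> g < \<alpha> * (LINT x|m. cmod (g x))" using False by simp
      then show False using insert.prems(5) bound[OF hi] h0 by (simp add: norm \<Phi>)
    qed
    have "{x. h x \<noteq> 0} \<subseteq> \<Union>F"
      using insert.prems(3) by (auto simp: h_def restrict_to_def indicator_def split: if_splits)
    from insert.IH[OF _ hi this pos ineq] insert.prems(1) obtain D B
      where B: "D \<in> F" "B \<in> sets borel" "B \<subseteq> D" "0 < (LINT x|m. cmod (restrict_to h B x))"
        "\<alpha> * (LINT x|m. cmod (restrict_to h B x)) \<le> \<Phi> (restrict_to h B)" by blast
    \<comment> \<open>The given sets may overlap. Cutting off \<open>C\<close> makes the parts
      disjoint, which is why the conclusion speaks of Borel subsets of members of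
      \<open>F\<close>.\<close>
    have eq: "restrict_to h B = restrict_to f (B - C)"
      by (auto simp: h_def restrict_to_def indicator_def fun_eq_iff)
    show ?thesis
      using B C unfolding eq by (intro bexI[of _ D] bexI[of _ "B - C"]) auto
  qed
qed

text \<open>Translation by \<open>a\<close> multiplies the integral against a character
  \<open>\<gamma>\<close> by \<open>\<gamma> a\<close>.\<close>

lemma annihilator_translate:
  assumes \<Lambda>: "\<Lambda> \<subseteq> dual_group" and h: "h \<in> annihilator \<Lambda>"
  shows "(\<lambda>x. h (x - a)) \<in> annihilator \<Lambda>"
  unfolding annihilator_def
proof (intro CollectI conjI ballI)
  have hc: "continuous_everywhere h" using h by (simp add: annihilator_def)
  show "continuous_everywhere (\<lambda>x. h (x - a))" by (rule continuous_compose_diff(4)[OF hc])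
  fix \<gamma> assume \<gamma>: "\<gamma> \<in> \<Lambda>"
  then have \<gamma>d: "\<gamma> \<in> dual_group" using \<Lambda> by blast
  note D = dual_groupD[OF \<gamma>d]
  have c: "continuous_everywhere (\<lambda>x. h x * \<gamma> (a + x))"
    by (intro continuous_on_mult hc continuous_compose_diff(6)[OF D(1)])
  have "(LINT x|m. h (x - a) * \<gamma> x) = (LINT x|m. h x * \<gamma> (a + x))"
    using integral_translate_diff[OF c, of a] by simp
  also have "\<dots> = (LINT x|m. \<gamma> a * (h x * \<gamma> x))" by (simp add: D(3) mult_ac)
  finally show "(LINT x|m. h (x - a) * \<gamma> x) = 0"
    using h \<gamma> by (simp add: annihilator_def)
qed

lemma annihilator_diff:
  "h \<in> annihilator \<Lambda> \<Longrightarrow> g \<in> annihilator \<Lambda> \<Longrightarrow> \<Lambda> \<subseteq> dual_group \<Longrightarrow> (\<lambda>x. h x - g x) \<in> annihilator \<Lambda>"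
  by (auto simp: annihilator_def left_diff_distrib integrable_mult_continuous integrable_continuous
      dual_groupD(1) subset_iff intro!: continuous_intros)

lemma annihilator_scale: "h \<in> annihilator \<Lambda> \<Longrightarrow> (\<lambda>x. c * h x) \<in> annihilator \<Lambda>"
  by (auto simp: annihilator_def mult.assoc intro!: continuous_intros)

text \<open>The functional in the definition of narrow operators is specialised to integration against \<open>v\<close>.\<close>

definition rich_annihilator :: "('g \<Rightarrow> complex) set \<Rightarrow> bool" where
  "rich_annihilator \<Lambda> \<longleftrightarrow> (\<forall>x y v \<delta>.
     continuous_everywhere x \<longrightarrow> (\<forall>t. cmod (x t) \<le> 1) \<longrightarrow> (\<exists>t. cmod (x t) = 1) \<longrightarrow>
     continuous_everywhere y \<longrightarrow> (\<forall>t. cmod (y t) \<le> 1) \<longrightarrow> (\<exists>t. cmod (y t) = 1) \<longrightarrow>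
     continuous_everywhere v \<longrightarrow> \<delta> > 0 \<longrightarrow>
     (\<exists>z h. continuous_everywhere z \<and> (\<forall>t. cmod (z t) \<le> 1) \<and> h \<in> annihilator \<Lambda> \<and>
        (\<forall>t. cmod (y t - z t - h t) \<le> \<delta>) \<and> cmod (LINT t|m. v t * (y t - z t)) \<le> \<delta> \<and>
        (\<exists>t. cmod (x t + z t) \<ge> 2 - \<delta>)))"

lemma rich_annihilatorD:
  assumes "rich_annihilator \<Lambda>"
    and "continuous_everywhere x" "\<forall>t. cmod (x t) \<le> 1" "\<exists>t. cmod (x t) = 1"
    and "continuous_everywhere y" "\<forall>t. cmod (y t) \<le> 1" "\<exists>t. cmod (y t) = 1"
    and "continuous_everywhere v" "\<delta> > 0"
  shows "\<exists>z h. continuous_everywhere z \<and> (\<forall>t. cmod (z t) \<le> 1) \<and> h \<in> annihilator \<Lambda> \<and>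
    (\<forall>t. cmod (y t - z t - h t) \<le> \<delta>) \<and> cmod (LINT t|m. v t * (y t - z t)) \<le> \<delta> \<and>
    (\<exists>t. cmod (x t + z t) \<ge> 2 - \<delta>)"
  using assms(1)[unfolded rich_annihilator_def, rule_format, of x y v \<delta>] assms(2-) by blast

lemma finite_phase_net:
  assumes "\<delta> > 0"
  obtains P :: "complex set" where "finite P" "\<And>c. c \<in> P \<Longrightarrow> cmod c = 1"
    "\<And>z. \<exists>c\<in>P. cmod (z - c * complex_of_real (cmod z)) \<le> \<delta> * cmod z"
proof -
  have "compact (sphere 0 1 :: complex set)" by simp
  moreover have "\<And>c. c \<in> sphere 0 1 \<Longrightarrow> open (ball c \<delta>)" by simp
  moreover have "sphere 0 1 \<subseteq> (\<Union>c\<in>sphere 0 1. ball (c::complex) \<delta>)" using assms by auto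
  ultimately obtain P where P: "P \<subseteq> sphere 0 1" "finite P" "sphere 0 1 \<subseteq> (\<Union>c\<in>P. ball (c::complex) \<delta>)"
    by (rule compactE_image)
  have "\<exists>c\<in>P. cmod (z - c * complex_of_real (cmod z)) \<le> \<delta> * cmod z" for z
  proof -
    \<comment> \<open>At 0, where \<open>sgn\<close> leaves the circle, 1 serves as the
      phase.\<close>
    define s where "s = (if z = 0 then 1 else sgn z)"
    have "s \<in> sphere 0 1" by (simp add: s_def norm_sgn)
    then obtain c where c: "c \<in> P" "cmod (s - c) < \<delta>" using P(3) by (auto simp: dist_norm norm_minus_commute)
    have "z = s * complex_of_real (cmod z)" by (simp add: s_def sgn_div_norm scaleR_conv_of_real)
    then have "z - c * complex_of_real (cmod z) = (s - c) * complex_of_real (cmod z)"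
      by (simp add: left_diff_distrib)
    then have "cmod (z - c * complex_of_real (cmod z)) \<le> \<delta> * cmod z"
      using c(2) by (simp add: norm_mult mult_right_mono)
    then show ?thesis using c(1) by blast
  qed
  moreover have "cmod c = 1" if "c \<in> P" for c using P(1) that by auto
  ultimately show ?thesis using that[of P] P(2) by blast
qed

lemma difference_nbhd:
  fixes W :: "'g set"
  assumes "open W" "0 \<in> W"
  obtains V where "open V" "0 \<in> V" "\<And>x y. x \<in> V \<Longrightarrow> y \<in> V \<Longrightarrow> x - y \<in> W"
proof -
  have "open ((\<lambda>(x, y). x - y) -` W)"
    unfolding case_prod_unfold by (intro open_vimage assms continuous_intros)
  moreover have "(0, 0) \<in> (\<lambda>(x, y). x - y) -` W" using assms by simp
  ultimately obtain A B where "open A" "open B" "(0, 0) \<in> A \<times> B" "A \<times> B \<subseteq> (\<lambda>(x, y). x - y) -` W"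
    by (rule open_prod_elim)
  then show ?thesis by (intro that[of "A \<inter> B"]) auto
qed

lemma open_translate_diff: "open V \<Longrightarrow> open {x :: 'g. x - t \<in> V}"
  using open_vimage[of V "\<lambda>x. x - t"] by (simp add: vimage_def continuous_intros)

text \<open>Two points of the unit disc whose sum has modulus close to 2 nearly coincide. Replacing
  \<open>b\<close> by 1 costs another \<open>d\<close>, and expanding the square of
  \<open>cmod (1 + c * z)\<close> yields the real part. Positivity of \<open>b\<close> later locates
  the point inside the support of a bump.\<close>

lemma rotation_estimate:
  assumes c: "cmod c = 1" and b: "0 \<le> b" "b \<le> 1" and z: "cmod z \<le> 1" and d: "0 < d" "d < 1"
    and sum: "cmod (cnj c * complex_of_real b + z) \<ge> 2 - d"
  shows "b > 0" "Re (c * z) \<ge> 1 - 4 * d"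
proof -
  have cc: "c * cnj c = 1" using complex_norm_square[of c] c by simp
  have "cmod (cnj c * complex_of_real b + z) \<le> b + cmod z"
    using norm_triangle_ineq[of "cnj c * complex_of_real b" z] c b by (simp add: norm_mult)
  then have b1: "b \<ge> 1 - d" using sum z by simp
  then show "b > 0" using d by simp
  have "cmod (cnj c * complex_of_real b + z) \<le> cmod (cnj c + z) + cmod (cnj c * complex_of_real b - cnj c)"
    using norm_triangle_ineq[of "cnj c + z" "cnj c * complex_of_real b - cnj c"] by (simp add: algebra_simps)
  also have "cmod (cnj c * complex_of_real b - cnj c) = 1 - b"
  proof -
    have "cnj c * complex_of_real b - cnj c = cnj c * complex_of_real (b - 1)" by (simp add: algebra_simps)
    then have "cmod (cnj c * complex_of_real b - cnj c) = \<bar>b - 1\<bar>" using c by (simp only: norm_mult complex_mod_cnj norm_of_real mult_1)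
    then show ?thesis using b by simp
  qed
  finally have "cmod (cnj c + z) \<ge> 2 - 2 * d" using sum b1 by simp
  moreover have "cmod (cnj c + z) = cmod (1 + c * z)"
  proof -
    have "1 + c * z = c * (cnj c + z)" by (simp add: distrib_left cc)
    then show ?thesis using c by (simp add: norm_mult)
  qed
  ultimately have "(2 - 2 * d)\<^sup>2 \<le> (cmod (1 + c * z))\<^sup>2"
    using d by (intro power_mono) auto
  also have "\<dots> = 1 + 2 * Re (c * z) + (cmod (c * z))\<^sup>2"
    unfolding cmod_power2 by (simp add: power2_eq_square algebra_simps)
  also have "(cmod (c * z))\<^sup>2 \<le> 1" using c z by (simp add: norm_mult power_le_one)
  finally have "(2 - 2 * d)\<^sup>2 \<le> 2 + 2 * Re (c * z)" by simp
  moreover have "(2 - 2 * d)\<^sup>2 = 4 - 8 * d + 4 * d\<^sup>2" by (simp add: power2_eq_square algebra_simps)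
  moreover have "0 \<le> d\<^sup>2" by simp
  ultimately show "Re (c * z) \<ge> 1 - 4 * d" by linarith
qed

text \<open>The geometric core. The inequality between \<open>\<alpha>\<close> times the norm and
  \<open>\<Phi>\<close> survives two restrictions by \<open>select_piece\<close>: the first fixes
  place and phase before richness is applied, the second adapts the piece to the open set that
  richness returns.\<close>

lemma rich_piece:
  fixes \<Phi> :: "('g \<Rightarrow> complex) \<Rightarrow> real"
  assumes \<Lambda>: "\<Lambda> \<subseteq> dual_group" and rich: "rich_annihilator \<Lambda>"
    and add: "\<And>f g. integrable m f \<Longrightarrow> integrable m g \<Longrightarrow> \<Phi> (\<lambda>x. f x + g x) = \<Phi> f + \<Phi> g"
    and bound: "\<And>f. integrable m f \<Longrightarrow> \<Phi> f \<le> K * (LINT x|m. cmod (f x))"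
    and f0: "integrable m f0" "0 < (LINT x|m. cmod (f0 x))" "\<alpha> * (LINT x|m. cmod (f0 x)) \<le> \<Phi> f0"
    and v: "continuous_everywhere v" "dist_L1 \<Lambda> v > 0" and e: "e > 0"
  shows "\<exists>f h. integrable m f \<and> 0 < (LINT x|m. cmod (f x)) \<and> \<alpha> * (LINT x|m. cmod (f x)) \<le> \<Phi> f \<and>
    h \<in> annihilator \<Lambda> \<and> (\<forall>x. cmod (h x) \<le> 1 + e) \<and> Re (LINT x|m. v x * h x) \<ge> dist_L1 \<Lambda> v - e \<and>
    Re (LINT x|m. f x * h x) \<ge> (1 - e) * (LINT x|m. cmod (f x))"
proof -
  define N where "N = (LINT x|m. cmod (v x))"
  have N: "N \<ge> 0" by (simp add: N_def)
  \<comment> \<open>\<open>d < 1\<close> is for \<open>rotation_estimate\<close>,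
    \<open>d < dist_L1 \<Lambda> v\<close> keeps \<open>h0\<close> from vanishing, and
    \<open>d * (8 + N) \<le> e\<close> covers the final losses: \<open>8 * d\<close> in
    \<open>pointwise\<close> and \<open>4 * d + d * N\<close> in \<open>vh2\<close>.\<close>
  define d where "d = min (1 / 2) (min (dist_L1 \<Lambda> v / 2) (e / (8 + N)))"
  have d: "d > 0" "d < 1" "d < dist_L1 \<Lambda> v" using v(2) e N by (auto simp: d_def)
  have "d \<le> e / (8 + N)" by (simp add: d_def)
  then have dN: "d * (8 + N) \<le> e" using N by (simp add: field_simps)
  have "0 \<le> d * N" using d N by simp
  then have d8: "8 * d \<le> e" using dN by (simp add: algebra_simps)
  obtain h0 where h0: "h0 \<in> annihilator \<Lambda>" "\<And>x. cmod (h0 x) \<le> 1"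
    "Re (LINT x|m. v x * h0 x) \<ge> dist_L1 \<Lambda> v - d"
    using dist_L1_attained_by_annihilator[OF \<Lambda> v(1) d(1)] by blast
  have h0c: "continuous_everywhere h0" using h0(1) by (simp add: annihilator_def)
  have "continuous_everywhere (\<lambda>x. cmod (h0 x))" by (intro continuous_intros h0c)
  from continuous_attains_sup[OF compact_UNIV _ this]
  obtain tm where tm: "\<And>t. cmod (h0 t) \<le> cmod (h0 tm)" by auto
  define s where "s = cmod (h0 tm)"
  have s1: "s \<le> 1" using h0(2) by (simp add: s_def)
  have s0: "s > 0"
  proof (rule ccontr)
    assume "\<not> ?thesis"
    then have "h0 t = 0" for t using tm[of t] by (simp add: s_def)
    then show False using h0(3) d(3) by simp
  qed
  \<comment> \<open>Richness concerns the unit sphere, so \<open>h0\<close> is scaled to attain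
    modulus 1. As \<open>s \<le> 1\<close>, this can only increase the positive real part of its
    integral against \<open>v\<close>.\<close>
  define y where "y = (\<lambda>x. complex_of_real (1 / s) * h0 x)"
  have ya: "y \<in> annihilator \<Lambda>" unfolding y_def by (rule annihilator_scale[OF h0(1)])
  have yc: "continuous_everywhere y" using ya by (simp add: annihilator_def)
  have yabs: "cmod (y t) = cmod (h0 t) / s" for t using s0 by (simp add: y_def norm_mult norm_divide)
  have y1: "\<forall>t. cmod (y t) \<le> 1" "\<exists>t. cmod (y t) = 1"
    using s0 tm by (auto simp: yabs s_def field_simps intro!: exI[of _ tm])
  have vy: "Re (LINT x|m. v x * y x) \<ge> dist_L1 \<Lambda> v - d"
  proof -
    have "(LINT x|m. v x * y x) = complex_of_real (1 / s) * (LINT x|m. v x * h0 x)"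
      by (simp add: y_def mult.left_commute)
    then have "Re (LINT x|m. v x * y x) = Re (LINT x|m. v x * h0 x) / s" by simp
    moreover have "Re (LINT x|m. v x * h0 x) * s \<le> Re (LINT x|m. v x * h0 x)"
      using h0(3) d(3) s1 by (intro mult_left_le) auto
    then have "Re (LINT x|m. v x * h0 x) \<le> Re (LINT x|m. v x * h0 x) / s"
      using s0 by (simp only: pos_le_divide_eq)
    ultimately show ?thesis using h0(3) by linarith
  qed
  obtain W where W: "open W" "0 \<in> W" "\<And>a x. a \<in> W \<Longrightarrow> cmod (v (x + a) - v x) \<le> d"
    using uniformly_continuous_translate[OF v(1) d(1)] by metis
  obtain W' where W': "open W'" "0 \<in> W'" "\<And>x y. x \<in> W' \<Longrightarrow> y \<in> W' \<Longrightarrow> x - y \<in> W"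
    using difference_nbhd[OF W(1,2)] by metis
  obtain P where P: "finite P" "\<And>c. c \<in> P \<Longrightarrow> cmod c = 1"
    "\<And>z. \<exists>c\<in>P. cmod (z - c * complex_of_real (cmod z)) \<le> d * cmod z"
    using finite_phase_net[OF d(1)] by metis
  \<comment> \<open>Two points of the same translate of \<open>W'\<close> differ by an element of
    \<open>W\<close>, the neighbourhood by which \<open>v\<close> may be translated cheaply.\<close>
  have "UNIV \<subseteq> (\<Union>t\<in>UNIV. {x. x - t \<in> W'})" using W'(2) by (auto intro: exI[of _ "_"])
  then obtain T where T: "finite T" "UNIV \<subseteq> (\<Union>t\<in>T. {x. x - t \<in> W'})"
    using compactE_image[OF compact_UNIV, of UNIV "\<lambda>t. {x. x - t \<in> W'}"] open_translate_diff[OF W'(1)] by metis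
  have f0m[measurable]: "f0 \<in> borel_measurable m" using f0(1) by simp
  define C where "C t c = {x. x - t \<in> W'} \<inter> {x. cmod (f0 x - c * complex_of_real (cmod (f0 x))) \<le> d * cmod (f0 x)}" for t c
  have Cm: "C t c \<in> sets borel" for t c
  proof -
    have "{x \<in> space m. cmod (f0 x - c * complex_of_real (cmod (f0 x))) \<le> d * cmod (f0 x)} \<in> sets m"
      by measurable
    then show ?thesis unfolding C_def using open_translate_diff[OF W'(1), of t] by (intro sets.Int) auto
  qed
  have "{x. f0 x \<noteq> 0} \<subseteq> \<Union>((\<lambda>(t, c). C t c) ` (T \<times> P))"
  proof
    fix x
    obtain t where "t \<in> T" "x - t \<in> W'" using T(2) by blast
    moreover obtain c where "c \<in> P" "cmod (f0 x - c * complex_of_real (cmod (f0 x))) \<le> d * cmod (f0 x)"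
      using P(3) by blast
    ultimately show "x \<in> \<Union>((\<lambda>(t, c). C t c) ` (T \<times> P))" by (auto simp: C_def)
  qed
  from select_piece[OF add bound _ _ f0(1) this f0(2,3)] T(1) P(1) Cm
  obtain t c B where t: "t \<in> T" and c: "c \<in> P" and B: "B \<in> sets borel" "B \<subseteq> C t c"
    "0 < (LINT x|m. cmod (restrict_to f0 B x))" "\<alpha> * (LINT x|m. cmod (restrict_to f0 B x)) \<le> \<Phi> (restrict_to f0 B)"
    by fastforce
  define f1 where "f1 = restrict_to f0 B"
  have f1: "integrable m f1" "0 < (LINT x|m. cmod (f1 x))" "\<alpha> * (LINT x|m. cmod (f1 x)) \<le> \<Phi> f1"
    using B f0(1) by (auto simp: f1_def integrable_restrict)
  have c1: "cmod c = 1" using P(2) c by simp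
  define U where "U = {x. x - t \<in> W'}"
  have U: "open U" "t \<in> U" using open_translate_diff[OF W'(1)] W'(2) by (auto simp: U_def)
  obtain b :: "'g \<Rightarrow> real" where b: "continuous_everywhere b" "\<And>x. 0 \<le> b x" "\<And>x. b x \<le> 1"
    "\<And>x. x \<in> - U \<Longrightarrow> b x = 0" "\<And>x. x \<in> {t} \<Longrightarrow> b x = 1"
    using urysohn[of "- U" "{t}"] U by (auto simp: closed_Compl)
  \<comment> \<open>A bump of phase \<open>cnj c\<close> that vanishes off \<open>U\<close>. Where
    \<open>x + z\<close> almost has modulus 2, \<open>x\<close> is nonzero, so the point lies in
    \<open>U\<close>; there \<open>z\<close> is close to \<open>cnj c\<close>, which cancels the
    phase of \<open>f1\<close>.\<close>
  define x where "x = (\<lambda>s. cnj c * complex_of_real (b s))"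
  have xc: "continuous_everywhere x" unfolding x_def by (intro continuous_intros b)
  have x1: "\<forall>s. cmod (x s) \<le> 1" "\<exists>s. cmod (x s) = 1"
    using b c1 by (auto simp: x_def norm_mult intro!: exI[of _ t])
  from rich_annihilatorD[OF rich xc x1 yc y1 v(1) d(1)]
  obtain z h where z: "continuous_everywhere z" "\<And>s. cmod (z s) \<le> 1" and h: "h \<in> annihilator \<Lambda>"
    "\<And>s. cmod (y s - z s - h s) \<le> d" and vz: "cmod (LINT s|m. v s * (y s - z s)) \<le> d"
    and ex: "\<exists>s. cmod (x s + z s) \<ge> 2 - d"
    by blast
  obtain t1 where t1: "cmod (x t1 + z t1) \<ge> 2 - d" using ex by blast
  have rot: "b t1 > 0" "Re (c * z t1) \<ge> 1 - 4 * d"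
    using rotation_estimate[OF c1 b(2,3)[of t1] z(2)[of t1] d(1,2)] t1 by (auto simp: x_def)
  have t1U: "t1 \<in> U" using b(4)[of t1] rot(1) by auto
  \<comment> \<open>\<open>z\<close> need not lie in the annihilator, but \<open>y - h\<close> does,
    and it is within \<open>d\<close> of \<open>z\<close>.\<close>
  define h1 where "h1 = (\<lambda>s. y s - h s)"
  have h1a: "h1 \<in> annihilator \<Lambda>" unfolding h1_def using annihilator_diff[OF ya h(1) \<Lambda>] .
  have h1c: "continuous_everywhere h1" using h1a by (simp add: annihilator_def)
  have h1z: "cmod (h1 s - z s) \<le> d" for s using h(2)[of s] by (simp add: h1_def algebra_simps)
  have h1b: "cmod (h1 s) \<le> 1 + d" for s
    using norm_triangle_ineq[of "h1 s - z s" "z s"] h1z[of s] z(2)[of s] by simp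
  have vi: "integrable m v" by (rule integrable_continuous[OF v(1)])
  have vh1: "Re (LINT s|m. v s * h1 s) \<ge> dist_L1 \<Lambda> v - 2 * d - d * N"
  proof -
    have i: "integrable m (\<lambda>s. v s * y s)" "integrable m (\<lambda>s. v s * z s)" "integrable m (\<lambda>s. v s * h1 s)"
      using vi yc z(1) h1c by (auto intro: integrable_mult_continuous)
    have "(LINT s|m. v s * h1 s) = (LINT s|m. v s * y s) - (LINT s|m. v s * (y s - z s)) + (LINT s|m. v s * (h1 s - z s))"
      using i by (simp add: right_diff_distrib)
    moreover have "cmod (LINT s|m. v s * (h1 s - z s)) \<le> d * N"
      unfolding N_def using h1z h1c z(1)
      by (intro integral_cmod_bound vi continuous_imp_measurable continuous_on_diff)
    ultimately show ?thesis
      using vy vz abs_Re_le_cmod[of "LINT s|m. v s * (y s - z s)"] abs_Re_le_cmod[of "LINT s|m. v s * (h1 s - z s)"]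
      by simp
  qed
  \<comment> \<open>Relaxing \<open>1 - 4 * d\<close> to \<open>1 - 5 * d\<close> makes the estimate
    at \<open>t1\<close> hold on an open set around it.\<close>
  define V where "V = U \<inter> {s. Re (c * z s) > 1 - 5 * d}"
  have V: "open V" "t1 \<in> V"
    unfolding V_def using U t1U rot(2) d(1) z(1) by (auto intro!: open_Int open_Collect_less continuous_intros)
  have "x \<in> (\<Union>a\<in>UNIV. {x. x - a \<in> V})" for x
    using V(2) by (auto intro!: exI[of _ "x - t1"])
  then obtain T2 where T2: "finite T2" "UNIV \<subseteq> (\<Union>a\<in>T2. {x. x - a \<in> V})"
    using compactE_image[OF compact_UNIV, of UNIV "\<lambda>t. {x. x - t \<in> V}"] open_translate_diff[OF V(1)]
    by (metis subsetI)
  have "{x. f1 x \<noteq> 0} \<subseteq> \<Union>((\<lambda>a. {x. x - a \<in> V}) ` T2)" using T2(2) by blast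
  \<comment> \<open>\<open>f1\<close> may vanish on \<open>V\<close>, but one of the finitely many
    translates of \<open>V\<close> covering the group carries a piece of it on which the inequality
    persists.\<close>
  from select_piece[OF add bound _ _ f1(1) this f1(2,3)] T2(1) open_translate_diff[OF V(1)]
  obtain a B2 where B2: "B2 \<in> sets borel" "B2 \<subseteq> {x. x - a \<in> V}"
    "0 < (LINT x|m. cmod (restrict_to f1 B2 x))" "\<alpha> * (LINT x|m. cmod (restrict_to f1 B2 x)) \<le> \<Phi> (restrict_to f1 B2)"
    by fastforce
  define f2 where "f2 = restrict_to f1 B2"
  have f2: "integrable m f2" "0 < (LINT x|m. cmod (f2 x))" "\<alpha> * (LINT x|m. cmod (f2 x)) \<le> \<Phi> f2"
    using B2 f1(1) by (auto simp: f2_def integrable_restrict)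
  have supp: "x \<in> U \<and> x - a \<in> V \<and> cmod (f2 x - c * complex_of_real (cmod (f2 x))) \<le> d * cmod (f2 x)"
    if "f2 x \<noteq> 0" for x
  proof -
    have "x \<in> B2" "x \<in> B" "f2 x = f0 x"
      using that by (auto simp: f2_def f1_def restrict_to_def indicator_def split: if_splits)
    then show ?thesis using B(2) B2(2) by (auto simp: C_def U_def)
  qed
  \<comment> \<open>The piece is not zero, so some \<open>x\<close> lies in \<open>U\<close> with
    \<open>x - a\<close> in \<open>V\<close>, a subset of \<open>U\<close>; hence \<open>a\<close>
    is a difference of two points of \<open>U\<close>.\<close>
  have aW: "a \<in> W"
  proof -
    have "\<exists>x. f2 x \<noteq> 0"
    proof (rule ccontr)
      assume "\<not> ?thesis"
      then show False using f2(2) by simp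
    qed
    then obtain x where "x \<in> U" "x - a \<in> U" using supp by (auto simp: V_def)
    then have "(x - t) - (x - a - t) \<in> W" by (intro W'(3)) (auto simp: U_def)
    then show ?thesis by simp
  qed
  define h2 where "h2 = (\<lambda>s. h1 (s - a))"
  have h2a: "h2 \<in> annihilator \<Lambda>" unfolding h2_def by (rule annihilator_translate[OF \<Lambda> h1a])
  have h2c: "continuous_everywhere h2" using h2a by (simp add: annihilator_def)
  have h2b: "cmod (h2 s) \<le> 1 + d" for s using h1b by (simp add: h2_def)
  have vh2: "Re (LINT s|m. v s * h2 s) \<ge> dist_L1 \<Lambda> v - e"
  proof -
    have vt: "continuous_everywhere (\<lambda>s. v (s + a))"
      using continuous_compose_diff(6)[OF v(1), of a] by (simp add: add.commute)
    have cc: "continuous_everywhere (\<lambda>s. v (s + a) * h1 s)" by (intro continuous_on_mult vt h1c)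
    have dc: "continuous_everywhere (\<lambda>s. v (s + a) - v s)" by (intro continuous_on_diff vt v)
    have "(LINT s|m. v s * h2 s) = (LINT s|m. v (s + a) * h1 s)"
      using integral_translate_diff[OF cc, of a] by (simp add: h2_def)
    also have "\<dots> = (LINT s|m. v s * h1 s) + (LINT s|m. (v (s + a) - v s) * h1 s)"
      using integrable_continuous[OF cc] integrable_mult_continuous[OF vi h1c] by (simp add: left_diff_distrib)
    finally have eq: "(LINT s|m. v s * h2 s) = (LINT s|m. v s * h1 s) + (LINT s|m. (v (s + a) - v s) * h1 s)" .
    have "cmod (LINT s|m. (v (s + a) - v s) * h1 s) \<le> (1 + d) * (LINT s|m. cmod (v (s + a) - v s))"
      by (intro integral_cmod_bound integrable_continuous dc continuous_imp_measurable h1c h1b)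
    also have "(LINT s|m. cmod (v (s + a) - v s)) \<le> (LINT s|m. d)"
      using W(3)[OF aW] dc by (intro integral_mono integrable_continuous continuous_on_norm continuous_on_const)
    finally have "cmod (LINT s|m. (v (s + a) - v s) * h1 s) \<le> (1 + d) * d" using d by simp
    also have "\<dots> \<le> 2 * d" using d by simp
    finally have "Re (LINT s|m. (v (s + a) - v s) * h1 s) \<ge> - 2 * d"
      using abs_Re_le_cmod[of "LINT s|m. (v (s + a) - v s) * h1 s"] by simp
    then have "Re (LINT s|m. v s * h2 s) \<ge> dist_L1 \<Lambda> v - (4 * d + d * N)"
      using eq vh1 by simp
    then show ?thesis using dN d(1) by (simp add: algebra_simps)
  qed
  \<comment> \<open>The losses are \<open>5 * d\<close> from \<open>V\<close>, \<open>d\<close> from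
    replacing \<open>z\<close> by \<open>h1\<close>, and \<open>2 * d\<close> from the phase of
    \<open>f2\<close>.\<close>
  have pointwise: "(1 - e) * cmod (f2 s) \<le> Re (f2 s * h2 s)" for s
  proof (cases "f2 s = 0")
    case False
    note sp = supp[OF False]
    define r where "r = f2 s - c * complex_of_real (cmod (f2 s))"
    have R1: "Re (c * h2 s) \<ge> Re (c * z (s - a)) - d"
    proof -
      have "cmod (c * (h2 s - z (s - a))) \<le> d" using h1z[of "s - a"] c1 by (simp add: h2_def norm_mult)
      then show ?thesis using abs_Re_le_cmod[of "c * (h2 s - z (s - a))"] by (simp add: algebra_simps)
    qed
    have "Re (c * z (s - a)) > 1 - 5 * d" using sp by (simp add: V_def)
    with R1 have R: "Re (c * h2 s) \<ge> 1 - 6 * d" by linarith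
    have "cmod (r * h2 s) \<le> (d * cmod (f2 s)) * (1 + d)"
      using sp h2b[of s] d by (auto simp: r_def norm_mult intro!: mult_mono)
    also have "\<dots> \<le> (d * cmod (f2 s)) * 2" using d by (intro mult_left_mono) auto
    finally have "Re (r * h2 s) \<ge> - (2 * d * cmod (f2 s))"
      using abs_Re_le_cmod[of "r * h2 s"] by simp
    moreover have "f2 s * h2 s = complex_of_real (cmod (f2 s)) * (c * h2 s) + r * h2 s"
      by (simp add: r_def algebra_simps)
    moreover have "cmod (f2 s) * (1 - 6 * d) \<le> cmod (f2 s) * Re (c * h2 s)"
      using R by (intro mult_left_mono) auto
    ultimately have "cmod (f2 s) * (1 - 6 * d) - 2 * d * cmod (f2 s) \<le> Re (f2 s * h2 s)" by simp
    moreover have "8 * d * cmod (f2 s) \<le> e * cmod (f2 s)" using d8 by (intro mult_right_mono) auto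
    ultimately show ?thesis by (simp add: algebra_simps)
  qed simp
  have i2: "integrable m (\<lambda>s. f2 s * h2 s)" by (rule integrable_mult_continuous[OF f2(1) h2c])
  have iRe: "integrable m (\<lambda>s. Re (f2 s * h2 s))" using i2 by (rule integrable_Re)
  have "(1 - e) * (LINT s|m. cmod (f2 s)) = (LINT s|m. (1 - e) * cmod (f2 s))" by simp
  also have "\<dots> \<le> (LINT s|m. Re (f2 s * h2 s))"
    using f2(1) pointwise by (intro integral_mono[OF _ iRe]) auto
  also have "\<dots> = Re (LINT s|m. f2 s * h2 s)" using i2 by (rule integral_Re)
  finally have "(1 - e) * (LINT s|m. cmod (f2 s)) \<le> Re (LINT s|m. f2 s * h2 s)" .
  moreover have "\<forall>s. cmod (h2 s) \<le> 1 + e" 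
  proof
    fix s show "cmod (h2 s) \<le> 1 + e" using h2b[of s] d8 d(1) by linarith
  qed
  ultimately show ?thesis using f2 h2a vh2 by blast
qed

end

section \<open>Quotients of seminormed spaces\<close>

lemma complex_scalars_simps [simp]:
  "carrier complex_scalars = UNIV" "add complex_scalars = (+)" "mult complex_scalars = (*)"
  "one complex_scalars = 1" "zero complex_scalars = 0" "smult complex_scalars = (*)"
  "nrm complex_scalars = cmod"
  by (simp_all add: complex_scalars_def)

lemma cring_complex_scalars: "cring complex_scalars"
proof (rule cringI)
  show "abelian_group complex_scalars"
  proof (rule abelian_groupI)
    fix x assume "x \<in> carrier complex_scalars"
    show "\<exists>y\<in>carrier complex_scalars. y \<oplus>\<^bsub>complex_scalars\<^esub> x = \<zero>\<^bsub>complex_scalars\<^esub>"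
      by (rule bexI[of _ "- x"]) simp_all
  qed (simp_all add: add_ac)
  show "comm_monoid complex_scalars"
    by (rule comm_monoidI) (auto simp: algebra_simps)
qed (simp add: algebra_simps)

text \<open>Definiteness is dropped so that integrable functions qualify before null functions are
  divided out; both quotients are then instances of one construction.\<close>

locale complex_seminormed_space = module complex_scalars X for X :: "'v normed_module" (structure) +
  assumes nrm_nonneg: "x \<in> carrier X \<Longrightarrow> 0 \<le> nrm X x"
    and nrm_triangle: "x \<in> carrier X \<Longrightarrow> y \<in> carrier X \<Longrightarrow> nrm X (x \<oplus> y) \<le> nrm X x + nrm X y"
    and nrm_smult: "x \<in> carrier X \<Longrightarrow> nrm X (c \<odot> x) = cmod c * nrm X x"

lemma complex_seminormed_spaceI:
  fixes X :: "'v normed_module" (structure)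
  assumes "abelian_group X"
    and "\<And>c x. x \<in> carrier X \<Longrightarrow> c \<odot> x \<in> carrier X"
    and "\<And>c d x. x \<in> carrier X \<Longrightarrow> (c + d) \<odot> x = c \<odot> x \<oplus> d \<odot> x"
    and "\<And>c x y. x \<in> carrier X \<Longrightarrow> y \<in> carrier X \<Longrightarrow> c \<odot> (x \<oplus> y) = c \<odot> x \<oplus> c \<odot> y"
    and "\<And>c d x. x \<in> carrier X \<Longrightarrow> (c * d) \<odot> x = c \<odot> (d \<odot> x)"
    and "\<And>x. x \<in> carrier X \<Longrightarrow> 1 \<odot> x = x"
    and "\<And>x. x \<in> carrier X \<Longrightarrow> 0 \<le> nrm X x"
    and "\<And>x y. x \<in> carrier X \<Longrightarrow> y \<in> carrier X \<Longrightarrow> nrm X (x \<oplus> y) \<le> nrm X x + nrm X y"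
    and "\<And>c x. x \<in> carrier X \<Longrightarrow> nrm X (c \<odot> x) = cmod c * nrm X x"
  shows "complex_seminormed_space X"
proof (rule complex_seminormed_space.intro)
  show "module complex_scalars X"
    by (rule moduleI[OF cring_complex_scalars assms(1)]; simp only: complex_scalars_simps; rule assms)
  show "complex_seminormed_space_axioms X"
    by (rule complex_seminormed_space_axioms.intro) (rule assms; assumption)+
qed

text \<open>Completeness for sequences with geometrically small increments. Such sequences lift
  along a quotient map term by term, and every Cauchy sequence has a subsequence of this
  kind.\<close>

definition series_complete :: "'v normed_module \<Rightarrow> bool" where
  "series_complete X \<longleftrightarrow>
     (\<forall>S. (\<forall>k. S k \<in> carrier X) \<longrightarrow> (\<forall>k. nrm X (S (Suc k) \<ominus>\<^bsub>X\<^esub> S k) < (1 / 2) ^ k) \<longrightarrow>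
        (\<exists>l\<in>carrier X. (\<lambda>k. nrm X (S k \<ominus>\<^bsub>X\<^esub> l)) \<longlonglongrightarrow> 0))"

context complex_seminormed_space begin

lemma smult_in [simp, intro]: "x \<in> carrier X \<Longrightarrow> c \<odot> x \<in> carrier X"
  using smult_closed[of c x] by simp

lemma smult_minus_one: "x \<in> carrier X \<Longrightarrow> (- 1) \<odot> x = \<ominus> x"
proof -
  assume x: "x \<in> carrier X"
  have "(- 1) \<odot> x \<oplus> 1 \<odot> x = (- 1 + 1) \<odot> x"
    using smult_l_distr[of "- 1" 1 x] x by simp
  then have "(- 1) \<odot> x \<oplus> x = \<zero>" using x smult_one[OF x] smult_l_null[OF x] by simp
  then show ?thesis using x by (intro M.minus_equality[symmetric]) auto
qed

lemma nrm_zero: "nrm X \<zero> = 0"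
  using nrm_smult[of \<zero> 0] smult_l_null[of \<zero>] by simp

lemma nrm_diff_triangle:
  assumes "x \<in> carrier X" "y \<in> carrier X" "z \<in> carrier X"
  shows "nrm X (x \<ominus> z) \<le> nrm X (x \<ominus> y) + nrm X (y \<ominus> z)"
proof -
  have "x \<ominus> z = (x \<ominus> y) \<oplus> (y \<ominus> z)"
    using assms by (simp add: M.minus_eq M.a_assoc M.r_neg1)
  then show ?thesis using assms nrm_triangle[of "x \<ominus> y" "y \<ominus> z"] by simp
qed

lemma banach_if_series_complete:
  assumes def: "\<And>x. x \<in> carrier X \<Longrightarrow> nrm X x = 0 \<Longrightarrow> x = \<zero>" and sc: "series_complete X"
  shows "complex_banach_space X"
proof (intro complex_banach_space.intro complex_normed_space.intro complex_normed_space_axioms.intro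
    complex_banach_space_axioms.intro)
  show "module complex_scalars X" by (rule module_axioms)
  fix s assume s: "\<And>n :: nat. s n \<in> carrier X"
    and cauchy: "\<And>e. e > 0 \<Longrightarrow> \<exists>N. \<forall>m\<ge>N. \<forall>n\<ge>N. nrm X (s m \<ominus> s n) < e"
  have "\<exists>N. \<forall>m\<ge>N. \<forall>n\<ge>N. nrm X (s m \<ominus> s n) < (1 / 2) ^ k" for k :: nat
    by (rule cauchy) simp
  then obtain N where N: "\<And>k m n. m \<ge> N k \<Longrightarrow> n \<ge> N k \<Longrightarrow> nrm X (s m \<ominus> s n) < (1 / 2) ^ k" by metis
  \<comment> \<open>Summing makes the index nondecreasing, so that \<open>r k\<close> and
    \<open>r (Suc k)\<close> both lie beyond \<open>N k\<close>.\<close>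
  define r where "r k = (\<Sum>i\<le>k. N i)" for k :: nat
  have r: "N k \<le> r k" for k unfolding r_def by (rule member_le_sum) auto
  have rS: "N k \<le> r (Suc k)" for k using r[of k] by (simp add: r_def)
  have "\<exists>l\<in>carrier X. (\<lambda>k. nrm X (s (r k) \<ominus> l)) \<longlonglongrightarrow> 0"
    by (rule sc[unfolded series_complete_def, rule_format, of "\<lambda>k. s (r k)"]) (rule s N[OF rS r])+
  then obtain l where l: "l \<in> carrier X" "(\<lambda>k. nrm X (s (r k) \<ominus> l)) \<longlonglongrightarrow> 0" by blast
  have "(\<lambda>n. nrm X (s n \<ominus> l)) \<longlonglongrightarrow> 0"
  proof (rule LIMSEQ_I)
    fix e :: real assume e: "e > 0"
    have "(\<lambda>k. nrm X (s (r k) \<ominus> l) + (1 / 2) ^ k) \<longlonglongrightarrow> 0 + 0"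
      by (intro tendsto_add l LIMSEQ_power_zero) simp
    then have "\<forall>\<^sub>F k in sequentially. nrm X (s (r k) \<ominus> l) + (1 / 2) ^ k < e"
      using e by (intro order_tendstoD) auto
    then obtain k where k: "nrm X (s (r k) \<ominus> l) + (1 / 2) ^ k < e"
      by (auto simp: eventually_sequentially)
    have "norm (nrm X (s n \<ominus> l) - 0) < e" if "n \<ge> N k" for n
      using nrm_diff_triangle[OF s s l(1), of n "r k"] N[OF that r] k nrm_nonneg[of "s n \<ominus> l"] s l(1) by simp
    then show "\<exists>N. \<forall>n\<ge>N. norm (nrm X (s n \<ominus> l) - 0) < e" by blast
  qed
  then show "\<exists>l\<in>carrier X. (\<lambda>n. nrm X (s n \<ominus> l)) \<longlonglongrightarrow> 0" using l(1) by blast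
next
  fix x assume "x \<in> carrier X"
  then show "nrm X x = 0 \<longleftrightarrow> x = \<zero>" using def[of x] nrm_zero by blast
qed (fact nrm_nonneg nrm_triangle nrm_smult)+

end

locale seminormed_quotient = complex_seminormed_space +
  fixes Y
  assumes submodule: "submodule Y complex_scalars X"
begin

abbreviation "Q \<equiv> quotient_space X Y"

sublocale abelian_subgroup Y X
  by (rule abelian_subgroupI3[OF additive_subgroup.intro[OF submodule.axioms(1)[OF submodule]] M.abelian_group_axioms])

lemma carrier_quotient: "carrier Q = (\<lambda>x. Y +> x) ` carrier X"
  by (auto simp: quotient_space_def A_RCOSETS_def')

lemma smult_sub: "x \<in> Y \<Longrightarrow> c \<odot> x \<in> Y"
  using submodule.smult_closed[OF submodule, of c x] by simp

lemma quotient_add: "x \<in> carrier X \<Longrightarrow> y \<in> carrier X \<Longrightarrow> (Y +> x) \<oplus>\<^bsub>Q\<^esub> (Y +> y) = Y +> (x \<oplus> y)"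
  by (simp add: quotient_space_def a_rcos_sum)

lemma mem_coset: "y \<in> Y +> x \<longleftrightarrow> (\<exists>h\<in>Y. y = h \<oplus> x)"
  by (auto simp: a_r_coset_def')

lemma coset_absorb: "x \<in> carrier X \<Longrightarrow> h \<in> Y \<Longrightarrow> Y +> (h \<oplus> x) = Y +> x"
proof -
  assume x: "x \<in> carrier X" and "h \<in> Y"
  then have "h \<oplus> x \<in> Y +> x" unfolding mem_coset by blast
  from a_repr_independence'[OF this x] show ?thesis by (rule sym)
qed

lemma quotient_smult: "x \<in> carrier X \<Longrightarrow> c \<odot>\<^bsub>Q\<^esub> (Y +> x) = Y +> (c \<odot> x)"
proof -
  assume x: "x \<in> carrier X"
  have "Y +> (c \<odot> a) = Y +> (c \<odot> x)" if a: "a \<in> Y +> x" for a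
  proof -
    obtain h where h: "h \<in> Y" "a = h \<oplus> x" using a unfolding mem_coset by blast
    then have "c \<odot> a = c \<odot> h \<oplus> c \<odot> x" using x smult_r_distr[of c h x] by simp
    then show ?thesis using coset_absorb[OF smult_in[OF x] smult_sub[OF h(1)], of c c] by simp
  qed
  moreover have "Y +> x \<noteq> {}" using a_rcos_self[OF x] by blast
  ultimately have "(\<Union>a\<in>Y +> x. Y +> (c \<odot> a)) = Y +> (c \<odot> x)"
    by (intro SUP_eq_const)
  then show ?thesis by (simp add: quotient_space_def)
qed

lemma quotient_zero: "\<zero>\<^bsub>Q\<^esub> = Y +> \<zero>"
  unfolding a_coset_add_zero[OF a_subset] by (simp add: quotient_space_def)

lemma quotient_nrm: "nrm Q (Y +> x) = (INF h\<in>Y. nrm X (h \<oplus> x))"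
proof -
  have "Y +> x = (\<lambda>h. h \<oplus> x) ` Y" by (auto simp: mem_coset)
  then show ?thesis by (simp add: quotient_space_def image_image)
qed

lemma quotient_nrm_le: "x \<in> carrier X \<Longrightarrow> h \<in> Y \<Longrightarrow> nrm Q (Y +> x) \<le> nrm X (h \<oplus> x)"
  unfolding quotient_nrm by (intro cINF_lower bdd_belowI2[where m=0]) (auto intro: nrm_nonneg)

lemma quotient_nrm_le_self: "x \<in> carrier X \<Longrightarrow> nrm Q (Y +> x) \<le> nrm X x"
  using quotient_nrm_le[of x \<zero>] by simp

lemma quotient_nrm_less:
  assumes "nrm Q (Y +> x) < e"
  obtains h where "h \<in> Y" "nrm X (h \<oplus> x) < e"
proof -
  have "Y \<noteq> {}" using zero_closed by blast
  then show ?thesis using that cInf_lessD[of "(\<lambda>h. nrm X (h \<oplus> x)) ` Y" e] assms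
    unfolding quotient_nrm by blast
qed

lemma quotient_nrm_nonneg: "x \<in> carrier X \<Longrightarrow> 0 \<le> nrm Q (Y +> x)"
proof -
  assume x: "x \<in> carrier X"
  have "Y \<noteq> {}" using zero_closed by blast
  then show ?thesis unfolding quotient_nrm using x by (intro cINF_greatest) (auto intro: nrm_nonneg)
qed

lemma quotient_smult_le:
  assumes x: "x \<in> carrier X"
  shows "nrm Q (Y +> (c \<odot> x)) \<le> cmod c * nrm Q (Y +> x)"
proof (rule field_le_epsilon)
  fix e :: real assume "e > 0"
  define k where "k = cmod c"
  have k: "k \<ge> 0" by (simp add: k_def)
  have "nrm Q (Y +> x) < nrm Q (Y +> x) + e / (k + 1)" using k \<open>e > 0\<close> by simp
  then obtain h where h: "h \<in> Y" "nrm X (h \<oplus> x) < nrm Q (Y +> x) + e / (k + 1)"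
    by (rule quotient_nrm_less)
  have "nrm Q (Y +> (c \<odot> x)) \<le> nrm X (c \<odot> h \<oplus> c \<odot> x)"
    using x h by (intro quotient_nrm_le) (auto intro: smult_sub)
  also have "c \<odot> h \<oplus> c \<odot> x = c \<odot> (h \<oplus> x)" using x h by (simp add: smult_r_distr)
  also have "nrm X (c \<odot> (h \<oplus> x)) = k * nrm X (h \<oplus> x)" using x h by (simp add: nrm_smult k_def)
  also have "\<dots> \<le> k * (nrm Q (Y +> x) + e / (k + 1))" using h k by (intro mult_left_mono) auto
  also have "\<dots> \<le> k * nrm Q (Y +> x) + e" using k \<open>e > 0\<close> by (simp add: field_simps)
  finally show "nrm Q (Y +> (c \<odot> x)) \<le> cmod c * nrm Q (Y +> x) + e" by (simp add: k_def)
qed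

lemma quotient_seminormed: "complex_seminormed_space Q"
proof (rule complex_seminormed_spaceI)
  have cl: "Y +> x \<in> carrier Q" if "x \<in> carrier X" for x using that by (auto simp: carrier_quotient)
  show "abelian_group Q"
  proof (rule abelian_groupI)
    fix A assume "A \<in> carrier Q"
    then obtain x where x: "x \<in> carrier X" "A = Y +> x" by (auto simp: carrier_quotient)
    then have "(Y +> (\<ominus> x)) \<oplus>\<^bsub>Q\<^esub> A = \<zero>\<^bsub>Q\<^esub>" by (simp add: quotient_add quotient_zero M.l_neg)
    then show "\<exists>B\<in>carrier Q. B \<oplus>\<^bsub>Q\<^esub> A = \<zero>\<^bsub>Q\<^esub>" using cl[of "\<ominus> x"] x by blast
  qed (auto simp: carrier_quotient quotient_add quotient_zero M.a_ac)
next
  fix A B assume "A \<in> carrier Q" "B \<in> carrier Q"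
  then obtain x y where x: "x \<in> carrier X" "A = Y +> x" and y: "y \<in> carrier X" "B = Y +> y"
    by (auto simp: carrier_quotient)
  show "nrm Q (A \<oplus>\<^bsub>Q\<^esub> B) \<le> nrm Q A + nrm Q B"
  proof (rule field_le_epsilon)
    fix e :: real assume "e > 0"
    then have "nrm Q A < nrm Q A + e / 2" "nrm Q B < nrm Q B + e / 2" by auto
    then obtain h k where h: "h \<in> Y" "nrm X (h \<oplus> x) < nrm Q A + e / 2"
      and k: "k \<in> Y" "nrm X (k \<oplus> y) < nrm Q B + e / 2"
      unfolding x y by (metis quotient_nrm_less)
    have "nrm Q (A \<oplus>\<^bsub>Q\<^esub> B) \<le> nrm X ((h \<oplus> k) \<oplus> (x \<oplus> y))"
      unfolding x y using x y h k by (subst quotient_add) (auto intro: quotient_nrm_le)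
    also have "(h \<oplus> k) \<oplus> (x \<oplus> y) = (h \<oplus> x) \<oplus> (k \<oplus> y)"
      using x y h k by (simp add: M.a_ac)
    also have "nrm X \<dots> \<le> nrm X (h \<oplus> x) + nrm X (k \<oplus> y)"
      using x y h k by (intro nrm_triangle) auto
    finally show "nrm Q (A \<oplus>\<^bsub>Q\<^esub> B) \<le> nrm Q A + nrm Q B + e" using h k by simp
  qed
next
  fix c A assume "A \<in> carrier Q"
  then obtain x where x: "x \<in> carrier X" "A = Y +> x" by (auto simp: carrier_quotient)
  show "nrm Q (c \<odot>\<^bsub>Q\<^esub> A) = cmod c * nrm Q A"
  proof (cases "c = 0")
    case True
    then show ?thesis
      using x quotient_smult_le[OF x(1), of 0] quotient_nrm_nonneg[of "0 \<odot> x"]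
      by (simp add: quotient_smult)
  next
    case False
    have "nrm Q (Y +> x) = nrm Q (Y +> ((1 / c) \<odot> (c \<odot> x)))"
      using smult_assoc1[of "1 / c" c x] x False smult_one[OF x(1)] by simp
    also have "\<dots> \<le> cmod (1 / c) * nrm Q (Y +> (c \<odot> x))" using x by (intro quotient_smult_le) auto
    finally have "cmod c * nrm Q (Y +> x) \<le> nrm Q (Y +> (c \<odot> x))"
      using False by (simp add: norm_divide field_simps)
    then show ?thesis using x quotient_smult_le[OF x(1), of c] by (simp add: quotient_smult)
  qed
next
  fix c A assume "A \<in> carrier Q"
  then obtain x where x: "x \<in> carrier X" "A = Y +> x" by (auto simp: carrier_quotient)
  show "c \<odot>\<^bsub>Q\<^esub> A \<in> carrier Q" using x by (simp add: quotient_smult carrier_quotient)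
  show "1 \<odot>\<^bsub>Q\<^esub> A = A" using x smult_one[OF x(1)] by (simp add: quotient_smult)
  show "0 \<le> nrm Q A" using x by (simp add: quotient_nrm_nonneg)
  fix d
  show "(c + d) \<odot>\<^bsub>Q\<^esub> A = c \<odot>\<^bsub>Q\<^esub> A \<oplus>\<^bsub>Q\<^esub> d \<odot>\<^bsub>Q\<^esub> A"
    using x smult_l_distr[of c d x] by (simp add: quotient_smult quotient_add)
  show "(c * d) \<odot>\<^bsub>Q\<^esub> A = c \<odot>\<^bsub>Q\<^esub> (d \<odot>\<^bsub>Q\<^esub> A)"
    using x smult_assoc1[of c d x] by (simp add: quotient_smult)
next
  fix c A B assume "A \<in> carrier Q" "B \<in> carrier Q"
  then obtain x y where x: "x \<in> carrier X" "A = Y +> x" and y: "y \<in> carrier X" "B = Y +> y"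
    by (auto simp: carrier_quotient)
  show "c \<odot>\<^bsub>Q\<^esub> (A \<oplus>\<^bsub>Q\<^esub> B) = c \<odot>\<^bsub>Q\<^esub> A \<oplus>\<^bsub>Q\<^esub> c \<odot>\<^bsub>Q\<^esub> B"
    using x y smult_r_distr[of c x y] by (simp add: quotient_smult quotient_add)
qed

lemma quotient_minus:
  assumes "x \<in> carrier X"
  shows "\<ominus>\<^bsub>Q\<^esub> (Y +> x) = Y +> (\<ominus> x)"
proof -
  interpret Q: complex_seminormed_space Q by (rule quotient_seminormed)
  show ?thesis
    using assms Q.smult_minus_one[of "Y +> x"] smult_minus_one[of x]
    by (simp add: carrier_quotient quotient_smult)
qed

lemma quotient_diff:
  assumes "x \<in> carrier X" "y \<in> carrier X"
  shows "(Y +> x) \<ominus>\<^bsub>Q\<^esub> (Y +> y) = Y +> (x \<ominus> y)"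
proof -
  have "(Y +> x) \<ominus>\<^bsub>Q\<^esub> (Y +> y) = (Y +> x) \<oplus>\<^bsub>Q\<^esub> (\<ominus>\<^bsub>Q\<^esub> (Y +> y))" by (simp add: a_minus_def)
  then show ?thesis using assms by (simp add: quotient_minus quotient_add M.minus_eq)
qed

text \<open>Representatives are chosen recursively: each new one is corrected by an element of
  \<open>Y\<close> so that its distance to the previous one is as small as the bound in the
  quotient.\<close>

lemma quotient_series_complete:
  assumes sc: "series_complete X"
  shows "series_complete Q"
  unfolding series_complete_def
proof (intro allI impI)
  fix S assume S: "\<forall>k. S k \<in> carrier Q" and fast: "\<forall>k. nrm Q (S (Suc k) \<ominus>\<^bsub>Q\<^esub> S k) < (1 / 2) ^ k"
  have "\<exists>s. \<forall>k. (s k \<in> carrier X \<and> Y +> s k = S k) \<and> nrm X (s (Suc k) \<ominus> s k) < (1 / 2) ^ k"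
  proof (rule dependent_nat_choice)
    show "\<exists>x. x \<in> carrier X \<and> Y +> x = S 0" using S[rule_format, of 0] by (auto simp: carrier_quotient)
  next
    fix x k assume x: "x \<in> carrier X \<and> Y +> x = S k"
    obtain y0 where y0: "y0 \<in> carrier X" "Y +> y0 = S (Suc k)"
      using S[rule_format, of "Suc k"] by (auto simp: carrier_quotient)
    have "nrm Q (Y +> (y0 \<ominus> x)) < (1 / 2) ^ k"
      using fast[rule_format, of k] quotient_diff[of y0 x] x y0 by simp
    then obtain h where h: "h \<in> Y" "nrm X (h \<oplus> (y0 \<ominus> x)) < (1 / 2) ^ k" by (rule quotient_nrm_less)
    have "h \<oplus> (y0 \<ominus> x) = (h \<oplus> y0) \<ominus> x" using h x y0 by (simp add: M.minus_eq M.a_assoc)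
    then show "\<exists>y. (y \<in> carrier X \<and> Y +> y = S (Suc k)) \<and> nrm X (y \<ominus> x) < (1 / 2) ^ k"
      using h y0 coset_absorb[of y0 h] by (intro exI[of _ "h \<oplus> y0"]) auto
  qed
  then obtain s where s: "\<And>k. s k \<in> carrier X" "\<And>k. Y +> s k = S k"
    "\<And>k. nrm X (s (Suc k) \<ominus> s k) < (1 / 2) ^ k" by blast
  then obtain l where l: "l \<in> carrier X" "(\<lambda>k. nrm X (s k \<ominus> l)) \<longlonglongrightarrow> 0"
    using sc[unfolded series_complete_def, rule_format, of s] by blast
  have "(\<lambda>k. nrm Q (S k \<ominus>\<^bsub>Q\<^esub> (Y +> l))) \<longlonglongrightarrow> 0"
  proof (rule tendsto_sandwich[OF _ _ tendsto_const l(2)])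
    have eq: "S k \<ominus>\<^bsub>Q\<^esub> (Y +> l) = Y +> (s k \<ominus> l)" for k
      using quotient_diff[of "s k" l] s l by simp
    show "\<forall>\<^sub>F k in sequentially. 0 \<le> nrm Q (S k \<ominus>\<^bsub>Q\<^esub> (Y +> l))"
      unfolding eq using s l by (intro always_eventually allI quotient_nrm_nonneg) auto
    show "\<forall>\<^sub>F k in sequentially. nrm Q (S k \<ominus>\<^bsub>Q\<^esub> (Y +> l)) \<le> nrm X (s k \<ominus> l)"
      unfolding eq using s l by (intro always_eventually allI quotient_nrm_le_self) auto
  qed
  then show "\<exists>L\<in>carrier Q. (\<lambda>k. nrm Q (S k \<ominus>\<^bsub>Q\<^esub> L)) \<longlonglongrightarrow> 0"
    using l(1) by (intro bexI[of _ "Y +> l"]) (auto simp: carrier_quotient)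
qed

end

section \<open>The Daugavet property\<close>

context haar_group begin

text \<open>\<open>rich_piece\<close> works with L1 norms, a real functional and a continuous
  \<open>v\<close>. The class is therefore first represented almost optimally and rotated so that
  \<open>\<phi>\<close> is positive on it, and \<open>u\<close> is replaced by a nearby
  \<open>v\<close>; the resulting \<open>h\<close> is then tested against \<open>u\<close>
  again.\<close>

lemma daugavet_estimate:
  fixes \<phi> :: "('g \<Rightarrow> complex) \<Rightarrow> complex"
  assumes \<Lambda>: "\<Lambda> \<subseteq> dual_group" and rich: "rich_annihilator \<Lambda>"
    and add: "\<And>f g. integrable m f \<Longrightarrow> integrable m g \<Longrightarrow> \<phi> (\<lambda>x. f x + g x) = \<phi> f + \<phi> g"
    and scale: "\<And>c f. integrable m f \<Longrightarrow> \<phi> (\<lambda>x. c * f x) = c * \<phi> f"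
    and bound: "\<And>f. integrable m f \<Longrightarrow> cmod (\<phi> f) \<le> \<tau> * dist_L1 \<Lambda> f"
    and sup: "\<And>\<delta>. \<delta> > 0 \<Longrightarrow> \<exists>f. integrable m f \<and> dist_L1 \<Lambda> f \<le> 1 \<and> cmod (\<phi> f) > \<tau> - \<delta>"
    and \<tau>: "\<tau> > 0" and u: "integrable m u" "dist_L1 \<Lambda> u = 1" and \<eta>: "\<eta> > 0"
  shows "\<exists>f. integrable m f \<and> dist_L1 \<Lambda> f \<le> 1 \<and> dist_L1 \<Lambda> (\<lambda>x. f x + \<phi> f * u x) \<ge> 1 + \<tau> - \<eta>"
proof -
  \<comment> \<open>The bound with \<open>2 + 5 * \<tau>\<close> keeps the linear losses below
    \<open>\<eta> / 2\<close>, and the one with \<open>\<eta>\<^sup>2\<close> gives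
    \<open>\<kappa> \<le> \<eta> / 4\<close>; \<open>\<epsilon> < \<tau>\<close> makes
    \<open>\<alpha>\<close> positive.\<close>
  define \<epsilon> where "\<epsilon> = min (min (1 / 2) (\<tau> / 2)) (min (\<eta> / (2 * (2 + 5 * \<tau>))) (\<eta>\<^sup>2 / (32 * \<tau> * (1 + \<tau>))))"
  have \<epsilon>_half: "\<epsilon> \<le> 1 / 2" unfolding \<epsilon>_def min_le_iff_disj by simp
  have \<epsilon>: "\<epsilon> > 0" "\<epsilon> \<le> 1 / 2" "\<epsilon> < \<tau>" using \<tau> \<eta> \<epsilon>_half by (auto simp: \<epsilon>_def)
  have "\<epsilon> \<le> \<eta> / (2 * (2 + 5 * \<tau>))" by (simp add: \<epsilon>_def)
  then have \<epsilon>1: "\<epsilon> * (2 + 5 * \<tau>) \<le> \<eta> / 2" using \<tau> by (simp add: field_simps)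
  have "\<epsilon> \<le> \<eta>\<^sup>2 / (32 * \<tau> * (1 + \<tau>))" by (simp add: \<epsilon>_def)
  then have "\<epsilon> * (32 * \<tau> * (1 + \<tau>)) \<le> \<eta>\<^sup>2" using \<tau> by (simp add: pos_le_divide_eq)
  then have \<epsilon>2: "2 * \<tau> * (\<epsilon> * (1 + \<tau>)) \<le> (\<eta> / 4)\<^sup>2" by (simp add: power_divide algebra_simps)
  obtain f' where f': "integrable m f'" "dist_L1 \<Lambda> f' \<le> 1" "cmod (\<phi> f') > \<tau> - \<epsilon>"
    using sup[OF \<epsilon>(1)] by blast
  \<comment> \<open>Adding a spectral function brings the L1 norm close to the distance and leaves
    \<open>\<phi>\<close> unchanged, since \<open>\<phi>\<close> is dominated by
    \<open>dist_L1\<close>.\<close>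
  obtain g where g: "g \<in> spectral_L1 \<Lambda>" "(LINT x|m. cmod (f' x + g x)) < dist_L1 \<Lambda> f' + \<epsilon>"
    using dist_L1_approx[OF \<epsilon>(1)] by blast
  have gi: "integrable m g" using g(1) by (rule spectral_integrable)
  have "\<phi> g = 0" using bound[OF gi] dist_L1_spectral[OF g(1)] by simp
  define f2 where "f2 = (\<lambda>x. f' x + g x)"
  have f2: "integrable m f2" "(LINT x|m. cmod (f2 x)) < 1 + \<epsilon>" "\<phi> f2 = \<phi> f'"
    using f' gi g(2) add[OF f'(1) gi] \<open>\<phi> g = 0\<close> by (auto simp: f2_def)
  have nz: "cmod (\<phi> f2) > 0" using f'(3) \<epsilon>(3) unfolding f2(3) by linarith
  define \<omega> where "\<omega> = cnj (\<phi> f2) / complex_of_real (cmod (\<phi> f2))"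
  have \<omega>: "cmod \<omega> = 1" using nz by (simp add: \<omega>_def norm_divide)
  have \<omega>\<phi>: "\<omega> * \<phi> f2 = complex_of_real (cmod (\<phi> f2))"
    using nz complex_norm_square[of "\<phi> f2"] by (simp add: \<omega>_def field_simps power2_eq_square)
  define f0 where "f0 = (\<lambda>x. \<omega> * f2 x)"
  have f0i: "integrable m f0" unfolding f0_def using f2(1) by simp
  have f0n: "(LINT x|m. cmod (f0 x)) < 1 + \<epsilon>" using f2(2) \<omega> by (simp add: f0_def norm_mult)
  have f0\<phi>: "\<phi> f0 = complex_of_real (cmod (\<phi> f2))" unfolding f0_def scale[OF f2(1)] \<omega>\<phi> ..
  have bound1: "cmod (\<phi> f) \<le> \<tau> * (LINT x|m. cmod (f x))" if "integrable m f" for f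
    using bound[OF that] dist_L1_le_norm[of \<Lambda> f] \<tau> by (meson less_imp_le mult_left_mono order_trans)
  have f0p: "0 < (LINT x|m. cmod (f0 x))"
  proof (rule ccontr)
    assume "\<not> ?thesis"
    then have "(LINT x|m. cmod (f0 x)) \<le> 0" by simp
    then have "\<tau> * (LINT x|m. cmod (f0 x)) \<le> 0" using \<tau> by (simp add: mult_le_0_iff)
    then show False using bound1[OF f0i] f0\<phi> nz by simp
  qed
  \<comment> \<open>The ratio guaranteed for \<open>f0\<close>, where \<open>\<phi>\<close> exceeds
    \<open>\<tau> - \<epsilon>\<close> and the norm is below \<open>1 + \<epsilon>\<close>.\<close>
  define \<alpha> where "\<alpha> = (\<tau> - \<epsilon>) / (1 + \<epsilon>)"
  have \<alpha>: "\<alpha> > 0" "\<alpha> * (1 + \<epsilon>) = \<tau> - \<epsilon>" using \<epsilon> by (auto simp: \<alpha>_def)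
  have \<alpha>f0: "\<alpha> * (LINT x|m. cmod (f0 x)) \<le> Re (\<phi> f0)"
  proof -
    have "\<alpha> * (LINT x|m. cmod (f0 x)) \<le> \<alpha> * (1 + \<epsilon>)" using f0n \<alpha>(1) by (intro mult_left_mono) auto
    then show ?thesis using \<alpha>(2) f0\<phi> f2(3) f'(3) by simp
  qed
  obtain v where v: "continuous_everywhere v" "(LINT x|m. cmod (u x - v x)) < \<epsilon>"
    using continuous_dense_L1[OF u(1) \<epsilon>(1)] by blast
  have vi: "integrable m v" by (rule integrable_continuous[OF v(1)])
  have dv: "dist_L1 \<Lambda> v \<ge> 1 - \<epsilon>"
  proof -
    have "dist_L1 \<Lambda> (\<lambda>x. v x + (u x - v x)) \<le> dist_L1 \<Lambda> v + dist_L1 \<Lambda> (\<lambda>x. u x - v x)"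
      using vi u(1) by (intro dist_L1_triangle) auto
    then show ?thesis using u(2) v(2) dist_L1_le_norm[of \<Lambda> "\<lambda>x. u x - v x"] by simp
  qed
  have "\<exists>f h. integrable m f \<and> 0 < (LINT x|m. cmod (f x)) \<and> \<alpha> * (LINT x|m. cmod (f x)) \<le> Re (\<phi> f) \<and>
    h \<in> annihilator \<Lambda> \<and> (\<forall>x. cmod (h x) \<le> 1 + \<epsilon>) \<and> Re (LINT x|m. v x * h x) \<ge> dist_L1 \<Lambda> v - \<epsilon> \<and>
    Re (LINT x|m. f x * h x) \<ge> (1 - \<epsilon>) * (LINT x|m. cmod (f x))"
  proof (rule rich_piece[OF \<Lambda> rich, where K=\<tau>])
    show "Re (\<phi> f) \<le> \<tau> * (LINT x|m. cmod (f x))" if "integrable m f" for f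
      using bound1[OF that] complex_Re_le_cmod[of "\<phi> f"] by simp
  qed (use add f0i f0p \<alpha>f0 v(1) dv \<epsilon> in auto)
  then obtain f h where f: "integrable m f" "0 < (LINT x|m. cmod (f x))" "\<alpha> * (LINT x|m. cmod (f x)) \<le> Re (\<phi> f)"
    and h: "h \<in> annihilator \<Lambda>" "\<And>x. cmod (h x) \<le> 1 + \<epsilon>"
    and vh: "Re (LINT x|m. v x * h x) \<ge> dist_L1 \<Lambda> v - \<epsilon>"
    and fh: "Re (LINT x|m. f x * h x) \<ge> (1 - \<epsilon>) * (LINT x|m. cmod (f x))" by blast
  have hc: "continuous_everywhere h" using h(1) by (simp add: annihilator_def)
  define n where "n = (LINT x|m. cmod (f x))"
  have n: "n > 0" using f(2) by (simp add: n_def)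
  \<comment> \<open>The piece may have tiny norm; every estimate obtained for it is proportional to
    that norm, so it can be rescaled to 1.\<close>
  define f3 where "f3 = (\<lambda>x. complex_of_real (1 / n) * f x)"
  have f3i: "integrable m f3" unfolding f3_def using f(1) by simp
  have "cmod (f3 x) = (1 / n) * cmod (f x)" for x using n by (simp add: f3_def norm_mult norm_divide)
  then have f3n: "(LINT x|m. cmod (f3 x)) = 1" using n by (simp add: n_def[symmetric])
  have f3d: "dist_L1 \<Lambda> f3 \<le> 1" using dist_L1_le_norm[of \<Lambda> f3] f3n by simp
  have "\<phi> f3 = complex_of_real (1 / n) * \<phi> f" unfolding f3_def by (rule scale[OF f(1)])
  then have "Re (\<phi> f3) = Re (\<phi> f) / n" by simp
  then have f3\<alpha>: "Re (\<phi> f3) \<ge> \<alpha>" using f(3) n by (simp add: n_def[symmetric] pos_le_divide_eq)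
  have "(LINT x|m. f3 x * h x) = complex_of_real (1 / n) * (LINT x|m. f x * h x)"
    by (simp add: f3_def mult.assoc)
  then have "Re (LINT x|m. f3 x * h x) = Re (LINT x|m. f x * h x) / n" by simp
  then have f3h: "Re (LINT x|m. f3 x * h x) \<ge> 1 - \<epsilon>"
    using fh n by (simp add: n_def[symmetric] pos_le_divide_eq)
  define c where "c = \<phi> f3"
  have c\<tau>: "cmod c \<le> \<tau>" using bound1[OF f3i] f3n by (simp add: c_def)
  \<comment> \<open>A number of modulus at most \<open>\<tau>\<close> with real part at least
    \<open>\<alpha>\<close> is close to \<open>\<tau>\<close>: the square of the distance is at most
    \<open>2 * \<tau> * (\<tau> - \<alpha>)\<close>.\<close>
  define \<kappa> where "\<kappa> = cmod (c - complex_of_real \<tau>)"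
  have "\<kappa>\<^sup>2 \<le> (\<eta> / 4)\<^sup>2"
  proof -
    have "\<kappa>\<^sup>2 = (cmod c)\<^sup>2 - 2 * \<tau> * Re c + \<tau>\<^sup>2"
      unfolding \<kappa>_def cmod_power2 by (simp add: power2_eq_square algebra_simps)
    also have "\<dots> \<le> \<tau>\<^sup>2 - 2 * \<tau> * \<alpha> + \<tau>\<^sup>2"
      using c\<tau> f3\<alpha> \<tau> by (intro add_mono diff_mono power_mono mult_left_mono) (auto simp: c_def)
    also have "\<dots> = 2 * \<tau> * (\<tau> - \<alpha>)" by (simp add: power2_eq_square algebra_simps)
    also have "\<tau> - \<alpha> \<le> \<epsilon> * (1 + \<tau>)"
    proof -
      have "\<alpha> \<le> \<tau>" using \<alpha> \<epsilon> \<tau> by (simp add: \<alpha>_def field_simps)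
      then have "\<alpha> * \<epsilon> \<le> \<tau> * \<epsilon>" using \<epsilon> by (intro mult_right_mono) auto
      then show ?thesis using \<alpha>(2) by (simp add: algebra_simps)
    qed
    finally show ?thesis using \<epsilon>2 \<tau> by (simp add: mult_left_mono)
  qed
  then have \<kappa>: "\<kappa> \<le> \<eta> / 4" using \<eta> by (intro power2_le_imp_le[of \<kappa> "\<eta> / 4"]) auto
  define J where "J = (LINT x|m. u x * h x)"
  have J1: "cmod J \<le> 1 + \<epsilon>"
    using integral_annihilator_bound[OF \<Lambda> u(1) h] u(2) by (simp add: J_def)
  have J2: "Re J \<ge> 1 - 4 * \<epsilon>"
  proof -
    have eq: "J = (LINT x|m. v x * h x) + (LINT x|m. (u x - v x) * h x)"
      unfolding J_def using integrable_mult_continuous[OF u(1) hc] integrable_mult_continuous[OF vi hc]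
      by (simp add: left_diff_distrib)
    have "cmod (LINT x|m. (u x - v x) * h x) \<le> (1 + \<epsilon>) * (LINT x|m. cmod (u x - v x))"
      using u(1) vi h(2) continuous_imp_measurable[OF hc] by (intro integral_cmod_bound) auto
    also have "\<dots> \<le> (1 + \<epsilon>) * \<epsilon>" using v(2) \<epsilon> by (intro mult_left_mono) auto
    also have "\<dots> \<le> 2 * \<epsilon>" using \<epsilon> by (intro mult_right_mono) auto
    finally have "Re (LINT x|m. (u x - v x) * h x) \<ge> - 2 * \<epsilon>"
      using abs_Re_le_cmod[of "LINT x|m. (u x - v x) * h x"] by simp
    then show ?thesis using eq vh dv by simp
  qed
  define D where "D = dist_L1 \<Lambda> (\<lambda>x. f3 x + c * u x)"
  have ci: "integrable m (\<lambda>x. f3 x + c * u x)" using f3i u(1) by simp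
  have "(LINT x|m. (f3 x + c * u x) * h x) = (LINT x|m. f3 x * h x) + c * J"
    unfolding J_def using integrable_mult_continuous[OF u(1) hc] integrable_mult_continuous[OF f3i hc]
    by (simp add: distrib_right mult.assoc)
  then have "Re ((LINT x|m. f3 x * h x) + c * J) \<le> (1 + \<epsilon>) * D"
    using integral_annihilator_bound[OF \<Lambda> ci h] complex_Re_le_cmod[of "LINT x|m. (f3 x + c * u x) * h x"]
    by (simp add: D_def)
  moreover have "Re (c * J) \<ge> \<tau> * (1 - 4 * \<epsilon>) - 2 * \<kappa>"
  proof -
    have "c * J = complex_of_real \<tau> * J + (c - complex_of_real \<tau>) * J" by (simp add: algebra_simps)
    moreover have "cmod ((c - complex_of_real \<tau>) * J) \<le> \<kappa> * 2"
      unfolding norm_mult \<kappa>_def[symmetric] using J1 \<epsilon> by (intro mult_left_mono) (auto simp: \<kappa>_def)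
    moreover have "\<tau> * Re J \<ge> \<tau> * (1 - 4 * \<epsilon>)" using J2 \<tau> by (intro mult_left_mono) auto
    ultimately show ?thesis
      using abs_Re_le_cmod[of "(c - complex_of_real \<tau>) * J"] by simp
  qed
  ultimately have low: "1 - \<epsilon> + \<tau> * (1 - 4 * \<epsilon>) - 2 * \<kappa> \<le> (1 + \<epsilon>) * D" using f3h by simp
  have "D \<ge> 1 + \<tau> - \<eta>"
  proof (rule ccontr)
    assume "\<not> ?thesis"
    then have "(1 + \<epsilon>) * D < (1 + \<epsilon>) * (1 + \<tau> - \<eta>)"
      using \<epsilon> by (intro mult_strict_left_mono) auto
    also have "(1 + \<epsilon>) * (1 + \<tau> - \<eta>) = (1 + \<tau> - \<eta>) + \<epsilon> * (1 + \<tau>) - \<epsilon> * \<eta>"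
      by (simp add: algebra_simps)
    finally have "(1 + \<epsilon>) * D < (1 + \<tau> - \<eta>) + \<epsilon> * (1 + \<tau>) - \<epsilon> * \<eta>" .
    moreover have "0 \<le> \<epsilon> * \<eta>" using \<epsilon> \<eta> by simp
    moreover have "\<epsilon> * (1 + \<tau>) + \<epsilon> + 4 * (\<tau> * \<epsilon>) \<le> \<eta> / 2" using \<epsilon>1 by (simp add: algebra_simps)
    moreover have "1 - \<epsilon> + (\<tau> - 4 * (\<tau> * \<epsilon>)) - 2 * \<kappa> \<le> (1 + \<epsilon>) * D" using low by (simp add: algebra_simps)
    \<comment> \<open>The products are abstracted to variables, which leaves a linear
      problem.\<close>
    moreover have False
      if "P < (1 + \<tau> - \<eta>) + R - Y" "0 \<le> Y" "R + \<epsilon> + 4 * X \<le> \<eta> / 2"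
        "1 - \<epsilon> + (\<tau> - 4 * X) - 2 * \<kappa> \<le> P" for P R X Y
      using that \<kappa> by linarith
    ultimately show False by blast
  qed
  then show ?thesis using f3i f3d by (intro exI[of _ f3]) (auto simp: D_def c_def)
qed

end

section \<open>The concrete spaces of continuous and of integrable functions\<close>

lemma continuous_functions_simps [simp]:
  "carrier continuous_functions = {f. continuous_everywhere f}"
  "f \<oplus>\<^bsub>continuous_functions\<^esub> g = (\<lambda>x. f x + g x)"
  "c \<odot>\<^bsub>continuous_functions\<^esub> f = (\<lambda>x. c * f x)"
  "\<zero>\<^bsub>continuous_functions\<^esub> = (\<lambda>_. 0)"
  "nrm continuous_functions f = (SUP x. cmod (f x))"
  by (simp_all add: continuous_functions_def)

lemma continuous_functions_minus:
  fixes f g :: "'g::topological_ab_group_add \<Rightarrow> complex"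
  assumes "continuous_everywhere f" "continuous_everywhere g"
  shows "f \<ominus>\<^bsub>continuous_functions\<^esub> g = (\<lambda>x. f x - g x)"
proof -
  have "abelian_group (continuous_functions :: ('g \<Rightarrow> complex) normed_module)"
  proof (rule abelian_groupI)
    fix f :: "'g \<Rightarrow> complex" assume "f \<in> carrier continuous_functions"
    then show "\<exists>g\<in>carrier continuous_functions. g \<oplus>\<^bsub>continuous_functions\<^esub> f = \<zero>\<^bsub>continuous_functions\<^esub>"
      by (intro bexI[of _ "\<lambda>x. - f x"]) (auto intro: continuous_intros)
  qed (auto simp: add_ac intro: continuous_intros)
  then interpret abelian_group "continuous_functions :: ('g \<Rightarrow> complex) normed_module" .
  have "\<ominus>\<^bsub>continuous_functions\<^esub> g = (\<lambda>x. - g x)"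
    by (rule minus_equality) (use assms in \<open>auto intro: continuous_intros\<close>)
  then show ?thesis by (simp add: a_minus_def)
qed

lemma integrable_functions_simps [simp]:
  "carrier (integrable_functions m) = {f. integrable m f}"
  "f \<oplus>\<^bsub>integrable_functions m\<^esub> g = (\<lambda>x. f x + g x)"
  "c \<odot>\<^bsub>integrable_functions m\<^esub> f = (\<lambda>x. c * f x)"
  "\<zero>\<^bsub>integrable_functions m\<^esub> = (\<lambda>_. 0)"
  "nrm (integrable_functions m) f = (LINT x|m. cmod (f x))"
  by (simp_all add: integrable_functions_def)

context haar_group begin

lemma sup_norm:
  fixes f :: "'g \<Rightarrow> complex"
  assumes "continuous_everywhere f"
  shows "cmod (f x) \<le> nrm continuous_functions f"
    and "a < nrm continuous_functions f \<Longrightarrow> \<exists>x. a < cmod (f x)"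
    and "(\<And>x. cmod (f x) \<le> B) \<Longrightarrow> nrm continuous_functions f \<le> B"
proof -
  obtain b where "\<And>x. cmod (f x) \<le> b" using bounded_continuous[OF assms] by metis
  then have bdd: "bdd_above (range (\<lambda>x. cmod (f x)))" by (rule bdd_aboveI2)
  show "cmod (f x) \<le> nrm continuous_functions f"
    using bdd by (auto intro: cSUP_upper)
  show "\<exists>x. a < cmod (f x)" if "a < nrm continuous_functions f"
    using that less_cSUP_iff[OF _ bdd, of a] by auto
  show "nrm continuous_functions f \<le> B" if "\<And>x. cmod (f x) \<le> B"
    using that by (auto intro: cSUP_least)
qed

lemma in_unit_sphere_continuous:
  fixes f :: "'g \<Rightarrow> complex"
  assumes "continuous_everywhere f" "\<forall>t. cmod (f t) \<le> 1" "\<exists>t. cmod (f t) = 1"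
  shows "f \<in> unit_sphere continuous_functions"
proof -
  have "nrm continuous_functions f \<le> 1" using assms by (intro sup_norm(3)) auto
  moreover have "nrm continuous_functions f \<ge> 1" using assms(3) sup_norm(1)[OF assms(1)] by metis
  ultimately show ?thesis using assms(1) unfolding unit_sphere_def by simp
qed

lemma integral_in_dual_space:
  assumes v: "continuous_everywhere v"
  shows "(\<lambda>f. LINT t|m. v t * f t) \<in> dual_space continuous_functions"
proof -
  have vi: "integrable m v" by (rule integrable_continuous[OF v])
  have "cmod (LINT t|m. v t * f t) \<le> (LINT t|m. cmod (v t)) * nrm continuous_functions f"
    if f: "continuous_everywhere f" for f
    using integral_cmod_bound[OF vi continuous_imp_measurable[OF f] sup_norm(1)[OF f]]
    by (simp only: mult.commute)
  then have "\<exists>K. \<forall>f\<in>carrier continuous_functions.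
      nrm complex_scalars (LINT t|m. v t * f t) \<le> K * nrm continuous_functions f"
    by (intro exI[of _ "LINT t|m. cmod (v t)"]) (simp del: continuous_functions_simps(5))
  then show ?thesis
    unfolding dual_space_def bounded_operator_def
    by (simp add: distrib_left mult.left_commute integrable_mult_continuous vi)
qed

text \<open>The quotient norm of \<open>y - z\<close> being small means that some element of the
  annihilator is uniformly close to it; the sup norm of \<open>x + z\<close> being large means that
  its modulus is large at some point.\<close>

lemma rich_annihilator_if_rich_subspace:
  assumes \<Lambda>: "\<Lambda> \<subseteq> dual_group"
    and rich: "rich_subspace (continuous_with_spectrum m (dual_group - inverse_characters \<Lambda>)) continuous_functions"
  shows "rich_annihilator \<Lambda>"
  unfolding rich_annihilator_def
proof (intro allI impI)
  fix x y v :: "'g \<Rightarrow> complex" and \<delta> :: real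
  assume x: "continuous_everywhere x" "\<forall>t. cmod (x t) \<le> 1" "\<exists>t. cmod (x t) = 1"
    and y: "continuous_everywhere y" "\<forall>t. cmod (y t) \<le> 1" "\<exists>t. cmod (y t) = 1"
    and v: "continuous_everywhere v" and \<delta>: "\<delta> > 0"
  let ?C = "continuous_functions :: ('g \<Rightarrow> complex) normed_module"
  let ?\<phi> = "\<lambda>f. LINT t|m. v t * f t"
  let ?E = "quotient_space ?C (annihilator \<Lambda>)"
  have "narrow_operator ?C ?E (\<lambda>x. annihilator \<Lambda> +>\<^bsub>?C\<^esub> x)"
    using rich by (simp only: rich_subspace_def annihilator_eq_spectrum[OF \<Lambda>])
  \<comment> \<open>Narrowness is used with \<open>\<delta> / 2\<close>: passing from the infimum
    over the coset and from the supremum to actual witnesses requires strict inequalities.\<close>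
  then obtain z where z: "z \<in> unit_sphere ?C"
    and near: "nrm ?E (annihilator \<Lambda> +>\<^bsub>?C\<^esub> (y \<ominus>\<^bsub>?C\<^esub> z)) + cmod (?\<phi> (y \<ominus>\<^bsub>?C\<^esub> z)) \<le> \<delta> / 2"
    and far: "nrm ?C (x \<oplus>\<^bsub>?C\<^esub> z) \<ge> 2 - \<delta> / 2"
    unfolding narrow_operator_def
    using in_unit_sphere_continuous[OF x] in_unit_sphere_continuous[OF y] integral_in_dual_space[OF v] \<delta>
    by (meson half_gt_zero)
  have zc: "continuous_everywhere z" and z1: "nrm ?C z = 1"
    using z by (auto simp: unit_sphere_def simp del: continuous_functions_simps(5))
  have zle: "\<forall>t. cmod (z t) \<le> 1" using sup_norm(1)[OF zc] z1 by simp
  have yz: "y \<ominus>\<^bsub>?C\<^esub> z = (\<lambda>t. y t - z t)" by (rule continuous_functions_minus[OF y(1) zc])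
  define w where "w = (\<lambda>t. y t - z t)"
  have "annihilator \<Lambda> +>\<^bsub>?C\<^esub> w = (\<lambda>h t. h t + w t) ` annihilator \<Lambda>"
    by (auto simp: a_r_coset_def')
  then have nE: "nrm ?E (annihilator \<Lambda> +>\<^bsub>?C\<^esub> w) = (INF h\<in>annihilator \<Lambda>. nrm ?C (\<lambda>t. h t + w t))"
    by (simp add: quotient_space_def image_image)
  have "(\<lambda>_. 0) \<in> annihilator \<Lambda>" by (simp add: annihilator_def)
  then have ne: "annihilator \<Lambda> \<noteq> {}" by blast
  have "(INF h\<in>annihilator \<Lambda>. nrm ?C (\<lambda>t. h t + w t)) < \<delta>"
    using near \<delta> norm_ge_zero[of "?\<phi> w"] unfolding yz w_def[symmetric] nE by linarith
  then obtain h where h: "h \<in> annihilator \<Lambda>" "nrm ?C (\<lambda>t. h t + w t) < \<delta>"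
    using cInf_lessD[of "(\<lambda>h. nrm ?C (\<lambda>t. h t + w t)) ` annihilator \<Lambda>" \<delta>] ne by blast
  have hw: "continuous_everywhere (\<lambda>t. h t + w t)"
    using h(1) y(1) zc by (auto simp: annihilator_def w_def intro!: continuous_intros)
  \<comment> \<open>The coset of \<open>w\<close> consists of the sums \<open>h + w\<close>, so the
    element subtracted from \<open>y - z\<close> is the negative of \<open>h\<close>.\<close>
  have 1: "cmod (y t - z t - (- 1) * h t) \<le> \<delta>" for t
    using sup_norm(1)[OF hw, of t] h(2) by (simp add: w_def algebra_simps)
  have "0 \<le> nrm ?E (annihilator \<Lambda> +>\<^bsub>?C\<^esub> w)"
    unfolding nE
  proof (rule cINF_greatest[OF ne])
    fix h assume "h \<in> annihilator \<Lambda>"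
    then have "continuous_everywhere (\<lambda>t. h t + w t)"
      using y(1) zc by (auto simp: annihilator_def w_def intro!: continuous_intros)
    from sup_norm(1)[OF this, of 0] show "0 \<le> nrm ?C (\<lambda>t. h t + w t)"
      using norm_ge_zero order_trans by blast
  qed
  then have 2: "cmod (LINT t|m. v t * (y t - z t)) \<le> \<delta>"
    using near \<delta> unfolding yz w_def[symmetric] by (simp add: w_def)
  have xz: "continuous_everywhere (\<lambda>t. x t + z t)" by (intro continuous_intros x zc)
  have "2 - \<delta> < nrm ?C (\<lambda>t. x t + z t)" using far \<delta> by simp
  then have 3: "\<exists>t. cmod (x t + z t) \<ge> 2 - \<delta>" using sup_norm(2)[OF xz] less_imp_le by metis
  show "\<exists>z h. continuous_everywhere z \<and> (\<forall>t. cmod (z t) \<le> 1) \<and> h \<in> annihilator \<Lambda> \<and>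
    (\<forall>t. cmod (y t - z t - h t) \<le> \<delta>) \<and> cmod (LINT t|m. v t * (y t - z t)) \<le> \<delta> \<and>
    (\<exists>t. cmod (x t + z t) \<ge> 2 - \<delta>)"
    using zc zle annihilator_scale[OF h(1), of "- 1"] 1 2 3
    by (intro exI[of _ z] exI[of _ "\<lambda>t. (- 1) * h t"] conjI) auto
qed

lemma integrable_functions_seminormed: "complex_seminormed_space (integrable_functions m)"
proof (rule complex_seminormed_spaceI)
  show "abelian_group (integrable_functions m)"
  proof (rule abelian_groupI)
    fix f assume "f \<in> carrier (integrable_functions m)"
    then show "\<exists>g\<in>carrier (integrable_functions m).
        g \<oplus>\<^bsub>integrable_functions m\<^esub> f = \<zero>\<^bsub>integrable_functions m\<^esub>"
      by (intro bexI[of _ "\<lambda>x. - f x"]) auto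
  qed (auto simp: add_ac)
qed (auto simp: algebra_simps norm_mult L1_triangle)

lemma integrable_functions_minus:
  assumes "integrable m f" "integrable m g"
  shows "f \<ominus>\<^bsub>integrable_functions m\<^esub> g = (\<lambda>x. f x - g x)"
proof -
  interpret complex_seminormed_space "integrable_functions m" by (rule integrable_functions_seminormed)
  have "\<ominus>\<^bsub>integrable_functions m\<^esub> g = (\<lambda>x. - g x)" using smult_minus_one[of g] assms by simp
  then show ?thesis by (simp add: a_minus_def)
qed

text \<open>Riesz-Fischer. The norms of the increments are summable, so the series of increments
  converges absolutely almost everywhere, and its sum of moduli \<open>w\<close> dominates the
  convergence.\<close>

lemma L1_series_complete: "series_complete (integrable_functions m)"
  unfolding series_complete_def
proof (intro allI impI)
  fix S :: "nat \<Rightarrow> 'g \<Rightarrow> complex"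
  assume "\<forall>k. S k \<in> carrier (integrable_functions m)"
  then have S: "integrable m (S k)" for k by simp
  assume "\<forall>k. nrm (integrable_functions m) (S (Suc k) \<ominus>\<^bsub>integrable_functions m\<^esub> S k) < (1 / 2) ^ k"
  then have fast: "(LINT x|m. cmod (S (Suc k) x - S k x)) < (1 / 2) ^ k" for k
    by (simp add: integrable_functions_minus S)
  define z where "z k x = S (Suc k) x - S k x" for k x
  have z: "integrable m (z k)" for k unfolding z_def using S by simp
  have zn: "integrable m (\<lambda>x. cmod (z k x))" for k using z by simp
  have meas: "(\<lambda>x. ennreal (cmod (z k x))) \<in> borel_measurable m" for k
    using z[of k] by measurable
  have sum: "summable (\<lambda>k. LINT x|m. cmod (z k x))"
    by (rule summable_comparison_test'[where g="\<lambda>k. (1 / 2) ^ k" and N=0])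
      (use fast in \<open>auto simp: z_def summable_geometric less_imp_le\<close>)
  have "(\<integral>\<^sup>+x. (\<Sum>k. ennreal (cmod (z k x))) \<partial>m) = (\<Sum>k. \<integral>\<^sup>+x. ennreal (cmod (z k x)) \<partial>m)"
    using meas by (rule nn_integral_suminf)
  also have "\<dots> = (\<Sum>k. ennreal (LINT x|m. cmod (z k x)))"
    using zn by (simp add: nn_integral_eq_integral)
  also have "\<dots> = ennreal (\<Sum>k. LINT x|m. cmod (z k x))"
    by (rule suminf_ennreal2) (auto simp: sum)
  finally have "(\<integral>\<^sup>+x. (\<Sum>k. ennreal (cmod (z k x))) \<partial>m) \<noteq> \<infinity>" by simp
  moreover have "(\<lambda>x. \<Sum>k. ennreal (cmod (z k x))) \<in> borel_measurable m"
    using meas by measurable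
  ultimately have "AE x in m. (\<Sum>k. ennreal (cmod (z k x))) \<noteq> \<infinity>"
    by (intro nn_integral_PInf_AE)
  then have ae: "AE x in m. summable (\<lambda>k. cmod (z k x))"
    by eventually_elim (auto intro!: summable_suminf_not_top)
  define w where "w x = (\<Sum>k. cmod (z k x))" for x
  have wi: "integrable m w"
    unfolding w_def using ae sum zn by (intro integrable_suminf) auto
  \<comment> \<open>Where the series diverges, the value of \<open>suminf\<close> is arbitrary; this
    happens on a null set only.\<close>
  define l where "l x = S 0 x + (\<Sum>k. z k x)" for x
  have li: "integrable m l"
    unfolding l_def using ae sum z S by (intro Bochner_Integration.integrable_add integrable_suminf) auto
  have Sz: "S k x = S 0 x + (\<Sum>i<k. z i x)" for k x
    unfolding z_def using sum_lessThan_telescope[of "\<lambda>i. S i x" k] by simp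
  have "(\<lambda>k. LINT x|m. cmod (S k x - l x)) \<longlonglongrightarrow> (LINT x|m. (0::real))"
  proof (rule integral_dominated_convergence[where w="\<lambda>x. 2 * w x"])
    show "AE x in m. (\<lambda>k. cmod (S k x - l x)) \<longlonglongrightarrow> 0"
      using ae
    proof eventually_elim
      case (elim x)
      have "(\<lambda>k. \<Sum>i<k. z i x) \<longlonglongrightarrow> (\<Sum>i. z i x)"
        by (rule summable_LIMSEQ[OF summable_norm_cancel[OF elim]])
      then have "(\<lambda>k. S 0 x + (\<Sum>i<k. z i x)) \<longlonglongrightarrow> l x"
        unfolding l_def by (rule tendsto_add[OF tendsto_const])
      then have "(\<lambda>k. S k x) \<longlonglongrightarrow> l x" by (simp only: Sz[symmetric])
      then show ?case by (intro tendsto_norm_zero LIM_zero)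
    qed
    show "AE x in m. norm (cmod (S k x - l x)) \<le> 2 * w x" for k
      using ae
    proof eventually_elim
      case (elim x)
      have "cmod (\<Sum>i<k. z i x) \<le> (\<Sum>i<k. cmod (z i x))" by (rule norm_sum)
      also have "\<dots> \<le> w x" unfolding w_def using elim by (intro sum_le_suminf) auto
      finally have 1: "cmod (\<Sum>i<k. z i x) \<le> w x" .
      have 2: "cmod (\<Sum>i. z i x) \<le> w x" unfolding w_def using elim by (rule summable_norm)
      have "S k x - l x = (\<Sum>i<k. z i x) - (\<Sum>i. z i x)" by (simp add: Sz[of k] l_def)
      then show ?case using 1 2 norm_triangle_ineq4[of "\<Sum>i<k. z i x" "\<Sum>i. z i x"] by simp
    qed
    show "(\<lambda>x. cmod (S k x - l x)) \<in> borel_measurable m" for k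
      using S[of k] li by measurable
  qed (use wi in auto)
  then show "\<exists>l\<in>carrier (integrable_functions m).
      (\<lambda>k. nrm (integrable_functions m) (S k \<ominus>\<^bsub>integrable_functions m\<^esub> l)) \<longlonglongrightarrow> 0"
    using li by (intro bexI[of _ l]) (simp_all add: integrable_functions_minus S)
qed

section \<open>The two successive quotients, and the operator on the second\<close>

definition null_functions :: "('g \<Rightarrow> complex) set" where
  "null_functions = {f \<in> carrier (integrable_functions m). AE x in m. f x = 0}"

abbreviation L1_class :: "('g \<Rightarrow> complex) \<Rightarrow> ('g \<Rightarrow> complex) set" where
  "L1_class f \<equiv> null_functions +>\<^bsub>integrable_functions m\<^esub> f"

lemma null_quotient: "seminormed_quotient (integrable_functions m) null_functions"
proof -
  interpret complex_seminormed_space "integrable_functions m" by (rule integrable_functions_seminormed)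
  have "submodule null_functions complex_scalars (integrable_functions m)"
  proof (rule submoduleI)
    fix f assume "f \<in> null_functions"
    then show "\<ominus>\<^bsub>integrable_functions m\<^esub> f \<in> null_functions"
      by (simp add: null_functions_def smult_minus_one[symmetric])
  qed (auto simp: null_functions_def)
  then show ?thesis
    by (intro seminormed_quotient.intro seminormed_quotient_axioms.intro complex_seminormed_space_axioms)
qed

lemma L1_space_eq: "L1_space m = quotient_space (integrable_functions m) null_functions"
  by (simp add: L1_space_def null_functions_def)

text \<open>Null functions do not affect Fourier coefficients, so a single representative decides
  whether a class belongs.\<close>

lemma L1_with_spectrum_eq: "L1_with_spectrum m \<Lambda> = L1_class ` spectral_L1 \<Lambda>"
proof -
  interpret I: seminormed_quotient "integrable_functions m" null_functions by (rule null_quotient)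
  have fc: "fourier_coeff m g \<gamma> = fourier_coeff m f \<gamma>"
    if f: "integrable m f" and g: "g \<in> L1_class f" and \<gamma>: "\<gamma> \<in> dual_group" for f g \<gamma>
  proof -
    obtain h where h: "integrable m h" "AE x in m. h x = 0" "g = (\<lambda>x. h x + f x)"
      using g unfolding I.mem_coset by (auto simp: null_functions_def)
    have c: "continuous_everywhere (\<lambda>x. cnj (\<gamma> x))" by (intro continuous_intros dual_groupD[OF \<gamma>])
    show ?thesis
      unfolding fourier_coeff_def
    proof (rule integral_cong_AE)
      show "(\<lambda>x. g x * cnj (\<gamma> x)) \<in> borel_measurable m" "(\<lambda>x. f x * cnj (\<gamma> x)) \<in> borel_measurable m"
        using integrable_mult_continuous[OF _ c, of g] integrable_mult_continuous[OF f c] h(1) f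
        by (auto simp: h(3))
      show "AE x in m. g x * cnj (\<gamma> x) = f x * cnj (\<gamma> x)" using h(2) by eventually_elim (simp add: h(3))
    qed
  qed
  have "L1_class f \<in> L1_with_spectrum m \<Lambda> \<longleftrightarrow> f \<in> spectral_L1 \<Lambda>" if f: "integrable m f" for f
  proof
    assume "L1_class f \<in> L1_with_spectrum m \<Lambda>"
    then show "f \<in> spectral_L1 \<Lambda>"
      using I.a_rcos_self[of f] f by (auto simp: L1_with_spectrum_def spectral_L1_def)
  next
    assume "f \<in> spectral_L1 \<Lambda>"
    then show "L1_class f \<in> L1_with_spectrum m \<Lambda>"
      using f fc[OF f] by (auto simp: L1_with_spectrum_def spectral_L1_def L1_space_eq I.carrier_quotient)
  qed
  moreover have "L1_with_spectrum m \<Lambda> \<subseteq> L1_class ` {f. integrable m f}"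
    by (auto simp: L1_with_spectrum_def L1_space_eq I.carrier_quotient)
  moreover have "spectral_L1 \<Lambda> \<subseteq> {f. integrable m f}" by (auto simp: spectral_L1_def)
  ultimately show ?thesis by blast
qed

lemma spectral_quotient: "seminormed_quotient (L1_space m) (L1_with_spectrum m \<Lambda>)"
proof -
  interpret I: seminormed_quotient "integrable_functions m" null_functions by (rule null_quotient)
  interpret complex_seminormed_space "L1_space m"
    unfolding L1_space_eq by (rule I.quotient_seminormed)
  have si: "integrable m f" if "f \<in> spectral_L1 \<Lambda>" for f using that by (rule spectral_integrable)
  have scale: "c \<odot>\<^bsub>L1_space m\<^esub> A \<in> L1_with_spectrum m \<Lambda>" if A: "A \<in> L1_with_spectrum m \<Lambda>" for c A
  proof -
    obtain f where f: "f \<in> spectral_L1 \<Lambda>" "A = L1_class f" using A by (auto simp: L1_with_spectrum_eq)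
    then have "c \<odot>\<^bsub>L1_space m\<^esub> A = L1_class (\<lambda>x. c * f x)"
      using I.quotient_smult[of f c] si by (simp add: L1_space_eq)
    then show ?thesis using scale_spectral[OF f(1)] by (auto simp: L1_with_spectrum_eq)
  qed
  have "submodule (L1_with_spectrum m \<Lambda>) complex_scalars (L1_space m)"
  proof (rule submoduleI)
    show sub: "L1_with_spectrum m \<Lambda> \<subseteq> carrier (L1_space m)" by (auto simp: L1_with_spectrum_def)
    show "\<zero>\<^bsub>L1_space m\<^esub> \<in> L1_with_spectrum m \<Lambda>"
      using zero_spectral[of \<Lambda>] I.quotient_zero by (auto simp: L1_with_spectrum_eq L1_space_eq)
    fix A assume A: "A \<in> L1_with_spectrum m \<Lambda>"
    then show "\<ominus>\<^bsub>L1_space m\<^esub> A \<in> L1_with_spectrum m \<Lambda>"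
      using scale[OF A, of "- 1"] smult_minus_one[of A] sub by auto
    show "c \<odot>\<^bsub>L1_space m\<^esub> A \<in> L1_with_spectrum m \<Lambda>" for c by (rule scale[OF A])
    fix B assume B: "B \<in> L1_with_spectrum m \<Lambda>"
    obtain f g where f: "f \<in> spectral_L1 \<Lambda>" "A = L1_class f" and g: "g \<in> spectral_L1 \<Lambda>" "B = L1_class g"
      using A B by (auto simp: L1_with_spectrum_eq)
    then have "A \<oplus>\<^bsub>L1_space m\<^esub> B = L1_class (\<lambda>x. f x + g x)"
      using I.quotient_add[of f g] si by (simp add: L1_space_eq)
    then show "A \<oplus>\<^bsub>L1_space m\<^esub> B \<in> L1_with_spectrum m \<Lambda>"
      using add_spectral[OF f(1) g(1)] by (auto simp: L1_with_spectrum_eq)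
  qed
  then show ?thesis
    by (intro seminormed_quotient.intro seminormed_quotient_axioms.intro complex_seminormed_space_axioms)
qed

abbreviation "L1_quotient \<Lambda> \<equiv> quotient_space (L1_space m) (L1_with_spectrum m \<Lambda>)"

definition quotient_class :: "('g \<Rightarrow> complex) set \<Rightarrow> ('g \<Rightarrow> complex) \<Rightarrow> ('g \<Rightarrow> complex) set set" where
  "quotient_class \<Lambda> f = L1_with_spectrum m \<Lambda> +>\<^bsub>L1_space m\<^esub> L1_class f"

text \<open>The interface to the double quotient, through which operators on classes become maps on
  integrable functions. The two nested infima, over spectral classes and over null functions,
  collapse into the one that defines \<open>dist_L1\<close>.\<close>

lemma
  shows carrier_L1_quotient: "carrier (L1_quotient \<Lambda>) = quotient_class \<Lambda> ` {f. integrable m f}"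
    and quotient_class_add: "integrable m f \<Longrightarrow> integrable m g \<Longrightarrow>
      quotient_class \<Lambda> f \<oplus>\<^bsub>L1_quotient \<Lambda>\<^esub> quotient_class \<Lambda> g = quotient_class \<Lambda> (\<lambda>x. f x + g x)"
    and quotient_class_scale: "integrable m f \<Longrightarrow>
      c \<odot>\<^bsub>L1_quotient \<Lambda>\<^esub> quotient_class \<Lambda> f = quotient_class \<Lambda> (\<lambda>x. c * f x)"
    and quotient_class_nrm: "integrable m f \<Longrightarrow> nrm (L1_quotient \<Lambda>) (quotient_class \<Lambda> f) = dist_L1 \<Lambda> f"
proof -
  interpret I: seminormed_quotient "integrable_functions m" null_functions by (rule null_quotient)
  interpret J: seminormed_quotient "L1_space m" "L1_with_spectrum m \<Lambda>" by (rule spectral_quotient)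
  have c: "L1_class f \<in> carrier (L1_space m)" if "integrable m f" for f
    using that by (simp add: L1_space_eq I.carrier_quotient)
  have add: "L1_class f \<oplus>\<^bsub>L1_space m\<^esub> L1_class g = L1_class (\<lambda>x. f x + g x)" if "integrable m f" "integrable m g" for f g
    using I.quotient_add[of f g] that by (simp add: L1_space_eq)
  show "carrier (L1_quotient \<Lambda>) = quotient_class \<Lambda> ` {f. integrable m f}"
    unfolding J.carrier_quotient quotient_class_def by (simp add: L1_space_eq I.carrier_quotient image_image)
  show "quotient_class \<Lambda> f \<oplus>\<^bsub>L1_quotient \<Lambda>\<^esub> quotient_class \<Lambda> g = quotient_class \<Lambda> (\<lambda>x. f x + g x)"
    if "integrable m f" "integrable m g" for f g
    unfolding quotient_class_def J.quotient_add[OF c[OF that(1)] c[OF that(2)]] add[OF that] ..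
  show "c \<odot>\<^bsub>L1_quotient \<Lambda>\<^esub> quotient_class \<Lambda> f = quotient_class \<Lambda> (\<lambda>x. c * f x)" if f: "integrable m f" for c f
  proof -
    have "c \<odot>\<^bsub>L1_space m\<^esub> L1_class f = L1_class (\<lambda>x. c * f x)"
      using I.quotient_smult[of f c] f by (simp add: L1_space_eq)
    then show ?thesis unfolding quotient_class_def J.quotient_smult[OF c[OF f]] by simp
  qed
  show "nrm (L1_quotient \<Lambda>) (quotient_class \<Lambda> f) = dist_L1 \<Lambda> f" if f: "integrable m f" for f
  proof (rule antisym)
    show "nrm (L1_quotient \<Lambda>) (quotient_class \<Lambda> f) \<le> dist_L1 \<Lambda> f"
    proof (rule field_le_epsilon)
      fix e :: real assume "e > 0"
      then obtain g where g: "g \<in> spectral_L1 \<Lambda>" "(LINT x|m. cmod (f x + g x)) < dist_L1 \<Lambda> f + e"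
        by (rule dist_L1_approx)
      have gi: "integrable m g" using g(1) by (rule spectral_integrable)
      have "nrm (L1_quotient \<Lambda>) (quotient_class \<Lambda> f) \<le> nrm (L1_space m) (L1_class g \<oplus>\<^bsub>L1_space m\<^esub> L1_class f)"
        unfolding quotient_class_def using g(1)
        by (intro J.quotient_nrm_le c[OF f]) (auto simp: L1_with_spectrum_eq)
      also have "\<dots> = nrm (L1_space m) (L1_class (\<lambda>x. g x + f x))" by (simp add: add[OF gi f])
      also have "\<dots> \<le> (LINT x|m. cmod (g x + f x))"
        using I.quotient_nrm_le_self[of "\<lambda>x. g x + f x"] gi f by (simp add: L1_space_eq)
      finally show "nrm (L1_quotient \<Lambda>) (quotient_class \<Lambda> f) \<le> dist_L1 \<Lambda> f + e"
        using g(2) by (simp add: add.commute)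
    qed
    show "dist_L1 \<Lambda> f \<le> nrm (L1_quotient \<Lambda>) (quotient_class \<Lambda> f)"
    proof (rule field_le_epsilon)
      fix e :: real assume "e > 0"
      then have "nrm (L1_quotient \<Lambda>) (L1_with_spectrum m \<Lambda> +>\<^bsub>L1_space m\<^esub> L1_class f)
          < nrm (L1_quotient \<Lambda>) (quotient_class \<Lambda> f) + e" by (simp add: quotient_class_def)
      then obtain G where G: "G \<in> L1_with_spectrum m \<Lambda>"
        "nrm (L1_space m) (G \<oplus>\<^bsub>L1_space m\<^esub> L1_class f) < nrm (L1_quotient \<Lambda>) (quotient_class \<Lambda> f) + e"
        by (rule J.quotient_nrm_less)
      then obtain g where g: "g \<in> spectral_L1 \<Lambda>" "G = L1_class g" by (auto simp: L1_with_spectrum_eq)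
      have gi: "integrable m g" using g(1) by (rule spectral_integrable)
      have "nrm (quotient_space (integrable_functions m) null_functions) (L1_class (\<lambda>x. g x + f x))
          < nrm (L1_quotient \<Lambda>) (quotient_class \<Lambda> f) + e"
        using G(2) unfolding g(2) add[OF gi f] unfolding L1_space_eq .
      then obtain h where h: "h \<in> null_functions"
        "nrm (integrable_functions m) (h \<oplus>\<^bsub>integrable_functions m\<^esub> (\<lambda>x. g x + f x)) < nrm (L1_quotient \<Lambda>) (quotient_class \<Lambda> f) + e"
        by (rule I.quotient_nrm_less)
      have hi: "integrable m h" "AE x in m. h x = 0" using h(1) by (auto simp: null_functions_def)
      have "dist_L1 \<Lambda> f \<le> (LINT x|m. cmod (f x + g x))" by (rule dist_L1_le[OF g(1)])
      also have "\<dots> = (LINT x|m. cmod (h x + (g x + f x)))"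
      proof (rule integral_cong_AE)
        show "(\<lambda>x. cmod (f x + g x)) \<in> borel_measurable m" "(\<lambda>x. cmod (h x + (g x + f x))) \<in> borel_measurable m"
          using f gi hi(1) by measurable
        show "AE x in m. cmod (f x + g x) = cmod (h x + (g x + f x))"
          using hi(2) by eventually_elim (simp add: add.commute)
      qed
      finally show "dist_L1 \<Lambda> f \<le> nrm (L1_quotient \<Lambda>) (quotient_class \<Lambda> f) + e" using h(2) by simp
    qed
  qed
qed

text \<open>Definiteness amounts to closedness of \<open>spectral_L1 \<Lambda>\<close>: a Fourier
  coefficient off \<open>\<Lambda>\<close> ignores spectral functions and is therefore bounded by
  \<open>dist_L1\<close>. Completeness descends through both quotients.\<close>

lemma L1_quotient_banach: "complex_banach_space (L1_quotient \<Lambda>)"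
proof -
  interpret I: seminormed_quotient "integrable_functions m" null_functions by (rule null_quotient)
  interpret J: seminormed_quotient "L1_space m" "L1_with_spectrum m \<Lambda>" by (rule spectral_quotient)
  interpret Q: complex_seminormed_space "L1_quotient \<Lambda>" by (rule J.quotient_seminormed)
  show ?thesis
  proof (rule Q.banach_if_series_complete)
    show "series_complete (L1_quotient \<Lambda>)"
      using J.quotient_series_complete I.quotient_series_complete[OF L1_series_complete]
      by (simp add: L1_space_eq)
    fix A assume "A \<in> carrier (L1_quotient \<Lambda>)" and A0: "nrm (L1_quotient \<Lambda>) A = 0"
    then obtain f where f: "integrable m f" "A = quotient_class \<Lambda> f" by (auto simp: carrier_L1_quotient)
    then have d: "dist_L1 \<Lambda> f = 0" using A0 quotient_class_nrm[where f=f and \<Lambda>=\<Lambda>] by simp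
    have "fourier_coeff m f \<gamma> = 0" if \<gamma>: "\<gamma> \<in> dual_group - \<Lambda>" for \<gamma>
    proof -
      have \<gamma>d: "\<gamma> \<in> dual_group" using \<gamma> by blast
      have "cmod (fourier_coeff m f \<gamma>) \<le> dist_L1 \<Lambda> f"
        unfolding dist_L1_def
      proof (rule cINF_greatest)
        show "spectral_L1 \<Lambda> \<noteq> {}" using zero_spectral by blast
        fix g assume g: "g \<in> spectral_L1 \<Lambda>"
        have gi: "integrable m g" using g by (rule spectral_integrable)
        have "fourier_coeff m g \<gamma> = 0" using g \<gamma> by (auto simp: spectral_L1_def)
        then have "fourier_coeff m f \<gamma> = (LINT x|m. (f x + g x) * cnj (\<gamma> x))"
          using character_mult_integrable[OF f(1) \<gamma>d] character_mult_integrable[OF gi \<gamma>d]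
          by (simp add: fourier_coeff_def distrib_right)
        also have "cmod \<dots> \<le> 1 * (LINT x|m. cmod (f x + g x))"
          using f(1) gi dual_groupD[OF \<gamma>d]
          by (intro integral_cmod_bound continuous_imp_measurable continuous_on_cnj) auto
        finally show "cmod (fourier_coeff m f \<gamma>) \<le> (LINT x|m. cmod (f x + g x))" by simp
      qed
      then show ?thesis using d by simp
    qed
    then have "f \<in> spectral_L1 \<Lambda>" using f(1) by (simp add: spectral_L1_def)
    then have "L1_class f \<in> L1_with_spectrum m \<Lambda>" by (simp add: L1_with_spectrum_eq)
    then show "A = \<zero>\<^bsub>L1_quotient \<Lambda>\<^esub>"
      unfolding f(2) quotient_class_def by (simp add: J.a_rcos_const quotient_space_def)
  qed
qed

text \<open>The operator is written as \<open>\<phi>\<close> times a vector of norm 1, with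
  \<open>\<phi>\<close> acting on integrable functions; its operator norm is then the norm of
  \<open>\<phi>\<close>. The triangle inequality gives one direction and
  \<open>daugavet_estimate\<close> the other.\<close>

lemma L1_quotient_daugavet:
  assumes \<Lambda>: "\<Lambda> \<subseteq> dual_group" and rich: "rich_annihilator \<Lambda>"
  shows "daugavet_property (L1_quotient \<Lambda>)"
  unfolding daugavet_property_def
proof (intro conjI allI impI)
  let ?Q = "L1_quotient \<Lambda>"
  show "complex_banach_space ?Q" by (rule L1_quotient_banach)
  then interpret Q: complex_banach_space ?Q .
  fix T assume "bounded_operator ?Q ?Q T \<and> rank_one ?Q ?Q T"
  then have bop: "bounded_operator ?Q ?Q T" and "rank_one ?Q ?Q T" by auto
  then obtain U where U: "U \<in> carrier ?Q" "U \<noteq> \<zero>\<^bsub>?Q\<^esub>" "T ` carrier ?Q = range (\<lambda>c. c \<odot>\<^bsub>?Q\<^esub> U)"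
    by (auto simp: rank_one_def)
  have Tc: "T x \<in> carrier ?Q" and Tadd: "y \<in> carrier ?Q \<Longrightarrow> T (x \<oplus>\<^bsub>?Q\<^esub> y) = T x \<oplus>\<^bsub>?Q\<^esub> T y"
    and Tscale: "T (c \<odot>\<^bsub>?Q\<^esub> x) = c \<odot>\<^bsub>?Q\<^esub> T x" if "x \<in> carrier ?Q" for x y c
    using bop that unfolding bounded_operator_def by blast+
  obtain K where K: "\<And>x. x \<in> carrier ?Q \<Longrightarrow> nrm ?Q (T x) \<le> K * nrm ?Q x"
    using bop unfolding bounded_operator_def by blast
  let ?B = "{x \<in> carrier ?Q. nrm ?Q x \<le> 1}"
  define \<tau> where "\<tau> = operator_norm ?Q ?Q T"
  have zB: "\<zero>\<^bsub>?Q\<^esub> \<in> ?B" using Q.nrm_eq_0[of "\<zero>\<^bsub>?Q\<^esub>"] by simp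
  have K1: "nrm ?Q (T x) \<le> \<bar>K\<bar>" if "x \<in> ?B" for x
  proof -
    have "K * nrm ?Q x \<le> \<bar>K\<bar> * 1" using that Q.nrm_nonneg[of x] by (intro mult_mono) auto
    then show ?thesis using K[of x] that by simp
  qed
  have bdd: "bdd_above ((\<lambda>x. nrm ?Q (T x)) ` ?B)" using K1 by (intro bdd_aboveI2) auto
  have \<tau>ge: "nrm ?Q (T x) \<le> \<tau>" if "x \<in> ?B" for x
    unfolding \<tau>_def operator_norm_def using bdd that by (intro cSUP_upper) auto
  have cl: "quotient_class \<Lambda> f \<in> carrier ?Q" if "integrable m f" for f
    using that by (simp add: carrier_L1_quotient)
  obtain u0 where u0: "integrable m u0" "U = quotient_class \<Lambda> u0" using U(1) by (auto simp: carrier_L1_quotient)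
  define n where "n = dist_L1 \<Lambda> u0"
  have "nrm ?Q U = n" using quotient_class_nrm[OF u0(1)] u0(2) by (simp add: n_def)
  then have n: "n > 0" using U(1,2) Q.nrm_eq_0[OF U(1)] Q.nrm_nonneg[OF U(1)] by linarith
  define u where "u = (\<lambda>x. complex_of_real (1 / n) * u0 x)"
  have ui: "integrable m u" unfolding u_def using u0(1) by simp
  have uU: "quotient_class \<Lambda> u = complex_of_real (1 / n) \<odot>\<^bsub>?Q\<^esub> U"
    unfolding u_def u0(2) by (rule quotient_class_scale[OF u0(1), symmetric])
  have ud: "dist_L1 \<Lambda> u = 1"
    using Q.nrm_smult[OF U(1), of "complex_of_real (1 / n)"] \<open>nrm ?Q U = n\<close> n
    unfolding uU[symmetric] quotient_class_nrm[OF ui] by (simp add: norm_divide)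
  have ex: "\<exists>c. T (quotient_class \<Lambda> f) = quotient_class \<Lambda> (\<lambda>x. c * u x)" if f: "integrable m f" for f
  proof -
    obtain c where c: "T (quotient_class \<Lambda> f) = c \<odot>\<^bsub>?Q\<^esub> U" using U(3) cl[OF f] by blast
    have "(\<lambda>x. c * complex_of_real n * u x) = (\<lambda>x. c * u0 x)" using n by (simp add: u_def)
    then show ?thesis using c quotient_class_scale[OF u0(1), where c=c and \<Lambda>=\<Lambda>] u0(2) by metis
  qed
  \<comment> \<open>Such a scalar exists because the range of \<open>T\<close> consists of multiples
    of \<open>U\<close>. It is unique, as the class of \<open>u\<close> has norm 1, and linearity of
    \<open>\<phi>\<close> comes from uniqueness.\<close>
  define \<phi> where "\<phi> f = (SOME c. T (quotient_class \<Lambda> f) = quotient_class \<Lambda> (\<lambda>x. c * u x))" for f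
  have \<phi>: "T (quotient_class \<Lambda> f) = quotient_class \<Lambda> (\<lambda>x. \<phi> f * u x)" if "integrable m f" for f
    unfolding \<phi>_def by (rule someI_ex[OF ex[OF that]])
  have dist_cu: "dist_L1 \<Lambda> (\<lambda>x. c * u x) = cmod c" for c
    using Q.nrm_smult[OF cl[OF ui], of c] quotient_class_scale[OF ui, where c=c and \<Lambda>=\<Lambda>]
      quotient_class_nrm[where f="\<lambda>x. c * u x" and \<Lambda>=\<Lambda>] quotient_class_nrm[OF ui, of \<Lambda>] ui ud by simp
  have uniq: "c = d" if eq: "quotient_class \<Lambda> (\<lambda>x. c * u x) = quotient_class \<Lambda> (\<lambda>x. d * u x)" for c d
  proof -
    have sum: "quotient_class \<Lambda> (\<lambda>x. b * u x) \<oplus>\<^bsub>?Q\<^esub> quotient_class \<Lambda> (\<lambda>x. (- d) * u x)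
        = quotient_class \<Lambda> (\<lambda>x. (b - d) * u x)" for b
      using quotient_class_add[where f="\<lambda>x. b * u x" and g="\<lambda>x. (- d) * u x" and \<Lambda>=\<Lambda>] ui by (simp add: left_diff_distrib)
    have "quotient_class \<Lambda> (\<lambda>x. (c - d) * u x) = quotient_class \<Lambda> (\<lambda>x. (d - d) * u x)"
      using sum[of c] sum[of d] eq by simp
    then have "dist_L1 \<Lambda> (\<lambda>x. (c - d) * u x) = dist_L1 \<Lambda> (\<lambda>x. (d - d) * u x)"
      using quotient_class_nrm[where f="\<lambda>x. (c - d) * u x" and \<Lambda>=\<Lambda>] quotient_class_nrm[where f="\<lambda>x. (d - d) * u x" and \<Lambda>=\<Lambda>] ui by simp
    then show ?thesis unfolding dist_cu by simp
  qed
  have \<phi>add: "\<phi> (\<lambda>x. f x + g x) = \<phi> f + \<phi> g" if f: "integrable m f" and g: "integrable m g" for f g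
  proof (rule uniq)
    have "quotient_class \<Lambda> (\<lambda>x. \<phi> (\<lambda>x. f x + g x) * u x) = T (quotient_class \<Lambda> f \<oplus>\<^bsub>?Q\<^esub> quotient_class \<Lambda> g)"
      using \<phi>[of "\<lambda>x. f x + g x"] f g quotient_class_add[OF f g, of \<Lambda>] by simp
    also have "\<dots> = quotient_class \<Lambda> (\<lambda>x. \<phi> f * u x + \<phi> g * u x)"
      using Tadd[OF cl[OF f] cl[OF g]] \<phi>[OF f] \<phi>[OF g] quotient_class_add[where f="\<lambda>x. \<phi> f * u x" and g="\<lambda>x. \<phi> g * u x" and \<Lambda>=\<Lambda>] ui by simp
    finally show "quotient_class \<Lambda> (\<lambda>x. \<phi> (\<lambda>x. f x + g x) * u x) = quotient_class \<Lambda> (\<lambda>x. (\<phi> f + \<phi> g) * u x)"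
      by (simp add: distrib_right)
  qed
  have \<phi>scale: "\<phi> (\<lambda>x. c * f x) = c * \<phi> f" if f: "integrable m f" for c f
  proof (rule uniq)
    have "quotient_class \<Lambda> (\<lambda>x. \<phi> (\<lambda>x. c * f x) * u x) = T (c \<odot>\<^bsub>?Q\<^esub> quotient_class \<Lambda> f)"
      using \<phi>[of "\<lambda>x. c * f x"] f quotient_class_scale[OF f, where c=c and \<Lambda>=\<Lambda>] by simp
    also have "\<dots> = quotient_class \<Lambda> (\<lambda>x. c * (\<phi> f * u x))"
      using Tscale[OF cl[OF f]] \<phi>[OF f] quotient_class_scale[where f="\<lambda>x. \<phi> f * u x" and c=c and \<Lambda>=\<Lambda>] ui by simp
    finally show "quotient_class \<Lambda> (\<lambda>x. \<phi> (\<lambda>x. c * f x) * u x) = quotient_class \<Lambda> (\<lambda>x. (c * \<phi> f) * u x)"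
      by (simp add: mult.assoc)
  qed
  have T\<phi>: "nrm ?Q (T (quotient_class \<Lambda> f)) = cmod (\<phi> f)" if "integrable m f" for f
    unfolding \<phi>[OF that] using quotient_class_nrm[where f="\<lambda>x. \<phi> f * u x" and \<Lambda>=\<Lambda>] ui dist_cu by simp
  have \<phi>bound: "cmod (\<phi> f) \<le> \<tau> * dist_L1 \<Lambda> f" if f: "integrable m f" for f
  proof (cases "dist_L1 \<Lambda> f = 0")
    case True
    \<comment> \<open>A function at distance 0 cannot be scaled to distance 1, so the boundedness
      constant \<open>K\<close> is used in place of the supremum \<open>\<tau>\<close>.\<close>
    then show ?thesis using K[OF cl[OF f]] T\<phi>[OF f] quotient_class_nrm[OF f, of \<Lambda>] by simp
  next
    case False
    define d where "d = dist_L1 \<Lambda> f"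
    have d: "d > 0" using False dist_L1_nonneg[of \<Lambda> f] by (simp add: d_def)
    have gi: "integrable m (\<lambda>x. complex_of_real (1 / d) * f x)" using f by simp
    have "dist_L1 \<Lambda> (\<lambda>x. complex_of_real (1 / d) * f x) \<le> 1"
      using dist_L1_scale_le[of \<Lambda> "complex_of_real (1 / d)" f] d by (simp add: norm_divide d_def[symmetric])
    then have "cmod (\<phi> (\<lambda>x. complex_of_real (1 / d) * f x)) \<le> \<tau>"
      using \<tau>ge[of "quotient_class \<Lambda> (\<lambda>x. complex_of_real (1 / d) * f x)"] cl[OF gi] T\<phi>[OF gi]
        quotient_class_nrm[OF gi, of \<Lambda>] by simp
    then show ?thesis using d unfolding \<phi>scale[OF f] by (simp add: norm_mult norm_divide field_simps d_def[symmetric])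
  qed
  have \<phi>sup: "\<exists>f. integrable m f \<and> dist_L1 \<Lambda> f \<le> 1 \<and> cmod (\<phi> f) > \<tau> - \<delta>" if "\<delta> > 0" for \<delta>
  proof -
    have "\<tau> - \<delta> < Sup ((\<lambda>x. nrm ?Q (T x)) ` ?B)" using that by (simp add: \<tau>_def operator_norm_def)
    then obtain x where x: "x \<in> ?B" "\<tau> - \<delta> < nrm ?Q (T x)"
      using less_cSUP_iff[OF _ bdd] zB by blast
    then obtain f where "integrable m f" "x = quotient_class \<Lambda> f" by (auto simp: carrier_L1_quotient)
    then show ?thesis using x T\<phi>[of f] quotient_class_nrm[where f=f and \<Lambda>=\<Lambda>] by (intro exI[of _ f]) auto
  qed
  have \<tau>pos: "\<tau> > 0"
  proof (rule ccontr)
    assume "\<not> ?thesis"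
    have "1 \<odot>\<^bsub>?Q\<^esub> U \<in> T ` carrier ?Q" unfolding U(3) by blast
    then obtain x where x: "x \<in> carrier ?Q" "T x = U" using Q.smult_one[OF U(1)] by auto
    then obtain f where f: "integrable m f" "x = quotient_class \<Lambda> f" by (auto simp: carrier_L1_quotient)
    have "n = cmod (\<phi> f)" using T\<phi>[OF f(1)] f(2) x(2) \<open>nrm ?Q U = n\<close> by simp
    also have "\<dots> \<le> 0" using \<phi>bound[OF f(1)] dist_L1_nonneg[of \<Lambda> f] \<open>\<not> \<tau> > 0\<close>
      by (meson mult_nonpos_nonneg not_less order_trans)
    finally show False using n by simp
  qed
  have upper: "nrm ?Q (x \<oplus>\<^bsub>?Q\<^esub> T x) \<le> 1 + \<tau>" if "x \<in> ?B" for x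
    using Q.nrm_triangle[of x "T x"] Tc[of x] \<tau>ge[OF that] that by simp
  have bdd': "bdd_above ((\<lambda>x. nrm ?Q (x \<oplus>\<^bsub>?Q\<^esub> T x)) ` ?B)" using upper by (intro bdd_aboveI2) auto
  have "operator_norm ?Q ?Q (\<lambda>x. x \<oplus>\<^bsub>?Q\<^esub> T x) \<le> 1 + \<tau>"
    unfolding operator_norm_def using upper zB by (intro cSUP_least) blast+
  moreover have "1 + \<tau> \<le> operator_norm ?Q ?Q (\<lambda>x. x \<oplus>\<^bsub>?Q\<^esub> T x)"
  proof (rule field_le_epsilon)
    fix \<eta> :: real assume \<eta>: "\<eta> > 0"
    obtain f where f: "integrable m f" "dist_L1 \<Lambda> f \<le> 1" "dist_L1 \<Lambda> (\<lambda>x. f x + \<phi> f * u x) \<ge> 1 + \<tau> - \<eta>"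
      using daugavet_estimate[OF \<Lambda> rich \<phi>add \<phi>scale \<phi>bound \<phi>sup \<tau>pos ui ud \<eta>] by blast
    define x where "x = quotient_class \<Lambda> f"
    have xB: "x \<in> ?B" using f(1,2) cl[OF f(1)] quotient_class_nrm[OF f(1), of \<Lambda>] by (simp add: x_def)
    have "x \<oplus>\<^bsub>?Q\<^esub> T x = quotient_class \<Lambda> (\<lambda>x. f x + \<phi> f * u x)"
      unfolding x_def \<phi>[OF f(1)] using quotient_class_add[OF f(1), where g="\<lambda>x. \<phi> f * u x" and \<Lambda>=\<Lambda>] ui by simp
    then have "nrm ?Q (x \<oplus>\<^bsub>?Q\<^esub> T x) = dist_L1 \<Lambda> (\<lambda>x. f x + \<phi> f * u x)"
      using quotient_class_nrm[where f="\<lambda>x. f x + \<phi> f * u x" and \<Lambda>=\<Lambda>] f(1) ui by simp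
    moreover have "nrm ?Q (x \<oplus>\<^bsub>?Q\<^esub> T x) \<le> operator_norm ?Q ?Q (\<lambda>x. x \<oplus>\<^bsub>?Q\<^esub> T x)"
      unfolding operator_norm_def using bdd' xB by (intro cSUP_upper) auto
    ultimately show "1 + \<tau> \<le> operator_norm ?Q ?Q (\<lambda>x. x \<oplus>\<^bsub>?Q\<^esub> T x) + \<eta>" using f(3) by simp
  qed
  ultimately show "operator_norm ?Q ?Q (\<lambda>x. x \<oplus>\<^bsub>?Q\<^esub> T x) = 1 + operator_norm ?Q ?Q T"
    unfolding \<tau>_def by (rule antisym)
qed

end

theorem theorem6p4:
  fixes m :: "'g::{topological_ab_group_add, t2_space} measure"
    and \<Lambda> :: "('g \<Rightarrow> complex) set"
  assumes "compact (UNIV :: 'g set)"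
    and "infinite (UNIV :: 'g set)"
    and "normalized_haar_measure m"
    and "\<Lambda> \<subseteq> dual_group"
    and "rich_subspace (continuous_with_spectrum m (dual_group - inverse_characters \<Lambda>))
           continuous_functions"
  shows "daugavet_property (quotient_space (L1_space m) (L1_with_spectrum m \<Lambda>))"
proof -
  interpret haar_group m by (rule haar_group.intro) (fact assms(1) assms(3))+
  show ?thesis
    by (rule L1_quotient_daugavet[OF assms(4) rich_annihilator_if_rich_subspace[OF assms(4,5)]])
qed

end
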